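(* Let $n\geq 1$, let $U\subseteq\mathcal{M}_n$ be a domain (nonempty connected open set) containing the null matrix, and let $F:U\rightarrow\mathcal{M}_n$ be a function of class $\mathcal{C}^1$ (in the real sense) with $F(0)=0$ such that $$\rho(F(x)-F(y))=\rho(x-y)\qquad (x,y\in U).$$ Then there exist $\gamma\in\mathbb{C}$ with $|\gamma|=1$ and an invertible $u\in\mathcal{M}_n$ such that, with $H$ equal to either $\gamma^{-1}F$ or $\gamma^{-1}\overline{F}$, one has either $H(x)=uxu^{-1}$ for all $x\in U$, or $H(x)=ux^tu^{-1}$ for all $x\in U$.
   Context: $\mathcal{M}_n$ denotes the space of all complex $n\times n$ matrices. For $x\in\mathcal{M}_n$, $\rho(x)$ denotes its spectral radius (the maximum modulus of its eigenvalues) and $x^t$ its transpose. The map $\overline{F}:U\to\mathcal{M}_n$ is defined by $\overline{F}(x)=\overline{F(x)}$, the matrix obtained from $F(x)$ by entrywise complex conjugation. *)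

theory Defs
  imports "HOL-Analysis.Analysis"
begin

definition eigenvalues :: "complex^'n^'n \<Rightarrow> complex set" where
  "eigenvalues A = {c. \<exists>v. v \<noteq> 0 \<and> A *v v = c *s v}"

definition spec_rad :: "complex^'n^'n \<Rightarrow> real" where
  "spec_rad A = Max (cmod ` eigenvalues A)"

definition mscale :: "complex \<Rightarrow> complex^'n^'m \<Rightarrow> complex^'n^'m" where
  "mscale c A = (\<chi> i j. c * A $ i $ j)"

definition mcnj :: "complex^'n^'m \<Rightarrow> complex^'n^'m" where
  "mcnj A = (\<chi> i j. cnj (A $ i $ j))"

end

theory Submission
  imports Defs "HOL-Complex_Analysis.Great_Picard" "HOL-Computational_Algebra.Fundamental_Theorem_Algebra"
begin

text \<open>
  The derivative \<open>T\<close> of \<open>F\<close> at \<open>0\<close> preserves the spectral radius because the spectral radius is continuous,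
  and \<open>T\<close> is injective because a nonzero matrix can be detected by adding nilpotents. So it suffices to
  show that \<open>G = T\<^sup>-\<^sup>1 \<circ> F\<close> is the identity and to determine \<open>T\<close>.

  Both parts rest on one first-order test. Let \<open>z\<close> have a strictly dominant eigenvalue, let \<open>w\<close> be its image
  and \<open>v\<close> an eigenvector of \<open>w\<close> to an eigenvalue of maximal modulus. Near \<open>z\<close> the spectral radius is
  differentiable, while along every perturbation of \<open>w\<close> that keeps \<open>v\<close> an eigenvector it is bounded below
  by a function with a known derivative. Comparing the two determines \<open>v\<close>.

  For \<open>G\<close> this shows: if \<open>a\<close> is a fixed point with \<open>G'(a) = id\<close>, then \<open>G(a + z)\<close> and \<open>a + z\<close> agree on every dominant
  eigenvector of \<open>z\<close>. If all eigenvalues of \<open>z\<close> are distinct and have the same modulus, every eigenvector is a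
  limit of dominant ones, so \<open>a + z\<close> is again such a fixed point. Such \<open>z\<close> span the matrices over the reals,
  so the set of these fixed points is open and closed in \<open>U\<close>.

  For \<open>T\<close> it shows that the adjoint \<open>S\<close> of \<open>T\<^sup>-\<^sup>1\<close> maps matrices of rank one to matrices of rank one and
  preserves the modulus of their trace. Hence \<open>S\<close> is, up to transposition and conjugation, of the
  form \<open>x \<mapsto> B x C\<close>, and the trace condition makes \<open>C\<close> a unimodular multiple of \<open>B\<^sup>-\<^sup>1\<close>.
\<close>

section \<open>The spectral radius\<close>

text \<open>The obstacle is multiplicity: the eigenvalue of maximal modulus of the image
  \<open>w\<close> may be repeated, so the spectral radius need not be differentiable there. Only a
  one-sided comparison is possible, and it is made strong by a rich supply of perturbations:
  \<open>outer v g\<close> has the eigenvector \<open>v\<close> with eigenvalue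
  \<open>bdot g v\<close>, for an arbitrary functional \<open>g\<close>, and an inequality between
  two real linear functions of \<open>g\<close> is an equality. To realise such a perturbation of
  \<open>w\<close> as a difference of values of \<open>G\<close>, it is the base point
  \<open>a\<close> that moves, along a curve with prescribed image, so that only the derivative at
  \<open>a\<close> enters. This is why the condition on the derivative travels along with the fixed
  points: without it a new point could not serve as the next base point. Conjugation is among the
  possible answers, so all linear maps are only real linear, and complex coefficients are kept
  inside matrix units and outer products. The adjoint appears because the first-order change of a
  simple eigenvalue is the inner product with a matrix of rank one; \<open>S\<close> carries this
  functional over to the image side.\<close>

lemma eigenvalues_iff_det: "c \<in> eigenvalues A \<longleftrightarrow> det (mat c - A) = 0"
  for A :: "complex^'n^'n"
proof -
  have *: "(mat c - A) *v v = c *s v - A *v v" for v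
    by (simp add: matrix_vector_mult_diff_rdistrib)
       (simp add: vec_eq_iff matrix_vector_mult_def mat_def if_distrib if_distribR cong: if_cong)
  have "det (mat c - A) \<noteq> 0 \<longleftrightarrow> (\<forall>v. (mat c - A) *v v = 0 \<longrightarrow> v = 0)"
    by (metis invertible_det_nz invertible_left_inverse matrix_left_invertible_ker)
  moreover have "(mat c - A) *v v = 0 \<longleftrightarrow> A *v v = c *s v" for v
    unfolding * by auto
  ultimately show ?thesis
    by (auto simp: eigenvalues_def)
qed

text \<open>The determinant is formed over the polynomial ring; evaluation at \<open>x\<close> is a
  ring homomorphism and passes through the Leibniz formula.\<close>

lemma det_poly: "\<exists>p. \<forall>x. poly p x = det (mat x - A)"
  for A :: "complex^'n^'n"
proof -
  define q where "q = det (\<chi> i j. [: - A$i$j, if i = j then 1 else 0 :])"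
  have "poly q x = det (mat x - A)" for x
    unfolding q_def det_def
    by (auto simp: poly_sum poly_prod mat_def intro!: sum.cong prod.cong)
  then show ?thesis by blast
qed

lemma tendsto_det [tendsto_intros]:
  fixes f :: "'a \<Rightarrow> complex^'n^'n"
  assumes "(f \<longlongrightarrow> A) F" shows "((\<lambda>x. det (f x)) \<longlongrightarrow> det A) F"
  unfolding det_def using assms by (intro tendsto_intros)

lemma mscale_component [simp]: "mscale c A $ i $ j = c * A $ i $ j"
  by (simp add: mscale_def)

lemma matrix_diff_ldistrib: "A ** (B - C) = A ** B - A ** C" for A :: "complex^'n^'m"
  by (simp add: vec_eq_iff matrix_matrix_mult_def right_diff_distrib sum_subtractf)

lemma matrix_diff_rdistrib: "(B - C) ** A = B ** A - C ** A" for A :: "complex^'n^'m"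
  by (simp add: vec_eq_iff matrix_matrix_mult_def left_diff_distrib sum_subtractf)

lemma mscale_mult_vec: "mscale c A *v v = c *s (A *v v)"
  by (simp add: matrix_vector_mult_def mscale_def vec_eq_iff sum_distrib_left mult.assoc)

lemma tendsto_mscale [tendsto_intros]:
  assumes "(f \<longlongrightarrow> a) F" "(g \<longlongrightarrow> A) F"
  shows "((\<lambda>x. mscale (f x) (g x)) \<longlongrightarrow> mscale a A) F"
  unfolding mscale_def using assms by (intro vec_tendstoI) (auto intro!: tendsto_intros)

lemma mscale_mult_left: "mscale c A ** B = mscale c (A ** B)"
  by (simp add: vec_eq_iff matrix_matrix_mult_def sum_distrib_left mult.assoc)

lemma mscale_mult_right: "A ** mscale c B = mscale c (A ** B)"
  by (simp add: vec_eq_iff matrix_matrix_mult_def sum_distrib_left mult.left_commute)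

lemma mat_eq_mscale: "mat c = mscale c (mat 1)"
  by (simp add: vec_eq_iff mat_def)

text \<open>Substituting \<open>inverse s\<close> reverses the characteristic polynomial, so that
  its behaviour at infinity can be read off at \<open>s = 0\<close>.\<close>

lemma det_mat_diff_scale:
  fixes A :: "complex^'n^'n"
  assumes "s \<noteq> 0"
  shows "s ^ CARD('n) * det (mat (inverse s) - A) = det (mat 1 - mscale s A)"
proof -
  have "mat s ** (mat (inverse s) - A) = mscale s (mat (inverse s) - A)"
    by (subst mat_eq_mscale[of s]) (simp add: mscale_mult_left)
  also have "\<dots> = mat 1 - mscale s A"
    using assms by (simp add: vec_eq_iff mat_def right_diff_distrib)
  finally have "det (mat 1 - mscale s A) = det (mat s :: complex^'n^'n) * det (mat (inverse s) - A)"
    by (metis det_mul)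
  moreover have "det (mat s :: complex^'n^'n) = (\<Prod>i\<in>UNIV. (mat s :: complex^'n^'n) $ i $ i)"
    by (rule det_diagonal) (simp add: mat_def)
  ultimately show ?thesis by (simp add: mat_def)
qed

text \<open>The reversed polynomial tends to \<open>det (mat 1) = 1\<close> as \<open>s\<close>
  tends to 0, whereas a constant value \<open>c\<close> would make it
  \<open>s ^ CARD('n) * c\<close>, which tends to 0. The case \<open>c = 0\<close> yields finitely
  many eigenvalues, the general case yields a root; together they make \<open>Max\<close> in
  \<open>spec_rad\<close> meaningful.\<close>

lemma det_mat_diff_not_constant:
  fixes A :: "complex^'n^'n"
  shows "\<exists>x. det (mat x - A) \<noteq> c"
proof (rule ccontr)
  assume "\<not> ?thesis"
  then have *: "det (mat 1 - mscale s A) = s ^ CARD('n) * c" if "s \<noteq> 0" for s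
    using det_mat_diff_scale[OF that, of A] by simp
  have "((\<lambda>s. det (mat 1 - mscale s A)) \<longlongrightarrow> det (mat 1 - mscale 0 A)) (at 0)"
    by (intro tendsto_intros)
  moreover have "((\<lambda>s. s ^ CARD('n) * c) \<longlongrightarrow> 0 ^ CARD('n) * c) (at 0)"
    by (intro tendsto_intros)
  then have "((\<lambda>s. det (mat 1 - mscale s A)) \<longlongrightarrow> 0 ^ CARD('n) * c) (at 0)"
    by (rule Lim_transform_eventually) (auto simp: eventually_at_filter *)
  ultimately have "det (mat 1 - mscale 0 A) = 0 ^ CARD('n) * c"
    by (intro tendsto_unique[OF trivial_limit_at])
  moreover have "mscale 0 A = 0" by (simp add: vec_eq_iff)
  ultimately show False by (simp add: power_0_left)
qed

lemma finite_eigenvalues: "finite (eigenvalues A)"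
proof -
  obtain p where p: "\<And>x. poly p x = det (mat x - A)" using det_poly by blast
  have "p \<noteq> 0" using det_mat_diff_not_constant[of A 0] p by force
  then have "finite {x. poly p x = 0}" by (rule poly_roots_finite)
  moreover have "{x. poly p x = 0} = eigenvalues A"
    by (auto simp: p eigenvalues_iff_det)
  ultimately show ?thesis by simp
qed

lemma eigenvalues_nonempty: "eigenvalues A \<noteq> {}"
proof
  assume *: "eigenvalues A = {}"
  obtain p where p: "\<And>x. poly p x = det (mat x - A)" using det_poly by blast
  have "\<not> (\<exists>a l. a \<noteq> 0 \<and> l = 0 \<and> p = pCons a l)"
  proof
    assume "\<exists>a l. a \<noteq> 0 \<and> l = 0 \<and> p = pCons a l"
    then obtain a where "p = [:a:]" by blast
    then show False using det_mat_diff_not_constant[of A a] p by (metis mult_zero_right poly_0 poly_pCons add.right_neutral)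
  qed
  then show False
    using fundamental_theorem_of_algebra_alt[of p] * p eigenvalues_iff_det by force
qed

lemma spec_rad_ge: "c \<in> eigenvalues A \<Longrightarrow> cmod c \<le> spec_rad A"
  unfolding spec_rad_def by (simp add: finite_eigenvalues)

lemma spec_rad_attained: "\<exists>c\<in>eigenvalues A. cmod c = spec_rad A"
proof -
  have "spec_rad A \<in> cmod ` eigenvalues A"
    unfolding spec_rad_def by (intro Max_in) (auto simp: finite_eigenvalues eigenvalues_nonempty)
  then show ?thesis by auto
qed

lemma spec_rad_eigenvector:
  obtains c v where "v \<noteq> 0" "A *v v = c *s v" "cmod c = spec_rad A"
  using spec_rad_attained[of A] by (auto simp: eigenvalues_def)

lemma spec_rad_ge_eigenvector: "v \<noteq> 0 \<Longrightarrow> A *v v = c *s v \<Longrightarrow> cmod c \<le> spec_rad A"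
  by (rule spec_rad_ge) (auto simp: eigenvalues_def)

lemma spec_rad_leI: "(\<And>c v. v \<noteq> 0 \<Longrightarrow> A *v v = c *s v \<Longrightarrow> cmod c \<le> r) \<Longrightarrow> spec_rad A \<le> r"
  by (metis spec_rad_eigenvector)

lemma scaleR_eq_mscale: "r *\<^sub>R A = mscale (of_real r) A"
  by (simp add: vec_eq_iff) (simp add: scaleR_conv_of_real)

section \<open>Homogeneity, similarity invariance and continuity of the spectral radius\<close>

lemma spec_rad_mscale: "spec_rad (mscale c A) = cmod c * spec_rad A"
proof (rule antisym)
  show "spec_rad (mscale c A) \<le> cmod c * spec_rad A"
  proof (rule spec_rad_leI)
    fix d v assume v: "v \<noteq> 0" "mscale c A *v v = d *s v"
    show "cmod d \<le> cmod c * spec_rad A"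
    proof (cases "c = 0")
      case True
      then have "d *s v = 0" using v by (simp add: mscale_mult_vec)
      then have "d = 0" using v by simp
      then show ?thesis using True by simp
    next
      case False
      have "A *v v = inverse c *s (c *s (A *v v))" using False by (simp add: vector_smult_assoc)
      also have "\<dots> = (d / c) *s v" using v(2) by (simp add: mscale_mult_vec vector_smult_assoc divide_inverse mult.commute)
      finally have "cmod (d / c) \<le> spec_rad A" by (rule spec_rad_ge_eigenvector[OF v(1)])
      then show ?thesis using False by (simp add: norm_divide field_simps)
    qed
  qed
  obtain d v where "v \<noteq> 0" "A *v v = d *s v" "cmod d = spec_rad A" by (rule spec_rad_eigenvector)
  moreover from this have "mscale c A *v v = (c * d) *s v"
    by (simp add: mscale_mult_vec vector_smult_assoc)
  ultimately show "cmod c * spec_rad A \<le> spec_rad (mscale c A)"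
    using spec_rad_ge_eigenvector by (metis norm_mult)
qed

lemma spec_rad_scaleR: "spec_rad (r *\<^sub>R A) = \<bar>r\<bar> * spec_rad A"
  by (simp add: scaleR_eq_mscale spec_rad_mscale)

lemma spec_rad_conj:
  fixes P Q A :: "complex^'n^'n"
  assumes "P ** Q = mat 1" "Q ** P = mat 1"
  shows "spec_rad (P ** A ** Q) = spec_rad A"
proof -
  have "P ** mat c ** Q = mat c" for c
    by (metis assms(1) mat_eq_mscale mscale_mult_left mscale_mult_right matrix_mul_rid)
  then have "mat c - P ** A ** Q = P ** (mat c - A) ** Q" for c
    by (simp add: matrix_diff_ldistrib matrix_diff_rdistrib)
  moreover have "det P * det Q = 1" using assms(1) by (metis det_I det_mul)
  ultimately have "det (mat c - P ** A ** Q) = det (mat c - A)" for c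
    by (simp add: det_mul mult.commute[of _ "det Q"])
  then have "eigenvalues (P ** A ** Q) = eigenvalues A"
    by (auto simp: eigenvalues_iff_det)
  then show ?thesis by (simp add: spec_rad_def)
qed

text \<open>Eigenvalues of modulus \<open>r\<close> of the \<open>X k\<close> lie on a compact
  circle; the limit of a convergent subsequence is an eigenvalue of \<open>A\<close> by continuity
  of the determinant.\<close>

lemma spec_rad_limit_ge:
  fixes X :: "nat \<Rightarrow> complex^'n^'n"
  assumes "X \<longlonglongrightarrow> A" "\<And>k. spec_rad (X k) = r"
  shows "r \<le> spec_rad A"
proof -
  have "\<exists>c. c \<in> sphere 0 r \<and> det (mat c - X k) = 0" for k
    using spec_rad_attained[of "X k"] assms(2)[of k] by (auto simp: eigenvalues_iff_det)
  then obtain c where c: "\<And>k. c k \<in> sphere 0 r" "\<And>k. det (mat (c k) - X k) = 0" by metis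
  obtain l s where l: "l \<in> sphere 0 r" "strict_mono s" "(c \<circ> s) \<longlonglongrightarrow> l"
    using compact_sphere[of "0::complex" r] c(1) unfolding compact_def by metis
  have "(\<lambda>k. X (s k)) \<longlonglongrightarrow> A" using LIMSEQ_subseq_LIMSEQ[OF assms(1) l(2)] by (simp add: o_def)
  moreover have "(\<lambda>k. mat (c (s k)) :: complex^'n^'n) \<longlonglongrightarrow> mat l"
    unfolding mat_def using l(3) by (intro vec_tendstoI) (auto simp: o_def)
  ultimately have "(\<lambda>k. det (mat (c (s k)) - X (s k))) \<longlonglongrightarrow> det (mat l - A)"
    by (intro tendsto_intros)
  then have "det (mat l - A) = 0" using c(2) by (simp add: LIMSEQ_const_iff)
  then show ?thesis using l(1) spec_rad_ge[of l A] by (simp add: eigenvalues_iff_det)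
qed

text \<open>By Hurwitz's theorem: near an eigenvalue \<open>l\<close> of \<open>A\<close> of modulus
  above \<open>r\<close>, the characteristic polynomials of all \<open>X k\<close> are free of
  zeros, so their nonconstant locally uniform limit could not vanish at \<open>l\<close>.\<close>

lemma spec_rad_limit_le:
  fixes X :: "nat \<Rightarrow> complex^'n^'n"
  assumes X: "X \<longlonglongrightarrow> A" and r: "\<And>k. spec_rad (X k) = r"
  shows "spec_rad A \<le> r"
proof (rule ccontr)
  assume "\<not> ?thesis"
  then obtain l where l: "det (mat l - A) = 0" "cmod l > r"
    using spec_rad_attained[of A] by (force simp: eigenvalues_iff_det)
  define S where "S = ball l (cmod l - r)"
  have S: "cmod x > r" if "x \<in> S" for x
    using that norm_triangle_ineq2[of l x] by (simp add: S_def dist_norm)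
  have cont: "continuous_on UNIV (\<lambda>(x, B). det (mat x - B :: complex^'n^'n))"
  proof -
    have "continuous_on UNIV (\<lambda>p. det (mscale (fst p) (mat 1) - snd p :: complex^'n^'n))"
      unfolding continuous_on_def by (intro ballI tendsto_intros)
    moreover have "mscale (fst p) (mat 1) = (mat (fst p) :: complex^'n^'n)" for p :: "complex \<times> (complex^'n^'n)"
      by (rule mat_eq_mscale[symmetric])
    ultimately show ?thesis by (simp add: case_prod_unfold)
  qed
  have hol: "(\<lambda>x. det (mat x - B)) holomorphic_on S" for B :: "complex^'n^'n"
  proof -
    obtain p where "\<And>x. poly p x = det (mat x - B)" using det_poly by blast
    then have "(\<lambda>x. det (mat x - B)) = poly p" by auto
    moreover have "poly p holomorphic_on S"
      unfolding holomorphic_on_def field_differentiable_def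
      using poly_DERIV has_field_derivative_at_within by blast
    ultimately show ?thesis by simp
  qed
  have "det (mat l - A) \<noteq> 0"
  proof (rule Hurwitz_no_zeros[of S "\<lambda>k x. det (mat x - X k)" "\<lambda>x. det (mat x - A)" l])
    show "uniform_limit K (\<lambda>k x. det (mat x - X k)) (\<lambda>x. det (mat x - A)) sequentially"
      if "compact K" "K \<subseteq> S" for K
    proof (rule uniform_limitI)
      fix e :: real assume "e > 0"
      \<comment> \<open>Joint continuity in \<open>(x, B)\<close> on a compact product makes the
        convergence uniform in \<open>x\<close>.\<close>
      have "uniformly_continuous_on (K \<times> cball A 1) (\<lambda>(x, B). det (mat x - B))"
        using that(1) cont by (intro compact_uniformly_continuous compact_Times compact_cball) (auto intro: continuous_on_subset)
      then obtain d where d: "d > 0" "\<And>p q. p \<in> K \<times> cball A 1 \<Longrightarrow> q \<in> K \<times> cball A 1 \<Longrightarrow> dist q p < d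
          \<Longrightarrow> dist (case q of (x, B) \<Rightarrow> det (mat x - B)) (case p of (x, B) \<Rightarrow> det (mat x - B)) < e"
        using \<open>e > 0\<close> unfolding uniformly_continuous_on_def by metis
      have "\<forall>\<^sub>F k in sequentially. dist (X k) A < min d 1"
        using X d(1) by (intro tendstoD) auto
      then show "\<forall>\<^sub>F k in sequentially. \<forall>x\<in>K. dist (det (mat x - X k)) (det (mat x - A)) < e"
      proof eventually_elim
        case (elim k)
        show ?case
        proof
          fix x assume "x \<in> K"
          then show "dist (det (mat x - X k)) (det (mat x - A)) < e"
            using d(2)[of "(x, A)" "(x, X k)"] elim by (simp add: dist_Pair_Pair dist_commute)
        qed
      qed
    qed
    show "\<not> (\<lambda>x. det (mat x - A)) constant_on S"
    proof
      assume "(\<lambda>x. det (mat x - A)) constant_on S"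
      moreover have "l \<in> S" using l by (simp add: S_def)
      ultimately have "S \<subseteq> eigenvalues A"
        using l(1) unfolding constant_on_def by (auto simp: eigenvalues_iff_det)
      moreover have "infinite S" using l(2) unfolding S_def
        by (simp add: uncountable_ball uncountable_infinite)
      ultimately show False using finite_eigenvalues finite_subset by blast
    qed
    show "\<And>k x. x \<in> S \<Longrightarrow> det (mat x - X k) \<noteq> 0"
      using S r spec_rad_ge by (metis eigenvalues_iff_det linorder_not_le)
    show "l \<in> S" using l by (simp add: S_def)
  qed (use hol in \<open>auto simp: S_def\<close>)
  then show False using l by simp
qed

lemma spec_rad_limit:
  fixes X :: "nat \<Rightarrow> complex^'n^'n"
  assumes "X \<longlonglongrightarrow> A" "\<And>k. spec_rad (X k) = r"
  shows "spec_rad A = r"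
  using spec_rad_limit_ge[OF assms] spec_rad_limit_le[OF assms] by simp

section \<open>Perturbation of a dominant eigenvalue\<close>

definition cdiag :: "complex^'n \<Rightarrow> complex^'n^'n" where
  "cdiag d = (\<chi> i j. if i = j then d $ i else 0)"

lemma cdiag_component [simp]: "cdiag d $ i $ j = (if i = j then d $ i else 0)"
  by (simp add: cdiag_def)

lemma cdiag_mult_vec: "(cdiag d *v x) $ i = d $ i * x $ i"
  by (simp add: matrix_vector_mult_def if_distrib if_distribR cong: if_cong)

lemma norm_matrix_component_le: "cmod (A $ i $ j) \<le> norm A"
  by (meson Finite_Cartesian_Product.norm_nth_le order_trans)

text \<open>
  By Gershgorin's argument the dominant eigenvector of \<open>cdiag d + h\<close> has off-\<open>j\<close> entries of order \<open>h\<close>; they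
  enter row \<open>j\<close> multiplied by further entries of \<open>h\<close>, so the error is quadratic.
\<close>

lemma spec_rad_diag_perturb:
  fixes d :: "complex^'n"
  assumes dom: "\<And>i. i \<noteq> j \<Longrightarrow> cmod (d $ i) < cmod (d $ j)"
  shows "\<exists>C \<delta>. \<delta> > 0 \<and> C \<ge> 0 \<and>
    (\<forall>h. norm h < \<delta> \<longrightarrow> spec_rad (cdiag d + h) \<le> cmod (d $ j + h $ j $ j) + C * (norm h)\<^sup>2)"
proof -
  \<comment> \<open>A bound for the other moduli; if \<open>j\<close> is the only index, any
    \<open>m\<close> below \<open>cmod (d $ j)\<close> will do.\<close>
  have "\<exists>m < cmod (d $ j). \<forall>i\<in>UNIV - {j}. cmod (d $ i) \<le> m"
  proof (cases "UNIV - {j} = {}")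
    case True
    then show ?thesis by (metis empty_iff gt_ex linordered_field_no_lb)
  next
    case False
    then show ?thesis using dom
      by (intro exI[of _ "Max ((\<lambda>i. cmod (d $ i)) ` (UNIV - {j}))"]) auto
  qed
  then obtain m where m: "m < cmod (d $ j)" "\<And>i. i \<noteq> j \<Longrightarrow> cmod (d $ i) \<le> m" by auto
  define N where "N = real CARD('n)"
  \<comment> \<open>Half the gap: an eigenvalue of modulus at least \<open>m + \<kappa>\<close> has
    distance at least \<kappa> from every \<open>d $ i\<close> with \<open>i \<noteq> j\<close>, and
    one of smaller modulus stays below \<open>cmod (d $ j + h $ j $ j)\<close> because
    \<open>h\<close> has entries smaller than \<kappa>.\<close>
  define \<kappa> where "\<kappa> = (cmod (d $ j) - m) / 2"
  have N: "N \<ge> 1" unfolding N_def by (simp add: Suc_leI)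
  have \<kappa>: "\<kappa> > 0" using m unfolding \<kappa>_def by simp
  have dj: "cmod (d $ j) = m + \<kappa> + \<kappa>" unfolding \<kappa>_def by simp
  have "spec_rad (cdiag d + h) \<le> cmod (d $ j + h $ j $ j) + (N\<^sup>2 / \<kappa>) * (norm h)\<^sup>2"
    if h: "norm h < \<kappa> / N" for h
  proof (rule spec_rad_leI)
    fix c x assume x: "x \<noteq> 0" "(cdiag d + h) *v x = c *s x"
    define e where "e = norm h"
    have he: "cmod (h $ i $ k) \<le> e" for i k unfolding e_def by (rule norm_matrix_component_le)
    have e0: "e \<ge> 0" unfolding e_def by simp
    have Ne: "N * e < \<kappa>" using h N unfolding e_def by (simp add: field_simps)
    have "e \<le> N * e" using N e0 by (simp add: mult_le_cancel_right1)
    then have e\<kappa>: "e < \<kappa>" using Ne by simp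
    have eq: "(c - d $ i) * x $ i = (\<Sum>k\<in>UNIV. h $ i $ k * x $ k)" for i
    proof -
      have "((cdiag d + h) *v x) $ i = d $ i * x $ i + (\<Sum>k\<in>UNIV. h $ i $ k * x $ k)"
        by (simp add: matrix_vector_mult_add_rdistrib cdiag_mult_vec) (simp add: matrix_vector_mult_def)
      then show ?thesis unfolding x(2) by (simp add: left_diff_distrib)
    qed
    show "cmod c \<le> cmod (d $ j + h $ j $ j) + (N\<^sup>2 / \<kappa>) * (norm h)\<^sup>2"
    proof (cases "cmod c < m + \<kappa>")
      case True
      have "cmod (d $ j) \<le> cmod (d $ j + h $ j $ j) + cmod (h $ j $ j)"
        by (metis add_diff_cancel_right' norm_triangle_ineq4)
      then have "cmod c \<le> cmod (d $ j + h $ j $ j)"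
        using True he[of j j] e\<kappa> dj by linarith
      then show ?thesis using \<kappa> by (simp add: add_increasing2)
    next
      case False
      define M where "M = Max (range (\<lambda>i. cmod (x $ i)))"
      have xM: "cmod (x $ i) \<le> M" for i unfolding M_def by simp
      have "M \<in> range (\<lambda>i. cmod (x $ i))" unfolding M_def by (intro Max_in) auto
      then obtain l where l: "M = cmod (x $ l)" by auto
      obtain i where "x $ i \<noteq> 0" using x(1) by (auto simp: vec_eq_iff)
      then have M: "M > 0" using xM[of i] by (metis less_le_trans zero_less_norm_iff)
      have row: "cmod ((c - d $ i) * x $ i) \<le> N * e * M" for i
      proof -
        have "cmod (\<Sum>k\<in>UNIV. h $ i $ k * x $ k) \<le> (\<Sum>k\<in>(UNIV::'n set). e * M)"
          using he xM e0 by (intro sum_norm_le) (auto simp: norm_mult intro!: mult_mono)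
        then show ?thesis by (simp add: eq N_def)
      qed
      have off: "\<kappa> \<le> cmod (c - d $ i)" if "i \<noteq> j" for i
        using norm_triangle_ineq2[of c "d $ i"] m(2)[OF that] False by simp
      \<comment> \<open>If the largest entry of \<open>x\<close> stood elsewhere, its row would give
        \<open>\<kappa> * M \<le> N * e * M\<close>, too much for so small an
        \<open>h\<close>.\<close>
      have lj: "l = j"
      proof (rule ccontr)
        assume "l \<noteq> j"
        have "\<kappa> * M \<le> N * e * M"
          using row[of l] off[OF \<open>l \<noteq> j\<close>] M unfolding norm_mult l[symmetric]
          by (meson less_eq_real_def mult_right_mono order_trans)
        then show False using Ne M by simp
      qed
      have xk: "cmod (x $ k) \<le> N * e * M / \<kappa>" if "k \<noteq> j" for k
      proof -
        have "\<kappa> * cmod (x $ k) \<le> N * e * M"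
          using row[of k] off[OF that] unfolding norm_mult
          by (meson norm_ge_zero mult_right_mono order_trans)
        then show ?thesis using \<kappa> by (simp add: field_simps)
      qed
      have "(c - d $ j - h $ j $ j) * x $ j = (\<Sum>k\<in>UNIV - {j}. h $ j $ k * x $ k)"
        using eq[of j] by (simp add: sum.remove[of UNIV j] algebra_simps)
      also have "cmod \<dots> \<le> (\<Sum>k\<in>UNIV - {j}. e * (N * e * M / \<kappa>))"
        using he xk e0 unfolding norm_mult[symmetric]
        by (intro sum_norm_le) (metis DiffE insertI1 mult_mono norm_ge_zero norm_mult)
      also have "\<dots> \<le> N * (e * (N * e * M / \<kappa>))"
      proof -
        have "0 \<le> e * (N * e * M / \<kappa>)" using e0 N M \<kappa> by simp
        then have "(\<Sum>k\<in>UNIV - {j}. e * (N * e * M / \<kappa>)) \<le> (\<Sum>k\<in>(UNIV::'n set). e * (N * e * M / \<kappa>))"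
          by (intro sum_mono2) auto
        then show ?thesis by (simp add: N_def)
      qed
      finally have "cmod (c - d $ j - h $ j $ j) * M \<le> (N\<^sup>2 / \<kappa> * e\<^sup>2) * M"
        unfolding norm_mult l[unfolded lj, symmetric] by (simp add: power2_eq_square mult.assoc mult.left_commute)
      then have "cmod (c - d $ j - h $ j $ j) \<le> N\<^sup>2 / \<kappa> * e\<^sup>2"
        by (rule mult_right_le_imp_le) (rule M)
      then show ?thesis unfolding e_def
        using norm_triangle_ineq2[of c "d $ j + h $ j $ j"] by (simp add: algebra_simps)
    qed
  qed
  moreover have "\<kappa> / N > 0" "N\<^sup>2 / \<kappa> \<ge> 0" using \<kappa> N by auto
  ultimately show ?thesis by blast
qed

lemma matrix_add_ldistrib: "A ** (B + C) = A ** B + A ** C" for A :: "complex^'n^'m"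
  by (simp add: vec_eq_iff matrix_matrix_mult_def distrib_left sum.distrib)

lemma matrix_add_rdistrib: "(B + C) ** A = B ** A + C ** A" for A :: "complex^'n^'m"
  by (simp add: vec_eq_iff matrix_matrix_mult_def distrib_right sum.distrib)

lemma bounded_linear_matrix_conj: "bounded_linear (\<lambda>h. Q ** h ** P)"
  for P Q :: "complex^'n^'n"
  unfolding linear_conv_bounded_linear[symmetric]
  by (rule linearI)
     (simp_all add: matrix_add_ldistrib matrix_add_rdistrib scaleR_eq_mscale mscale_mult_left mscale_mult_right)

lemma tendsto_matrix_conj [tendsto_intros]:
  fixes P Q :: "complex^'n^'n"
  assumes "(f \<longlongrightarrow> l) F" shows "((\<lambda>x. Q ** f x ** P) \<longlongrightarrow> Q ** l ** P) F"
  using bounded_linear.tendsto[OF bounded_linear_matrix_conj assms] .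

lemma conj_conj:
  fixes P Q :: "complex^'n^'n"
  assumes "P ** Q = mat 1" shows "P ** (Q ** A ** P) ** Q = A"
  by (metis assms matrix_mul_assoc matrix_mul_lid matrix_mul_rid)

text \<open>Conjugation is bounded by some \<open>K\<close>, so the admissible radius shrinks by the
  factor \<open>K\<close> and the quadratic constant grows by its square. The entry
  \<open>(Q ** h ** P) $ j $ j\<close> is the first-order change of the dominant eigenvalue.\<close>

lemma spec_rad_conj_diag_perturb:
  fixes d :: "complex^'n" and P Q :: "complex^'n^'n"
  assumes PQ: "P ** Q = mat 1" "Q ** P = mat 1"
    and dom: "\<And>i. i \<noteq> j \<Longrightarrow> cmod (d $ i) < cmod (d $ j)"
  obtains C \<delta> where "\<delta> > 0" "C \<ge> 0"
    "\<And>h. norm h < \<delta> \<Longrightarrow>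
      spec_rad (P ** cdiag d ** Q + h) \<le> cmod (d $ j + (Q ** h ** P) $ j $ j) + C * (norm h)\<^sup>2"
proof -
  obtain C \<delta> where C: "\<delta> > 0" "C \<ge> 0"
    "\<And>h. norm h < \<delta> \<Longrightarrow> spec_rad (cdiag d + h) \<le> cmod (d $ j + h $ j $ j) + C * (norm h)\<^sup>2"
    using spec_rad_diag_perturb[of j d, OF dom] by blast
  obtain K where K: "K > 0" "\<And>h. norm (Q ** h ** P) \<le> norm h * K"
    using bounded_linear.pos_bounded[OF bounded_linear_matrix_conj[of Q P]] by blast
  show thesis
  proof (rule that[of "\<delta> / K" "C * K\<^sup>2"])
    fix h :: "complex^'n^'n" assume h: "norm h < \<delta> / K"
    let ?h = "Q ** h ** P"
    have "norm ?h < \<delta>" using K(2)[of h] h K(1) by (simp add: field_simps)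
    then have "spec_rad (cdiag d + ?h) \<le> cmod (d $ j + ?h $ j $ j) + C * (norm ?h)\<^sup>2"
      by (rule C(3))
    moreover have "P ** cdiag d ** Q + h = P ** (cdiag d + ?h) ** Q"
      by (simp add: matrix_add_ldistrib matrix_add_rdistrib conj_conj[OF PQ(1)])
    moreover have "(norm ?h)\<^sup>2 \<le> K\<^sup>2 * (norm h)\<^sup>2"
      using power_mono[OF K(2)[of h], of 2] by (simp add: power_mult_distrib mult.commute)
    then have "C * (norm ?h)\<^sup>2 \<le> C * K\<^sup>2 * (norm h)\<^sup>2"
      using C(2) by (simp add: mult_left_mono mult.assoc)
    ultimately show "spec_rad (P ** cdiag d ** Q + h) \<le> cmod (d $ j + ?h $ j $ j) + C * K\<^sup>2 * (norm h)\<^sup>2"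
      by (simp add: spec_rad_conj[OF PQ])
  qed (use C K in auto)
qed

lemma conj_diag_column:
  fixes P Q :: "complex^'n^'n"
  assumes "Q ** P = mat 1"
  shows "(P ** cdiag d ** Q) *v column j P = d $ j *s column j P"
proof -
  have c: "column j P = P *v axis j 1"
    by (simp add: vec_eq_iff matrix_vector_mult_def column_def axis_def if_distrib cong: if_cong)
  have "(P ** cdiag d ** Q) *v column j P = P *v (cdiag d *v ((Q ** P) *v axis j 1))"
    unfolding c by (simp add: matrix_vector_mul_assoc matrix_mul_assoc)
  also have "cdiag d *v ((Q ** P) *v axis j 1) = d $ j *s axis j 1"
    unfolding assms by (simp add: vec_eq_iff cdiag_mult_vec axis_def)
  finally show ?thesis unfolding c by (simp add: vector_scalar_commute)
qed

lemma column_conj_nonzero: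
  fixes P Q :: "complex^'n^'n"
  assumes "Q ** P = mat 1"
  shows "column j P \<noteq> 0"
proof
  assume "column j P = 0"
  then have "(Q ** P) $ j $ j = 0"
    by (simp add: matrix_matrix_mult_def column_def vec_eq_iff)
  then show False by (simp add: assms mat_def)
qed

lemma spec_rad_conj_diag:
  fixes d :: "complex^'n" and P Q :: "complex^'n^'n"
  assumes PQ: "P ** Q = mat 1" "Q ** P = mat 1"
    and dom: "\<And>i. i \<noteq> j \<Longrightarrow> cmod (d $ i) < cmod (d $ j)"
  shows "spec_rad (P ** cdiag d ** Q) = cmod (d $ j)"
proof (rule antisym)
  obtain C \<delta> where "\<delta> > 0" "C \<ge> 0"
    "\<And>h. norm h < \<delta> \<Longrightarrow>
      spec_rad (P ** cdiag d ** Q + h) \<le> cmod (d $ j + (Q ** h ** P) $ j $ j) + C * (norm h)\<^sup>2"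
    using spec_rad_conj_diag_perturb[OF PQ dom] by blast
  from this(3)[of 0] this(1) show "spec_rad (P ** cdiag d ** Q) \<le> cmod (d $ j)" by simp
  show "cmod (d $ j) \<le> spec_rad (P ** cdiag d ** Q)"
    by (rule spec_rad_ge_eigenvector[OF column_conj_nonzero[OF PQ(2)] conj_diag_column[OF PQ(2)]])
qed

lemma cmod_add_squared: "(cmod (a + b))\<^sup>2 = (cmod a)\<^sup>2 + 2 * Re (cnj a * b) + (cmod b)\<^sup>2"
  unfolding cmod_power2 by (simp add: power2_eq_square algebra_simps)

text \<open>The squared eigenvalue comparison for step size \<open>t\<close>: \<open>m\<close> is
  the common modulus at \<open>t = 0\<close>, and once it has dropped out a factor \<open>t\<close>
  can be divided away, leaving terms whose limits are known.\<close>

lemma second_order_cancel: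
  fixes t :: real
  assumes "m\<^sup>2 + 2 * (t * a) + (t * s)\<^sup>2
      \<le> m\<^sup>2 + 2 * (t * b) + (t * q)\<^sup>2 + (C * (t * k)\<^sup>2)\<^sup>2 + 2 * x * (C * (t * k)\<^sup>2)"
    and "t > 0"
  shows "2 * a + t * s\<^sup>2 \<le> 2 * b + t * q\<^sup>2 + 2 * x * C * t * k\<^sup>2 + C\<^sup>2 * t ^ 3 * k ^ 4"
proof -
  have "t * (2 * a + t * s\<^sup>2) \<le> t * (2 * b + t * q\<^sup>2 + 2 * x * C * t * k\<^sup>2 + C\<^sup>2 * t ^ 3 * k ^ 4)"
    using assms(1) by (simp add: algebra_simps power2_eq_square power3_eq_cube power4_eq_xxxx)
  then show ?thesis using assms(2) by simp
qed

text \<open>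
  Nothing is assumed about the multiplicity of \<open>\<mu>\<close>, since the spectral radius of \<open>w + t *\<^sub>R h\<close> is only
  bounded below.
\<close>

lemma peripheral_eigenvector_ineq:
  fixes d :: "complex^'n" and P Q h w :: "complex^'n^'n" and k :: "real \<Rightarrow> complex^'n^'n"
  assumes PQ: "P ** Q = mat 1" "Q ** P = mat 1"
    and dom: "\<And>i. i \<noteq> j \<Longrightarrow> cmod (d $ i) < cmod (d $ j)"
    and v: "v \<noteq> 0" "w *v v = \<mu> *s v" "cmod \<mu> = cmod (d $ j)" "h *v v = s *s v"
    and k: "((\<lambda>t. (1 / t) *\<^sub>R k t) \<longlongrightarrow> k0) (at_right 0)"
    and ev: "\<forall>\<^sub>F t in at_right 0. spec_rad (w + t *\<^sub>R h) \<le> spec_rad (P ** cdiag d ** Q + k t)"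
  shows "Re (cnj \<mu> * s) \<le> Re (cnj (d $ j) * (Q ** k0 ** P) $ j $ j)"
proof -
  obtain C \<delta> where C: "\<delta> > 0" "C \<ge> 0"
    "\<And>h. norm h < \<delta> \<Longrightarrow>
      spec_rad (P ** cdiag d ** Q + h) \<le> cmod (d $ j + (Q ** h ** P) $ j $ j) + C * (norm h)\<^sup>2"
    using spec_rad_conj_diag_perturb[OF PQ dom] by blast
  define \<kappa> where "\<kappa> t = (1 / t) *\<^sub>R k t" for t
  define q where "q t = (Q ** \<kappa> t ** P) $ j $ j" for t
  have \<kappa>: "(\<kappa> \<longlongrightarrow> k0) (at_right 0)" using k unfolding \<kappa>_def .
  have q: "(q \<longlongrightarrow> (Q ** k0 ** P) $ j $ j) (at_right 0)"
    unfolding q_def by (intro tendsto_vec_nth tendsto_matrix_conj \<kappa>)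
  have "((\<lambda>t. norm (t *\<^sub>R \<kappa> t)) \<longlongrightarrow> norm (0 *\<^sub>R k0)) (at_right 0)"
    by (intro tendsto_intros \<kappa>)
  then have "\<forall>\<^sub>F t in at_right 0. norm (t *\<^sub>R \<kappa> t) < \<delta>"
    using C(1) by (auto intro: order_tendstoD)
  moreover have "\<forall>\<^sub>F t::real in at_right 0. t > 0" by (simp add: eventually_at_right_less)
  ultimately have "\<forall>\<^sub>F t in at_right 0. 2 * Re (cnj \<mu> * s) + t * (cmod s)\<^sup>2 \<le>
      2 * Re (cnj (d $ j) * q t) + t * (cmod (q t))\<^sup>2
      + 2 * cmod (d $ j + t *\<^sub>R q t) * C * t * (norm (\<kappa> t))\<^sup>2 + C\<^sup>2 * t ^ 3 * (norm (\<kappa> t)) ^ 4"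
    using ev
  proof eventually_elim
    case (elim t)
    have kt: "k t = t *\<^sub>R \<kappa> t" using elim unfolding \<kappa>_def by simp
    have "(w + t *\<^sub>R h) *v v = (\<mu> + t *\<^sub>R s) *s v"
      using v by (simp add: matrix_vector_mult_add_rdistrib scaleR_eq_mscale mscale_mult_vec
          vector_smult_assoc vector_sadd_rdistrib scaleR_conv_of_real)
    then have "cmod (\<mu> + t *\<^sub>R s) \<le> spec_rad (w + t *\<^sub>R h)"
      by (rule spec_rad_ge_eigenvector[OF v(1)])
    also note elim(3)
    also have "spec_rad (P ** cdiag d ** Q + k t)
        \<le> cmod (d $ j + (Q ** k t ** P) $ j $ j) + C * (norm (k t))\<^sup>2"
      using elim(1) kt by (intro C(3)) simp
    also have "(Q ** k t ** P) $ j $ j = t *\<^sub>R q t"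
      unfolding kt q_def by (simp add: scaleR_eq_mscale mscale_mult_left mscale_mult_right scaleR_conv_of_real)
    \<comment> \<open>Squaring replaces moduli by polynomial expressions whose terms linear in
      \<open>t\<close> are the two real parts to be compared.\<close>
    finally have "(cmod (\<mu> + t *\<^sub>R s))\<^sup>2 \<le> (cmod (d $ j + t *\<^sub>R q t) + C * (norm (k t))\<^sup>2)\<^sup>2"
      by (intro power_mono) auto
    moreover have "(norm (k t))\<^sup>2 = (t * norm (\<kappa> t))\<^sup>2"
      "(cmod (t *\<^sub>R s))\<^sup>2 = (t * cmod s)\<^sup>2" "(cmod (t *\<^sub>R q t))\<^sup>2 = (t * cmod (q t))\<^sup>2"
      "Re (cnj \<mu> * (t *\<^sub>R s)) = t * Re (cnj \<mu> * s)"
      "Re (cnj (d $ j) * (t *\<^sub>R q t)) = t * Re (cnj (d $ j) * q t)"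
      using elim(2) kt by (auto simp: algebra_simps)
    ultimately show ?case
      using elim(2) unfolding power2_sum[of "cmod _" "C * _"] cmod_add_squared[of _ "t *\<^sub>R _"] v(3)
      by (intro second_order_cancel) simp_all
  qed
  note le = this
  have lim1: "((\<lambda>t. 2 * Re (cnj \<mu> * s) + t * (cmod s)\<^sup>2) \<longlongrightarrow> 2 * Re (cnj \<mu> * s) + 0 * (cmod s)\<^sup>2) (at_right 0)"
    by (intro tendsto_intros)
  have lim2: "((\<lambda>t. 2 * Re (cnj (d $ j) * q t) + t * (cmod (q t))\<^sup>2
      + 2 * cmod (d $ j + t *\<^sub>R q t) * C * t * (norm (\<kappa> t))\<^sup>2 + C\<^sup>2 * t ^ 3 * (norm (\<kappa> t)) ^ 4) \<longlongrightarrow>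
     2 * Re (cnj (d $ j) * (Q ** k0 ** P) $ j $ j) + 0 * (cmod ((Q ** k0 ** P) $ j $ j))\<^sup>2
      + 2 * cmod (d $ j + 0 *\<^sub>R (Q ** k0 ** P) $ j $ j) * C * 0 * (norm k0)\<^sup>2 + C\<^sup>2 * 0 ^ 3 * (norm k0) ^ 4) (at_right 0)"
    by (intro tendsto_intros q \<kappa>)
  have "2 * Re (cnj \<mu> * s) + 0 * (cmod s)\<^sup>2 \<le> 2 * Re (cnj (d $ j) * (Q ** k0 ** P) $ j $ j) + 0 * (cmod ((Q ** k0 ** P) $ j $ j))\<^sup>2
      + 2 * cmod (d $ j + 0 *\<^sub>R (Q ** k0 ** P) $ j $ j) * C * 0 * (norm k0)\<^sup>2 + C\<^sup>2 * 0 ^ 3 * (norm k0) ^ 4"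
    by (rule tendsto_le[OF trivial_limit_at_right_real lim2 lim1 le])
  then show ?thesis by simp
qed

section \<open>Isometries tangent to the identity\<close>

text \<open>Bilinear rather than Hermitian, so that \<open>bdot g\<close> runs through all complex
  linear functionals and agrees with the trace of \<open>outer\<close>.\<close>

definition bdot :: "complex^'n \<Rightarrow> complex^'n \<Rightarrow> complex" where
  "bdot x y = (\<Sum>i\<in>UNIV. x $ i * y $ i)"

definition outer :: "complex^'n \<Rightarrow> complex^'m \<Rightarrow> complex^'m^'n" where
  "outer a b = (\<chi> i j. a $ i * b $ j)"

lemma outer_component [simp]: "outer a b $ i $ j = a $ i * b $ j"
  by (simp add: outer_def)

lemma outer_mult_vec: "outer a b *v x = bdot b x *s a"
  by (simp add: vec_eq_iff matrix_vector_mult_def bdot_def sum_distrib_left mult_ac)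

lemma conj_outer_component:
  fixes P Q :: "complex^'n^'n"
  shows "(Q ** outer v g ** P) $ j $ j = (Q *v v) $ j * bdot g (column j P)"
proof -
  have "(Q ** outer v g) = outer (Q *v v) g"
    by (simp add: vec_eq_iff matrix_matrix_mult_def matrix_vector_mult_def sum_distrib_right mult.assoc)
  then show ?thesis
    by (simp add: matrix_matrix_mult_def bdot_def column_def sum_distrib_left mult.assoc)
qed

lemma bdot_axis: "bdot (axis i c) x = c * x $ i"
proof -
  have "bdot (axis i c) x = (\<Sum>k\<in>UNIV. if k = i then c * x $ k else 0)"
    unfolding bdot_def by (intro sum.cong) (auto simp: axis_def)
  then show ?thesis by simp
qed

text \<open>A real linear function of \<open>g\<close> that is nowhere positive vanishes. Testing
  with the conjugate of the difference \<open>z\<close> in coordinate \<open>i\<close> gives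
  \<open>cmod z ^ 2 \<le> 0\<close>.\<close>

lemma Re_le_imp_eq:
  assumes "\<And>g. Re (\<alpha> * bdot g v) \<le> Re (\<beta> * bdot g e)"
  shows "\<alpha> *s v = \<beta> *s e"
proof -
  have "\<alpha> * v $ i = \<beta> * e $ i" for i
  proof -
    define z where "z = \<alpha> * v $ i - \<beta> * e $ i"
    have "Re (\<alpha> * (cnj z * v $ i)) \<le> Re (\<beta> * (cnj z * e $ i))"
      using assms[of "axis i (cnj z)"] by (simp add: bdot_axis)
    then have "Re (cnj z * z) \<le> 0" unfolding z_def by (simp add: algebra_simps)
    then have "(cmod z)\<^sup>2 \<le> 0" unfolding cmod_power2 by (simp add: power2_eq_square)
    then show ?thesis unfolding z_def by simp
  qed
  then show ?thesis by (simp add: vec_eq_iff)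
qed

lemma tendsto_mult_vec:
  fixes f :: "'a \<Rightarrow> complex^'n^'m"
  assumes "(f \<longlongrightarrow> l) F" shows "((\<lambda>x. f x *v e) \<longlongrightarrow> l *v e) F"
  unfolding matrix_vector_mult_def using assms
  by (intro vec_tendstoI) (auto intro!: tendsto_intros)

lemma scaleR_mult_vec: "(t *\<^sub>R A) *v e = t *\<^sub>R (A *v e)" for A :: "complex^'n^'m"
  by (simp add: vec_eq_iff matrix_vector_mult_def scaleR_sum_right)

lemma has_derivative_directional:
  assumes "(f has_derivative f') (at x)"
  shows "((\<lambda>t. (1 / t) *\<^sub>R (f (x + t *\<^sub>R h) - f x)) \<longlongrightarrow> f' h) (at_right 0)"
proof -
  have lin: "bounded_linear f'" using assms by (rule has_derivative_bounded_linear)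
  have "((\<lambda>t. f (x + t *\<^sub>R h)) has_derivative (\<lambda>t. f' (t *\<^sub>R h))) (at 0)"
    by (rule has_derivative_compose[of "\<lambda>t. x + t *\<^sub>R h" "\<lambda>t. t *\<^sub>R h" 0 UNIV f f', simplified])
       (auto intro!: derivative_eq_intros assms)
  then have "((\<lambda>t. f (x + t *\<^sub>R h)) has_derivative (\<lambda>t. f' (t *\<^sub>R h))) (at_right 0)"
    by (rule has_derivative_at_withinI)
  then have *: "((\<lambda>t. (1 / norm (t - 0)) *\<^sub>R (f (x + t *\<^sub>R h) - (f (x + 0 *\<^sub>R h) + f' ((t - 0) *\<^sub>R h)))) \<longlongrightarrow> 0) (at_right 0)"
    unfolding has_derivative_within by blast
  have "((\<lambda>t. (1 / t) *\<^sub>R (f (x + t *\<^sub>R h) - f x) - f' h) \<longlongrightarrow> 0) (at_right 0)"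
  proof (rule Lim_transform_eventually[OF *])
    have "\<forall>\<^sub>F t::real in at_right 0. t > 0" by (simp add: eventually_at_right_less)
    then show "\<forall>\<^sub>F t in at_right 0. (1 / norm (t - 0)) *\<^sub>R (f (x + t *\<^sub>R h) - (f (x + 0 *\<^sub>R h) + f' ((t - 0) *\<^sub>R h)))
        = (1 / t) *\<^sub>R (f (x + t *\<^sub>R h) - f x) - f' h"
      by eventually_elim (simp add: linear_cmul[OF bounded_linear.linear[OF lin]] algebra_simps)
  qed
  then show ?thesis by (rule LIM_zero_cancel)
qed

text \<open>Preimages exist by the open mapping theorem at a point with invertible derivative. They
  may be chosen arbitrarily in a small ball: the derivative estimate with constant 1/2 forces
  \<open>norm (k t) \<le> 2 * t * norm h\<close>, and the same estimate with a small constant then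
  gives the limit of the quotients. The minus signs make \<open>G (a + z) - G (a - k t)\<close> a
  perturbation by \<open>+ t *\<^sub>R h\<close>.\<close>

lemma local_inverse_curve:
  fixes G :: "'a::euclidean_space \<Rightarrow> 'a"
  assumes U: "open U" "a \<in> U" and cont: "continuous_on U G"
    and der: "(G has_derivative (\<lambda>x. x)) (at a)"
  obtains k where "((\<lambda>t. (1 / t) *\<^sub>R k t) \<longlongrightarrow> h) (at_right 0)"
    "\<forall>\<^sub>F t in at_right 0. a - k t \<in> U \<and> G (a - k t) = G a - t *\<^sub>R h"
proof -
  have approx: "\<exists>r>0. ball a r \<subseteq> U \<and> (\<forall>y\<in>ball a r. norm (G y - G a - (y - a)) \<le> e * norm (y - a))"
    if e: "e > 0" for e
  proof -
    obtain r1 where r1: "r1 > 0" "ball a r1 \<subseteq> U" using U by (meson openE)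
    have "\<forall>e>0. \<exists>d>0. \<forall>y. norm (y - a) < d \<longrightarrow> norm (G y - G a - (y - a)) \<le> e * norm (y - a)"
      using der unfolding has_derivative_at_alt by simp
    then obtain r2 where r2: "r2 > 0" "\<And>y. norm (y - a) < r2 \<Longrightarrow> norm (G y - G a - (y - a)) \<le> e * norm (y - a)"
      using e by meson
    show ?thesis
      by (rule exI[of _ "min r1 r2"]) (use r1 r2 in \<open>auto simp: dist_norm norm_minus_commute\<close>)
  qed
  obtain r where r: "r > 0" "ball a r \<subseteq> U"
    "\<And>y. y \<in> ball a r \<Longrightarrow> norm (G y - G a - (y - a)) \<le> (1/2) * norm (y - a)"
    using approx[of "1/2"] by auto
  have "G a \<in> interior (G ` ball a r)"
    by (rule sussmann_open_mapping[OF U(1) cont U(2) der, of "\<lambda>x. x"])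
       (use r in \<open>auto simp: bounded_linear_ident interior_open\<close>)
  then obtain s where s: "s > 0" "ball (G a) s \<subseteq> G ` ball a r"
    by (metis mem_interior)
  define k where "k t = (SOME k. a - k \<in> ball a r \<and> G (a - k) = G a - t *\<^sub>R h)" for t
  have "((\<lambda>t. norm (t *\<^sub>R h)) \<longlongrightarrow> norm (0 *\<^sub>R h)) (at_right 0)"
    by (intro tendsto_intros)
  then have "\<forall>\<^sub>F t in at_right 0. norm (t *\<^sub>R h) < s"
    using s(1) by (auto intro: order_tendstoD)
  moreover have pos: "\<forall>\<^sub>F t::real in at_right 0. t > 0" by (simp add: eventually_at_right_less)
  ultimately have k: "\<forall>\<^sub>F t in at_right 0. t > 0 \<and> a - k t \<in> ball a r \<and> G (a - k t) = G a - t *\<^sub>R h"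
  proof eventually_elim
    case (elim t)
    have "G a - t *\<^sub>R h \<in> ball (G a) s" using elim by (simp add: dist_norm)
    then obtain y where "y \<in> ball a r" "G y = G a - t *\<^sub>R h" using s(2) by (metis (no_types, lifting) imageE subsetD)
    then have "\<exists>k. a - k \<in> ball a r \<and> G (a - k) = G a - t *\<^sub>R h"
      by (intro exI[of _ "a - y"]) simp
    from someI_ex[OF this] elim show ?case unfolding k_def by simp
  qed
  have bound: "\<forall>\<^sub>F t in at_right 0. norm (k t) \<le> 2 * t * norm h"
    using k
  proof eventually_elim
    case (elim t)
    have "norm (k t - t *\<^sub>R h) \<le> (1/2) * norm (k t)"
      using r(3)[of "a - k t"] elim by (simp add: norm_minus_commute algebra_simps)
    moreover have "norm (k t) \<le> norm (k t - t *\<^sub>R h) + norm (t *\<^sub>R h)"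
      by (metis diff_add_cancel norm_triangle_ineq)
    ultimately show ?case using elim by simp
  qed
  have "((\<lambda>t. 2 * t * norm h) \<longlongrightarrow> 2 * 0 * norm h) (at_right 0)" by (intro tendsto_intros)
  then have k0: "(k \<longlongrightarrow> 0) (at_right 0)"
    using bound by (intro Lim_null_comparison[of k "\<lambda>t. 2 * t * norm h"]) auto
  have "((\<lambda>t. (1 / t) *\<^sub>R k t - h) \<longlongrightarrow> 0) (at_right 0)"
  proof (rule tendstoI)
    fix e :: real assume e: "e > 0"
    \<comment> \<open>Chosen so that \<open>\<eta> * (2 * norm h) < e\<close>; the summand 1 covers
      \<open>h = 0\<close>.\<close>
    define \<eta> where "\<eta> = e / (2 * norm h + 1)"
    have w: "2 * norm h + 1 > 0" by (simp add: add_nonneg_pos)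
    then have \<eta>: "\<eta> > 0" using e unfolding \<eta>_def by simp
    have "\<eta> * (2 * norm h) < \<eta> * (2 * norm h + 1)" using \<eta> by simp
    also have "\<dots> = e" using w unfolding \<eta>_def by simp
    finally have \<eta>': "\<eta> * (2 * norm h) < e" .
    obtain r' where r': "r' > 0" "\<And>y. y \<in> ball a r' \<Longrightarrow> norm (G y - G a - (y - a)) \<le> \<eta> * norm (y - a)"
      using approx[OF \<eta>] by auto
    have "\<forall>\<^sub>F t in at_right 0. norm (k t) < r'"
      using tendsto_norm[OF k0] r'(1) by (auto intro: order_tendstoD)
    then show "\<forall>\<^sub>F t in at_right 0. dist ((1 / t) *\<^sub>R k t - h) 0 < e"
      using k bound
    proof eventually_elim
      case (elim t)
      have "norm (k t - t *\<^sub>R h) \<le> \<eta> * norm (k t)"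
        using r'(2)[of "a - k t"] elim by (simp add: dist_norm norm_minus_commute algebra_simps)
      also have "\<dots> \<le> \<eta> * (2 * t * norm h)" using elim \<eta> by (intro mult_left_mono) auto
      also have "\<dots> < t * e" using elim \<eta>' by (simp add: mult.left_commute mult.commute)
      finally have lt: "norm (k t - t *\<^sub>R h) < t * e" .
      have "(1 / t) *\<^sub>R k t - h = (1 / t) *\<^sub>R (k t - t *\<^sub>R h)"
        using elim by (simp add: scaleR_diff_right)
      then have "norm ((1 / t) *\<^sub>R k t - h) = norm (k t - t *\<^sub>R h) / t" using elim by simp
      also have "\<dots> < e" using lt elim by (simp add: pos_divide_less_eq mult.commute)
      finally show ?case by simp
    qed
  qed
  then have "((\<lambda>t. (1 / t) *\<^sub>R k t) \<longlongrightarrow> h) (at_right 0)" by (rule LIM_zero_cancel)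
  moreover have "\<forall>\<^sub>F t in at_right 0. a - k t \<in> U \<and> G (a - k t) = G a - t *\<^sub>R h"
    using k by eventually_elim (use r(2) in auto)
  ultimately show thesis using that by blast
qed

section \<open>Matrix units and elementary similarities\<close>

lemma matrix_eq_columns:
  fixes A B P Q :: "complex^'n^'n"
  assumes "P ** Q = mat 1" "\<And>k. A *v column k P = B *v column k P"
  shows "A = B"
proof -
  have *: "(C ** P) $ i $ k = (C *v column k P) $ i" for C :: "complex^'n^'n" and i k
    by (simp add: matrix_matrix_mult_def matrix_vector_mult_def column_def)
  have "A ** P = B ** P" unfolding vec_eq_iff * by (simp add: assms(2))
  then show ?thesis by (metis assms(1) matrix_mul_assoc matrix_mul_rid)
qed

text \<open>The coefficient is part of the unit because a real linear map must be tested on all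
  complex multiples separately.\<close>

definition munit :: "'n \<Rightarrow> 'n \<Rightarrow> complex \<Rightarrow> complex^'n^'n" where
  "munit i j c = (\<chi> k l. if k = i \<and> l = j then c else 0)"

lemma munit_component [simp]: "munit i j c $ k $ l = (if k = i \<and> l = j then c else 0)"
  by (simp add: munit_def)

lemma matrix_munit_sum: "A = (\<Sum>i\<in>UNIV. \<Sum>j\<in>UNIV. munit i j (A $ i $ j))"
proof -
  have "(\<Sum>j\<in>UNIV. if k = i \<and> l = j then A $ i $ j else 0) = (if k = i then A $ i $ l else 0)" for i k l
    by (cases "k = i") simp_all
  then show ?thesis by (simp add: vec_eq_iff)
qed

lemma munit_mult_munit: "munit i j c ** munit k l c' = (if j = k then munit i l (c * c') else 0)"
proof -
  have "(\<Sum>r\<in>UNIV. (if p = i \<and> r = j then c else 0) * (if r = j \<and> q = l then c' else 0))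
     = (\<Sum>r\<in>UNIV. if r = j then (if p = i \<and> q = l then c * c' else 0) else 0)" for p q
    by (intro sum.cong) auto
  moreover have "j \<noteq> k \<Longrightarrow> (\<Sum>r\<in>UNIV. (if p = i \<and> r = j then c else 0) * (if r = k \<and> q = l then c' else 0)) = 0" for p q
    by (intro sum.neutral) auto
  ultimately have "(munit i j c ** munit k l c') $ p $ q = (if j = k then munit i l (c * c') else 0) $ p $ q" for p q
    by (cases "j = k") (simp_all add: matrix_matrix_mult_def)
  then show ?thesis by (simp add: vec_eq_iff)
qed

lemma cdiag_mult: "(cdiag d ** A) $ i $ j = d $ i * A $ i $ j"
  by (simp add: matrix_matrix_mult_def if_distrib if_distribR cong: if_cong)

lemma mult_cdiag: "(A ** cdiag d) $ i $ j = A $ i $ j * d $ j"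
  by (simp add: matrix_matrix_mult_def if_distrib if_distribR cong: if_cong)

lemma elementary_inverse:
  assumes "i \<noteq> j"
  shows "(mat 1 + munit i j s) ** (mat 1 - munit i j s) = mat 1"
    "(mat 1 - munit i j s) ** (mat 1 + munit i j s) = mat 1"
  using assms
  by (simp_all add: matrix_add_ldistrib matrix_add_rdistrib matrix_diff_ldistrib matrix_diff_rdistrib munit_mult_munit)

text \<open>The matrix unit squares to zero, so the conjugation has no higher-order terms. If
  \<open>d $ i \<noteq> d $ j\<close>, a suitable \<open>s\<close> produces every multiple of
  \<open>munit i j 1\<close> without changing the eigenvalues.\<close>

lemma elementary_conj_diag:
  assumes "i \<noteq> j"
  shows "(mat 1 + munit i j s) ** cdiag d ** (mat 1 - munit i j s) = cdiag d + munit i j (s * (d $ j - d $ i))"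
proof -
  have 1: "munit i j s ** cdiag d = munit i j (s * d $ j)"
    by (auto simp: vec_eq_iff mult_cdiag)
  have 2: "cdiag d ** munit i j s = munit i j (s * d $ i)"
    by (auto simp: vec_eq_iff cdiag_mult)
  show ?thesis
    using assms
    by (simp add: matrix_add_ldistrib matrix_add_rdistrib matrix_diff_ldistrib 1 2 munit_mult_munit)
       (auto simp: vec_eq_iff algebra_simps)
qed

lemma norm_mscale: "norm (mscale c A) = cmod c * norm A"
  by (simp add: norm_vec_def L2_set_def norm_mult power_mult_distrib real_sqrt_mult
      flip: sum_distrib_left)

lemma mscale_mscale: "mscale a (mscale b A) = mscale (a * b) A"
  by (simp add: vec_eq_iff)

lemma mscale_add: "mscale c (A + B) = mscale c A + mscale c B"
  by (simp add: vec_eq_iff distrib_left)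

lemma mscale_conj_diag: "mscale c (P ** cdiag d ** Q) = P ** cdiag (c *s d) ** Q"
proof -
  have "mscale c (cdiag d) = cdiag (c *s d)" by (simp add: vec_eq_iff)
  then show ?thesis by (metis mscale_mult_left mscale_mult_right)
qed

section \<open>Fixed points at which the derivative is the identity\<close>

locale spec_rad_isometry =
  fixes U :: "(complex^'n^'n) set" and G :: "complex^'n^'n \<Rightarrow> complex^'n^'n"
    and G' :: "complex^'n^'n \<Rightarrow> ((complex^'n^'n) \<Rightarrow>\<^sub>L (complex^'n^'n))"
  assumes open_U: "open U"
    and deriv: "\<And>x. x \<in> U \<Longrightarrow> (G has_derivative blinfun_apply (G' x)) (at x)"
    and iso: "\<And>x y. x \<in> U \<Longrightarrow> y \<in> U \<Longrightarrow> spec_rad (G x - G y) = spec_rad (x - y)"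
begin

text \<open>Both conditions are equations in continuous quantities, since \<open>G'\<close> takes
  values in a normed space of operators; a point satisfying them can serve again as base point of
  the eigenvector test.\<close>

definition Good :: "(complex^'n^'n) set" where
  "Good = {a \<in> U. G a = a \<and> G' a = id_blinfun}"

lemma cont_G: "continuous_on U G"
  by (meson continuous_at_imp_continuous_on deriv has_derivative_continuous)

text \<open>Moving the base point to \<open>a - k t\<close> perturbs the difference of the images by
  \<open>outer v g\<close> and the difference of the points by \<open>k t\<close>. The first-order
  test for all \<open>g\<close> makes \<open>v\<close> a multiple of column \<open>j\<close> of
  \<open>P\<close>, after which its eigenvalue is identified as well.\<close>

lemma dominant_eigenvector:
  fixes P Q :: "complex^'n^'n"
  assumes a: "a \<in> Good" and PQ: "P ** Q = mat 1" "Q ** P = mat 1"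
    and x: "a + P ** cdiag d ** Q \<in> U"
    and dom: "\<And>i. i \<noteq> j \<Longrightarrow> cmod (d $ i) < cmod (d $ j)" and nz: "d $ j \<noteq> 0"
  shows "G (a + P ** cdiag d ** Q) *v column j P = (a + P ** cdiag d ** Q) *v column j P"
proof -
  define z where "z = P ** cdiag d ** Q"
  define w where "w = G (a + z) - G a"
  define e where "e = column j P"
  have aU: "a \<in> U" "G a = a" "G' a = id_blinfun" using a unfolding Good_def by auto
  have xU: "a + z \<in> U" using x unfolding z_def .
  have e: "z *v e = d $ j *s e" unfolding z_def e_def by (rule conj_diag_column[OF PQ(2)])
  have sw: "spec_rad w = cmod (d $ j)"
    using iso[OF xU aU(1)] spec_rad_conj_diag[OF PQ dom] unfolding w_def z_def by simp
  obtain \<mu> v where v: "v \<noteq> 0" "w *v v = \<mu> *s v" "cmod \<mu> = cmod (d $ j)"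
    using spec_rad_eigenvector[of w] sw by metis
  have "Re (cnj \<mu> * bdot g v) \<le> Re ((cnj (d $ j) * (Q *v v) $ j) * bdot g e)" for g
  proof -
    have "(G has_derivative (\<lambda>x. x)) (at a)"
      using deriv[OF aU(1)] aU(3) by (simp add: id_blinfun.rep_eq)
    then obtain k where k: "((\<lambda>t. (1 / t) *\<^sub>R k t) \<longlongrightarrow> outer v g) (at_right 0)"
      "\<forall>\<^sub>F t in at_right 0. a - k t \<in> U \<and> G (a - k t) = G a - t *\<^sub>R outer v g"
      using local_inverse_curve[OF open_U aU(1) cont_G] by blast
    have "\<forall>\<^sub>F t in at_right 0. spec_rad (w + t *\<^sub>R outer v g) \<le> spec_rad (P ** cdiag d ** Q + k t)"
      using k(2)
    proof eventually_elim
      case (elim t)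
      have "w + t *\<^sub>R outer v g = G (a + z) - G (a - k t)"
        using elim unfolding w_def by simp
      moreover have "z + k t = (a + z) - (a - k t)" by simp
      ultimately have "spec_rad (w + t *\<^sub>R outer v g) = spec_rad (z + k t)"
        using iso[OF xU, of "a - k t"] elim by metis
      then show ?case unfolding z_def by simp
    qed
    from peripheral_eigenvector_ineq[OF PQ dom v outer_mult_vec k(1) this]
    show ?thesis unfolding conj_outer_component e_def by (simp add: mult.assoc)
  qed
  then have eq: "cnj \<mu> *s v = (cnj (d $ j) * (Q *v v) $ j) *s e" by (rule Re_le_imp_eq)
  have \<mu>0: "\<mu> \<noteq> 0" using v(3) nz by auto
  define \<sigma> where "\<sigma> = (Q *v v) $ j"
  have \<sigma>: "\<sigma> \<noteq> 0"
  proof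
    assume "\<sigma> = 0"
    then have "cnj \<mu> *s v = 0" using eq unfolding \<sigma>_def by simp
    then show False using v(1) \<mu>0 by simp
  qed
  \<comment> \<open>Column \<open>j\<close> of \<open>P\<close> has coordinate 1 in its own
    direction; applying \<open>Q\<close> to \<open>eq\<close> and reading coordinate
    \<open>j\<close> therefore compares \<mu> with \<open>d $ j\<close>.\<close>
  have "(Q *v e) $ j = 1"
  proof -
    have "(Q *v e) $ j = (Q ** P) $ j $ j"
      unfolding e_def by (simp add: matrix_vector_mult_def matrix_matrix_mult_def column_def)
    then show ?thesis by (simp add: PQ mat_def)
  qed
  moreover have "(Q *v (cnj \<mu> *s v)) $ j = cnj \<mu> * \<sigma>" unfolding \<sigma>_def by (simp add: vector_scalar_commute)
  ultimately have "cnj \<mu> * \<sigma> = cnj (d $ j) * \<sigma>"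
    unfolding eq by (auto simp add: vector_scalar_commute \<sigma>_def)
  then have \<mu>: "\<mu> = d $ j" using \<sigma> by simp
  then have "v = \<sigma> *s e" using eq \<mu>0 unfolding \<sigma>_def
    by (simp add: vec_eq_iff)
  then have "\<sigma> *s (w *v e) = \<sigma> *s (d $ j *s e)"
    using v(2) \<mu> by (simp add: vector_scalar_commute vector_smult_assoc mult.commute)
  then have "w *v e = d $ j *s e" using \<sigma> by (simp add: vec_eq_iff)
  then have "G (a + z) *v e = (a + z) *v e"
    unfolding w_def aU(2) by (simp add: matrix_vector_mult_diff_rdistrib matrix_vector_mult_add_rdistrib e diff_eq_eq)
  then show ?thesis unfolding z_def e_def .
qed

text \<open>Pushing \<open>d $ j\<close> radially outwards makes it strictly dominant and keeps the
  eigenvectors; the equation survives the limit because \<open>G\<close> is continuous.\<close>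

lemma weakly_dominant_eigenvector:
  fixes P Q :: "complex^'n^'n"
  assumes a: "a \<in> Good" and PQ: "P ** Q = mat 1" "Q ** P = mat 1"
    and x: "a + P ** cdiag d ** Q \<in> U"
    and dom: "\<And>i. cmod (d $ i) \<le> cmod (d $ j)"
  shows "G (a + P ** cdiag d ** Q) *v column j P = (a + P ** cdiag d ** Q) *v column j P"
proof -
  \<comment> \<open>The outward unit direction, giving
    \<open>cmod (d $ j + of_real t * u) = cmod (d $ j) + t\<close>; at the origin any direction is
    outward and 1 is taken.\<close>
  define u where "u = (if d $ j = 0 then 1 else sgn (d $ j))"
  define D where "D t = (\<chi> i. if i = j then d $ j + of_real t * u else d $ i)" for t
  define X where "X t = a + P ** cdiag (D t) ** Q" for t
  have cm: "cmod (d $ j + of_real t * u) = cmod (d $ j) + t" if "t > 0" for t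
  proof (cases "d $ j = 0")
    case False
    have "d $ j + of_real t * u = of_real (cmod (d $ j) + t) * sgn (d $ j)"
      using False unfolding u_def by (simp add: sgn_eq field_simps)
    then show ?thesis using that False by (simp add: norm_mult norm_sgn del: of_real_add)
  qed (use that in \<open>simp add: u_def\<close>)
  have "((\<lambda>t. cdiag (D t)) \<longlongrightarrow> cdiag (D 0)) (at_right 0)"
    unfolding cdiag_def D_def by (intro vec_tendstoI) (auto intro!: tendsto_eq_intros)
  then have "(X \<longlongrightarrow> X 0) (at_right 0)"
    unfolding X_def by (intro tendsto_intros)
  moreover have "D 0 = d" by (simp add: D_def vec_eq_iff)
  ultimately have lim: "(X \<longlongrightarrow> X 0) (at_right 0)" and X0: "X 0 = a + P ** cdiag d ** Q"
    by (simp_all add: X_def)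
  have X0U: "X 0 \<in> U" using x X0 by simp
  have inU: "\<forall>\<^sub>F t in at_right 0. X t \<in> U"
    using lim open_U X0U by (rule topological_tendstoD)
  have "isCont G (X 0)" using deriv[OF X0U] by (rule has_derivative_continuous)
  then have "((\<lambda>t. G (X t)) \<longlongrightarrow> G (X 0)) (at_right 0)"
    using lim by (rule isCont_tendsto_compose)
  then have 1: "((\<lambda>t. G (X t) *v column j P) \<longlongrightarrow> G (X 0) *v column j P) (at_right 0)"
    by (rule tendsto_mult_vec)
  have 2: "((\<lambda>t. X t *v column j P) \<longlongrightarrow> X 0 *v column j P) (at_right 0)"
    using lim by (rule tendsto_mult_vec)
  have "\<forall>\<^sub>F t::real in at_right 0. t > 0" by (simp add: eventually_at_right_less)
  then have "\<forall>\<^sub>F t in at_right 0. X t *v column j P = G (X t) *v column j P"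
    using inU
  proof eventually_elim
    case (elim t)
    have "cmod (D t $ i) < cmod (D t $ j)" if "i \<noteq> j" for i
      using that elim(1) dom[of i] by (simp add: D_def cm)
    moreover have "cmod (D t $ j) > 0"
      using cm[OF elim(1)] elim(1) by (simp add: D_def add_nonneg_pos)
    then have "D t $ j \<noteq> 0" by auto
    ultimately show ?case
      using dominant_eigenvector[OF a PQ, of "D t" j] elim(2) unfolding X_def by simp
  qed
  with 2 have "((\<lambda>t. G (X t) *v column j P) \<longlongrightarrow> X 0 *v column j P) (at_right 0)"
    by (rule Lim_transform_eventually)
  then have "G (X 0) *v column j P = X 0 *v column j P"
    by (rule tendsto_unique[OF trivial_limit_at_right_real 1])
  then show ?thesis unfolding X0 .
qed

lemma fixed_point_step:
  fixes P Q :: "complex^'n^'n"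
  assumes a: "a \<in> Good" and PQ: "P ** Q = mat 1" "Q ** P = mat 1"
    and x: "a + P ** cdiag d ** Q \<in> U" and d: "\<And>i. cmod (d $ i) = r"
  shows "G (a + P ** cdiag d ** Q) = a + P ** cdiag d ** Q"
  by (rule matrix_eq_columns[OF PQ(1)], rule weakly_dominant_eigenvector[OF a PQ x]) (simp add: d)

lemma derivative_fixed_vector:
  assumes b: "b \<in> U" "G b = b"
    and ev: "\<forall>\<^sub>F t in at_right 0. G (b + t *\<^sub>R h) *v e = (b + t *\<^sub>R h) *v e"
  shows "blinfun_apply (G' b) h *v e = h *v e"
proof -
  have lim: "((\<lambda>t. ((1 / t) *\<^sub>R (G (b + t *\<^sub>R h) - G b)) *v e) \<longlongrightarrow> blinfun_apply (G' b) h *v e) (at_right 0)"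
    by (intro tendsto_mult_vec has_derivative_directional deriv b)
  have "\<forall>\<^sub>F t::real in at_right 0. t > 0" by (simp add: eventually_at_right_less)
  then have "\<forall>\<^sub>F t in at_right 0. ((1 / t) *\<^sub>R (G (b + t *\<^sub>R h) - G b)) *v e = h *v e"
    using ev
    by eventually_elim (simp add: b scaleR_mult_vec matrix_vector_mult_diff_rdistrib matrix_vector_mult_add_rdistrib)
  from Lim_transform_eventually[OF lim this] show ?thesis by (simp add: tendsto_const_iff)
qed

end

text \<open>In the square of the modulus the negative term \<open>2 * t * Re \<eta>\<close>
  outweighs the quadratic one for small \<open>t\<close>.\<close>

lemma cmod_one_plus_le_1:
  assumes "Re \<eta> < 0"
  shows "\<forall>\<^sub>F t in at_right 0. cmod (1 + of_real t * \<eta>) \<le> 1"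
proof -
  have "((\<lambda>t. t * (cmod \<eta>)\<^sup>2) \<longlongrightarrow> 0 * (cmod \<eta>)\<^sup>2) (at_right 0)" by (intro tendsto_intros)
  then have "\<forall>\<^sub>F t in at_right 0. t * (cmod \<eta>)\<^sup>2 < - 2 * Re \<eta>"
    using assms by (intro order_tendstoD(2)) auto
  moreover have "\<forall>\<^sub>F t::real in at_right 0. t > 0" by (simp add: eventually_at_right_less)
  ultimately show ?thesis
  proof eventually_elim
    case (elim t)
    have "(cmod (1 + of_real t * \<eta>))\<^sup>2 = 1 + t * (2 * Re \<eta> + t * (cmod \<eta>)\<^sup>2)"
      unfolding cmod_add_squared[of 1] by (simp add: norm_mult power_mult_distrib algebra_simps power2_eq_square)
    also have "\<dots> \<le> 1" using elim by (simp add: mult_le_0_iff)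
    finally have "(cmod (1 + of_real t * \<eta>))\<^sup>2 \<le> 1\<^sup>2" by simp
    then show ?case by (rule power2_le_imp_le) simp
  qed
qed

context spec_rad_isometry
begin

text \<open>Being a fixed point says nothing yet about the derivative at the new point
  \<open>b\<close>. It is computed on the real span of the matrices
  \<open>P ** munit i k c ** Q\<close>: points close to \<open>b\<close> in these directions are
  still diagonalisable and can be tested from the old base point \<open>a\<close>.\<close>

lemma good_step:
  fixes P Q :: "complex^'n^'n"
  assumes a: "a \<in> Good" and PQ: "P ** Q = mat 1" "Q ** P = mat 1"
    and x: "a + P ** cdiag d ** Q \<in> U" and d: "\<And>i. cmod (d $ i) = r" and r: "r > 0"
    and inj: "\<And>i k. i \<noteq> k \<Longrightarrow> d $ i \<noteq> d $ k"
  shows "a + P ** cdiag d ** Q \<in> Good"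
proof -
  define b where "b = a + P ** cdiag d ** Q"
  have bU: "b \<in> U" using x unfolding b_def .
  have Gb: "G b = b" unfolding b_def by (rule fixed_point_step[OF a PQ x d])
  define T where "T = blinfun_apply (G' b)"
  have T: "bounded_linear T" unfolding T_def by (rule blinfun.bounded_linear_right)
  note T_lin = linear_simps[OF T] linear_sum[OF bounded_linear.linear[OF T]]
  have near: "\<forall>\<^sub>F t in at_right 0. b + t *\<^sub>R h \<in> U" for h
  proof -
    have "((\<lambda>t. b + t *\<^sub>R h) \<longlongrightarrow> b + 0 *\<^sub>R h) (at_right 0)" by (intro tendsto_intros)
    then show ?thesis using open_U bU by (intro topological_tendstoD) auto
  qed
  have scale: "t *\<^sub>R (P ** munit i k c ** Q) = P ** munit i k (of_real t * c) ** Q" for t i k c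
  proof -
    have "munit i k (of_real t * c) = mscale (of_real t) (munit i k c)" by (simp add: vec_eq_iff)
    then show ?thesis by (simp add: scaleR_eq_mscale mscale_mult_left mscale_mult_right)
  qed
  \<comment> \<open>Moving along \<open>munit i k\<close> only conjugates the diagonal matrix, because the \<open>d $ i\<close> are distinct.\<close>
  have off: "T (P ** munit i k c ** Q) = P ** munit i k c ** Q" if ik: "i \<noteq> k" for i k c
  proof (rule matrix_eq_columns[OF PQ(1)], unfold T_def, rule derivative_fixed_vector[OF bU Gb])
    fix l
    show "\<forall>\<^sub>F t in at_right 0. G (b + t *\<^sub>R (P ** munit i k c ** Q)) *v column l P =
        (b + t *\<^sub>R (P ** munit i k c ** Q)) *v column l P"
      using near[of "P ** munit i k c ** Q"]
    proof eventually_elim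
      case (elim t)
      \<comment> \<open>Solves \<open>s * (d $ k - d $ i) = of_real t * c\<close>.\<close>
      define s where "s = of_real t * c / (d $ k - d $ i)"
      define R where "R = mat 1 + munit i k s"
      define R' where "R' = mat 1 - munit i k s"
      have R: "R ** R' = mat 1" "R' ** R = mat 1"
        unfolding R_def R'_def using elementary_inverse[OF ik] by auto
      have PR: "(P ** R) ** (R' ** Q) = mat 1" "(R' ** Q) ** (P ** R) = mat 1"
        by (metis PQ R matrix_mul_assoc matrix_mul_rid)+
      have "s * (d $ k - d $ i) = of_real t * c" using inj[OF ik] unfolding s_def by simp
      then have "R ** cdiag d ** R' = cdiag d + munit i k (of_real t * c)"
        unfolding R_def R'_def elementary_conj_diag[OF ik] by simp
      then have "(P ** R) ** cdiag d ** (R' ** Q) = P ** (cdiag d + munit i k (of_real t * c)) ** Q"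
        by (metis matrix_mul_assoc)
      then have eq: "b + t *\<^sub>R (P ** munit i k c ** Q) = a + (P ** R) ** cdiag d ** (R' ** Q)"
        unfolding b_def scale by (simp add: matrix_add_ldistrib matrix_add_rdistrib add.assoc)
      have "G (a + (P ** R) ** cdiag d ** (R' ** Q)) = a + (P ** R) ** cdiag d ** (R' ** Q)"
        using elim unfolding eq by (intro fixed_point_step[OF a PR _ d])
      then show ?case unfolding eq by simp
    qed
  qed
  \<comment> \<open>Enlarging \<open>d $ i\<close> keeps eigenvector \<open>i\<close> dominant and shrinking it keeps the others; since \<open>T\<close> is
      real linear, each half-plane of directions suffices.\<close>
  have diag: "T (P ** munit i i c ** Q) = P ** munit i i c ** Q" for i c
  proof (rule matrix_eq_columns[OF PQ(1)])
    fix k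
    \<comment> \<open>The direction is measured relative to \<open>d $ i\<close>, so that \<eta>
      multiplies this entry by \<open>1 + of_real t * \<eta>\<close> and the common modulus
      \<open>r\<close> factors out.\<close>
    define X where "X \<eta> = P ** munit i i (\<eta> * d $ i) ** Q" for \<eta>
    define D where "D t \<eta> = (\<chi> l. if l = i then d $ i * (1 + of_real t * \<eta>) else d $ l)" for t \<eta>
    have X_add: "X (\<eta> + \<theta>) = X \<eta> + X \<theta>" for \<eta> \<theta>
    proof -
      have "munit i i ((\<eta> + \<theta>) * d $ i) = munit i i (\<eta> * d $ i) + munit i i (\<theta> * d $ i)"
        by (simp add: vec_eq_iff algebra_simps)
      then show ?thesis unfolding X_def by (simp add: matrix_add_ldistrib matrix_add_rdistrib)
    qed
    have X_t: "b + t *\<^sub>R X \<eta> = a + P ** cdiag (D t \<eta>) ** Q" for t \<eta>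
    proof -
      have "cdiag (D t \<eta>) = cdiag d + munit i i (of_real t * (\<eta> * d $ i))"
        unfolding D_def by (auto simp: vec_eq_iff algebra_simps)
      then show ?thesis unfolding b_def X_def scale
        by (simp add: matrix_add_ldistrib matrix_add_rdistrib add.assoc)
    qed
    have half: "T (X \<eta>) *v column k P = X \<eta> *v column k P"
      if "k \<noteq> i \<and> Re \<eta> < 0 \<or> k = i \<and> Re \<eta> > 0" for \<eta>
    proof -
      have pos: "\<forall>\<^sub>F t::real in at_right 0. t > 0" by (simp add: eventually_at_right_less)
      have "\<forall>\<^sub>F t in at_right 0. \<forall>l. cmod (D t \<eta> $ l) \<le> cmod (D t \<eta> $ k)"
      proof (cases "k = i")
        case True
        show ?thesis using pos
        proof eventually_elim
          case (elim t)
          have "1 \<le> Re (1 + of_real t * \<eta>)" using that True elim by simp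
          also have "\<dots> \<le> cmod (1 + of_real t * \<eta>)" by (rule complex_Re_le_cmod)
          finally have "r \<le> r * cmod (1 + of_real t * \<eta>)" using r by simp
          then show ?case using True by (simp add: D_def norm_mult d)
        qed
      next
        case False
        then have "Re \<eta> < 0" using that by simp
        from cmod_one_plus_le_1[OF this] show ?thesis
        proof eventually_elim
          case (elim t)
          then have "r * cmod (1 + of_real t * \<eta>) \<le> r" using r by simp
          then show ?case using False by (simp add: D_def norm_mult d)
        qed
      qed
      then have "\<forall>\<^sub>F t in at_right 0. G (b + t *\<^sub>R X \<eta>) *v column k P = (b + t *\<^sub>R X \<eta>) *v column k P"
        using near[of "X \<eta>"]
        by eventually_elim (unfold X_t, rule weakly_dominant_eigenvector[OF a PQ], auto)
      then show ?thesis unfolding T_def by (rule derivative_fixed_vector[OF bU Gb])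
    qed
    have add: "T (X (\<eta> + \<theta>)) *v column k P = X (\<eta> + \<theta>) *v column k P"
      if "T (X \<eta>) *v column k P = X \<eta> *v column k P" "T (X \<theta>) *v column k P = X \<theta> *v column k P" for \<eta> \<theta>
      using that unfolding X_add by (simp add: T_lin matrix_vector_mult_add_rdistrib)
    have X0: "T (X 0) *v column k P = X 0 *v column k P"
    proof -
      have "X 0 = 0" using X_add[of 0 0] by simp
      then show ?thesis by (simp add: T_lin)
    qed
    have neg: "T (X (- \<eta>)) *v column k P = X (- \<eta>) *v column k P"
      if "T (X \<eta>) *v column k P = X \<eta> *v column k P" for \<eta>
    proof -
      have "X (- \<eta>) = - X \<eta>" using X_add[of \<eta> "- \<eta>"] X_add[of 0 0] by (simp add: add_eq_0_iff)
      then show ?thesis using that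
        by (simp add: T_lin) (metis diff_0 matrix_vector_mult_diff_rdistrib)
    qed
    have nz: "T (X \<eta>) *v column k P = X \<eta> *v column k P" if "Re \<eta> \<noteq> 0" for \<eta>
      using half[of \<eta>] half[of "- \<eta>"] neg[of "- \<eta>"] that
      by (metis minus_complex.simps(1) uminus_complex.simps(1) add.inverse_inverse linorder_neqE_linordered_idom neg_0_less_iff_less neg_less_0_iff_less)
    \<comment> \<open>A purely imaginary direction is the sum of \<open>\<eta> + 1\<close> and
      \<open>-1\<close>, both with nonzero real part.\<close>
    have all: "T (X \<eta>) *v column k P = X \<eta> *v column k P" for \<eta>
    proof (cases "Re \<eta> = 0")
      case True
      then show ?thesis using add[OF nz[of "\<eta> + 1"] nz[of "-1"]] by simp
    qed (rule nz)
    have "d $ i \<noteq> 0" using d[of i] r by auto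
    then have "X (c / d $ i) = P ** munit i i c ** Q" unfolding X_def by simp
    then show "T (P ** munit i i c ** Q) *v column k P = (P ** munit i i c ** Q) *v column k P"
      using all by metis
  qed
  have unit: "T (P ** munit i k c ** Q) = P ** munit i k c ** Q" for i k c
    using off diag by (cases "i = k") auto
  have "T M = M" for M
  proof -
    have lin: "linear (\<lambda>h. P ** h ** Q)" by (rule bounded_linear.linear[OF bounded_linear_matrix_conj])
    have "M = P ** (Q ** M ** P) ** Q" by (rule conj_conj[OF PQ(1), symmetric])
    also have "\<dots> = (\<Sum>i\<in>UNIV. \<Sum>k\<in>UNIV. P ** munit i k ((Q ** M ** P) $ i $ k) ** Q)"
      by (subst matrix_munit_sum[of "Q ** M ** P"]) (simp add: linear_sum[OF lin])
    finally have M: "M = (\<Sum>i\<in>UNIV. \<Sum>k\<in>UNIV. P ** munit i k ((Q ** M ** P) $ i $ k) ** Q)" .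
    have "T M = (\<Sum>i\<in>UNIV. \<Sum>k\<in>UNIV. T (P ** munit i k ((Q ** M ** P) $ i $ k) ** Q))"
      by (subst M) (simp add: T_lin)
    also have "\<dots> = M" unfolding unit by (rule M[symmetric])
    finally show ?thesis .
  qed
  then have "G' b = id_blinfun" unfolding T_def by (intro blinfun_eqI) simp
  then show ?thesis using bU Gb unfolding Good_def b_def by simp
qed

text \<open>The radius \<open>\<delta>\<close> depends on \<open>r\<close> but not on \<open>a\<close>, so that reachable directions can be added up.\<close>

definition Reach :: "complex^'n^'n \<Rightarrow> bool" where
  "Reach x \<longleftrightarrow> (\<forall>r>0. \<exists>\<delta>>0. \<forall>a\<in>Good. ball a r \<subseteq> U \<longrightarrow> (\<forall>c. cmod c < \<delta> \<longrightarrow> a + mscale c x \<in> Good))"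

lemma small_mscale:
  assumes "r > 0" obtains \<delta> where "\<delta> > 0" "\<And>c. cmod c < \<delta> \<Longrightarrow> norm (mscale c x) < r"
proof (rule that[of "r / (norm x + 1)"])
  have p: "norm x + 1 > 0" by (simp add: add_nonneg_pos)
  show "r / (norm x + 1) > 0" using assms p by simp
  fix c assume "cmod c < r / (norm x + 1)"
  then have "cmod c * (norm x + 1) < r" using p by (simp add: pos_less_divide_eq)
  moreover have "cmod c * norm x \<le> cmod c * (norm x + 1)" by (intro mult_left_mono) auto
  ultimately show "norm (mscale c x) < r" by (simp add: norm_mscale)
qed

lemma Reach_conj_diag:
  fixes P Q :: "complex^'n^'n"
  assumes PQ: "P ** Q = mat 1" "Q ** P = mat 1"
    and d: "\<And>i. cmod (d $ i) = 1" and inj: "\<And>i k. i \<noteq> k \<Longrightarrow> d $ i \<noteq> d $ k"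
  shows "Reach (P ** cdiag d ** Q)"
  unfolding Reach_def
proof (intro allI impI)
  fix r :: real assume "r > 0"
  then obtain \<delta> where \<delta>: "\<delta> > 0" "\<And>c. cmod c < \<delta> \<Longrightarrow> norm (mscale c (P ** cdiag d ** Q)) < r"
    using small_mscale by blast
  have "a + mscale c (P ** cdiag d ** Q) \<in> Good" if "a \<in> Good" "ball a r \<subseteq> U" "cmod c < \<delta>" for a c
  proof (cases "c = 0")
    case True
    then have "mscale c (P ** cdiag d ** Q) = 0" by (simp add: vec_eq_iff)
    then show ?thesis using that by simp
  next
    case False
    have "a + mscale c (P ** cdiag d ** Q) \<in> U"
      using that \<delta>(2)[of c] by (auto simp: dist_norm)
    then show ?thesis unfolding mscale_conj_diag
      by (intro good_step[OF that(1) PQ, of _ "cmod c"])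
         (use False inj in \<open>auto simp: norm_mult d\<close>)
  qed
  then show "\<exists>\<delta>>0. \<forall>a\<in>Good. ball a r \<subseteq> U \<longrightarrow> (\<forall>c. cmod c < \<delta> \<longrightarrow> a + mscale c (P ** cdiag d ** Q) \<in> Good)"
    using \<delta>(1) by blast
qed

text \<open>One direction is used at a time. The first move is kept shorter than \<open>r/2\<close>,
  so a ball of radius \<open>r/2\<close> about the new point still lies in \<open>U\<close> and the
  induction hypothesis for \<open>r/2\<close> applies.\<close>

lemma Reach_sum:
  assumes "finite S" "\<And>s. s \<in> S \<Longrightarrow> Reach (x s)" "r > 0"
  shows "\<exists>\<delta>>0. \<forall>a\<in>Good. ball a r \<subseteq> U \<longrightarrow>
      (\<forall>c. (\<forall>s\<in>S. cmod (c s) < \<delta>) \<longrightarrow> a + (\<Sum>s\<in>S. mscale (c s) (x s)) \<in> Good)"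
  using assms
proof (induction S arbitrary: r rule: finite_induct)
  case empty
  then show ?case by (auto intro: exI[of _ 1])
next
  case (insert y S)
  have "\<exists>\<delta>>0. \<forall>a\<in>Good. ball a (r/2) \<subseteq> U \<longrightarrow>
      (\<forall>c. (\<forall>s\<in>S. cmod (c s) < \<delta>) \<longrightarrow> a + (\<Sum>s\<in>S. mscale (c s) (x s)) \<in> Good)"
    by (rule insert.IH) (use insert.prems in auto)
  then obtain \<delta>1 where \<delta>1: "\<delta>1 > 0" "\<forall>a\<in>Good. ball a (r/2) \<subseteq> U \<longrightarrow>
      (\<forall>c. (\<forall>s\<in>S. cmod (c s) < \<delta>1) \<longrightarrow> a + (\<Sum>s\<in>S. mscale (c s) (x s)) \<in> Good)"
    by auto
  have "Reach (x y)" using insert.prems by simp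
  then obtain \<delta>2 where \<delta>2: "\<delta>2 > 0" "\<forall>a\<in>Good. ball a r \<subseteq> U \<longrightarrow> (\<forall>c. cmod c < \<delta>2 \<longrightarrow> a + mscale c (x y) \<in> Good)"
    using insert.prems(2) unfolding Reach_def by auto
  obtain \<delta>3 where \<delta>3: "\<delta>3 > 0" "\<And>c. cmod c < \<delta>3 \<Longrightarrow> norm (mscale c (x y)) < r/2"
    using small_mscale[of "r/2"] insert.prems(2) by auto
  have "a + (\<Sum>s\<in>insert y S. mscale (c s) (x s)) \<in> Good"
    if a: "a \<in> Good" "ball a r \<subseteq> U" and c: "\<forall>s\<in>insert y S. cmod (c s) < min \<delta>1 (min \<delta>2 \<delta>3)" for a c
  proof -
    have 1: "a + mscale (c y) (x y) \<in> Good" using \<delta>2(2) a c by simp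
    have "ball (a + mscale (c y) (x y)) (r/2) \<subseteq> ball a r"
    proof
      fix z assume "z \<in> ball (a + mscale (c y) (x y)) (r/2)"
      moreover have "dist a (a + mscale (c y) (x y)) < r/2" using \<delta>3(2)[of "c y"] c by (simp add: dist_norm)
      ultimately show "z \<in> ball a r" using dist_triangle[of a z "a + mscale (c y) (x y)"] by simp
    qed
    then have "(a + mscale (c y) (x y)) + (\<Sum>s\<in>S. mscale (c s) (x s)) \<in> Good"
      using c a 1 \<delta>1(2) by auto
    then show ?thesis using insert.hyps by (simp add: add.assoc)
  qed
  then show ?case using \<delta>1(1) \<delta>2(1) \<delta>3(1)
    by (intro exI[of _ "min \<delta>1 (min \<delta>2 \<delta>3)"]) auto
qed

text \<open>An instance of \<open>Reach_sum\<close>: the two directions are indexed by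
  \<open>bool\<close> and carry the coefficients \<open>c * \<alpha>\<close> and
  \<open>c * \<beta>\<close>.\<close>

lemma Reach_lincomb:
  assumes "Reach x" "Reach y" shows "Reach (mscale \<alpha> x + mscale \<beta> y)"
  unfolding Reach_def
proof (intro allI impI)
  fix r :: real assume "r > 0"
  define z where "z s = (if s then x else y)" for s
  have "Reach (z s)" for s using assms by (simp add: z_def)
  then obtain \<delta> where \<delta>: "\<delta> > 0" "\<And>a c. a \<in> Good \<Longrightarrow> ball a r \<subseteq> U \<Longrightarrow> (\<forall>s. cmod (c s) < \<delta>) \<Longrightarrow>
      a + (\<Sum>s\<in>UNIV. mscale (c s) (z s)) \<in> Good"
    using Reach_sum[of UNIV z r] \<open>r > 0\<close> by auto
  \<comment> \<open>Bounds both coefficients and is positive even if they vanish.\<close>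
  define K where "K = cmod \<alpha> + cmod \<beta> + 1"
  have K: "K > 0" unfolding K_def by (simp add: add_nonneg_pos)
  have "a + mscale c (mscale \<alpha> x + mscale \<beta> y) \<in> Good"
    if "a \<in> Good" "ball a r \<subseteq> U" "cmod c < \<delta> / K" for a c
  proof -
    have "cmod c * K < \<delta>" using that(3) K by (simp add: pos_less_divide_eq)
    moreover have "cmod c * cmod \<alpha> \<le> cmod c * K" "cmod c * cmod \<beta> \<le> cmod c * K"
      unfolding K_def by (intro mult_left_mono; simp)+
    ultimately have "\<forall>s. cmod (if s then c * \<alpha> else c * \<beta>) < \<delta>" by (auto simp: norm_mult)
    from \<delta>(2)[OF that(1,2) this] show ?thesis
      by (simp add: UNIV_bool z_def mscale_add mscale_mscale add_ac)
  qed
  then show "\<exists>\<delta>>0. \<forall>a\<in>Good. ball a r \<subseteq> U \<longrightarrow> (\<forall>c. cmod c < \<delta> \<longrightarrow> a + mscale c (mscale \<alpha> x + mscale \<beta> y) \<in> Good)"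
    using \<delta>(1) K by (intro exI[of _ "\<delta> / K"]) auto
qed

text \<open>Two diagonal matrices with distinct unimodular entries that differ only at
  \<open>j\<close> have a multiple of \<open>munit j j 1\<close> as difference. Since the unit
  circle is infinite, an entry \<open>c0\<close> is left over besides the \<open>CARD('n)\<close>
  entries already used.\<close>

lemma Reach_idempotent:
  fixes P Q :: "complex^'n^'n"
  assumes PQ: "P ** Q = mat 1" "Q ** P = mat 1"
  shows "Reach (P ** munit j j 1 ** Q)"
proof -
  have inf: "infinite (sphere (0::complex) 1)"
  proof
    assume "finite (sphere (0::complex) 1)"
    then have "sphere (0::complex) 1 = {} \<or> (\<exists>a. sphere (0::complex) 1 = {a})"
      using connected_finite_iff_sing[OF connected_sphere[of "0::complex" 1]] by simp
    moreover have "1 \<in> sphere (0::complex) 1" "- 1 \<in> sphere (0::complex) 1" by auto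
    ultimately have "(1::complex) = - 1" by (metis empty_iff singletonD)
    then show False by simp
  qed
  obtain A where A: "finite A" "card A = CARD('n)" "A \<subseteq> sphere (0::complex) 1"
    using infinite_arbitrarily_large[OF inf] by blast
  obtain f :: "'n \<Rightarrow> complex" where f: "bij_betw f UNIV A"
    using finite_same_card_bij[of "UNIV :: 'n set" A] A by auto
  have "infinite (sphere (0::complex) 1 - A)" using inf A by simp
  then obtain c0 where c0: "c0 \<in> sphere 0 1" "c0 \<notin> A" by (metis Diff_iff finite.emptyI ex_in_conv)
  define d where "d = (\<chi> i. f i)"
  define d' where "d' = (\<chi> i. if i = j then c0 else f i)"
  have fA: "f i \<in> A" for i using f by (auto simp: bij_betw_def)
  have f1: "cmod (f i) = 1" for i using fA[of i] A(3) by auto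
  have finj: "f i \<noteq> f k" if "i \<noteq> k" for i k using f that by (auto simp: bij_betw_def inj_on_def)
  have "Reach (P ** cdiag d ** Q)"
    by (rule Reach_conj_diag[OF PQ]) (auto simp: d_def f1 finj)
  moreover have "Reach (P ** cdiag d' ** Q)"
    using c0 fA by (intro Reach_conj_diag[OF PQ]) (auto simp: d'_def f1 finj)
  ultimately have "Reach (mscale (1 / (f j - c0)) (P ** cdiag d ** Q) + mscale (- 1 / (f j - c0)) (P ** cdiag d' ** Q))"
    by (rule Reach_lincomb)
  also have "mscale (1 / (f j - c0)) (P ** cdiag d ** Q) + mscale (- 1 / (f j - c0)) (P ** cdiag d' ** Q) =
      P ** (cdiag ((1 / (f j - c0)) *s d) + cdiag ((- 1 / (f j - c0)) *s d')) ** Q"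
    unfolding mscale_conj_diag by (simp add: matrix_add_ldistrib matrix_add_rdistrib)
  also have "cdiag ((1 / (f j - c0)) *s d) + cdiag ((- 1 / (f j - c0)) *s d') = munit j j 1"
    using c0 fA[of j] by (auto simp: vec_eq_iff d_def d'_def simp flip: diff_divide_distrib add_divide_distrib)
  finally show ?thesis .
qed

text \<open>For \<open>i \<noteq> j\<close> the matrix \<open>munit j j 1 + munit i j 1\<close> is
  similar to \<open>munit j j 1\<close>, so it is reachable, and the diagonal unit can be
  subtracted.\<close>

lemma Reach_munit: "Reach (munit i j 1)"
proof (cases "i = j")
  case True
  then show ?thesis using Reach_idempotent[of "mat 1" "mat 1" j] by simp
next
  case False
  have "Reach ((mat 1 + munit i j 1) ** munit j j 1 ** (mat 1 - munit i j 1))"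
    by (rule Reach_idempotent) (use elementary_inverse[OF False] in auto)
  moreover have "(mat 1 + munit i j 1) ** munit j j 1 ** (mat 1 - munit i j 1) = munit j j 1 + munit i j 1"
    using False by (simp add: matrix_add_ldistrib matrix_add_rdistrib matrix_diff_ldistrib munit_mult_munit)
  moreover have "Reach (munit j j 1)" using Reach_idempotent[of "mat 1" "mat 1" j] by simp
  ultimately have "Reach (mscale 1 (munit j j 1 + munit i j 1) + mscale (- 1) (munit j j 1))"
    by (intro Reach_lincomb) auto
  also have "mscale 1 (munit j j 1 + munit i j 1) + mscale (- 1) (munit j j 1) = munit i j 1"
    by (auto simp: vec_eq_iff)
  finally show ?thesis .
qed

text \<open>\<open>Reach\<close> allows complex coefficients, so the matrix units reach a full
  neighbourhood: the coefficients are the entries of the displacement, each bounded by its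
  norm.\<close>

lemma open_Good: "open Good"
  unfolding open_contains_ball
proof
  fix a assume a: "a \<in> Good"
  then have "a \<in> U" by (simp add: Good_def)
  then obtain r where r: "r > 0" "ball a r \<subseteq> U" using open_U by (meson openE)
  define x :: "'n \<times> 'n \<Rightarrow> complex^'n^'n" where "x = (\<lambda>(i, j). munit i j 1)"
  have "Reach (x s)" for s by (cases s) (simp add: x_def Reach_munit)
  then obtain \<delta> where \<delta>: "\<delta> > 0" "\<And>c. (\<forall>s. cmod (c s) < \<delta>) \<Longrightarrow> a + (\<Sum>s\<in>UNIV. mscale (c s) (x s)) \<in> Good"
    using Reach_sum[of UNIV x r] r a by auto
  have "ball a \<delta> \<subseteq> Good"
  proof
    fix b assume b: "b \<in> ball a \<delta>"
    define h where "h = b - a"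
    have "norm h < \<delta>" using b by (simp add: h_def dist_norm norm_minus_commute)
    then have "cmod (h $ i $ j) < \<delta>" for i j using norm_matrix_component_le[of h i j] by simp
    then have "a + (\<Sum>s\<in>UNIV. mscale (h $ fst s $ snd s) (x s)) \<in> Good"
      by (intro \<delta>(2)) simp
    also have "(\<Sum>s\<in>UNIV. mscale (h $ fst s $ snd s) (x s)) = (\<Sum>i\<in>UNIV. \<Sum>j\<in>UNIV. munit i j (h $ i $ j))"
    proof -
      have "mscale c (munit i j 1) = munit i j c" for c and i j :: 'n by (simp add: vec_eq_iff)
      then show ?thesis
        by (simp add: sum.cartesian_product x_def case_prod_unfold)
    qed
    also have "\<dots> = h" by (rule matrix_munit_sum[symmetric])
    finally show "b \<in> Good" by (simp add: h_def)
  qed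
  then show "\<exists>e>0. ball a e \<subseteq> Good" using \<delta>(1) by blast
qed

text \<open>Continuity of the derivative enters here, through the closedness of \<open>Good\<close>
  in \<open>U\<close>.\<close>

lemma identity_on_domain:
  assumes "connected U" "continuous_on U G'" "a \<in> Good" "x \<in> U"
  shows "G x = x"
proof -
  have "closedin (top_of_set U) {x \<in> U. (G x - x, G' x) = (0, id_blinfun)}"
    by (intro continuous_closedin_preimage_constant continuous_intros assms cont_G)
  moreover have "{x \<in> U. (G x - x, G' x) = (0, id_blinfun)} = Good"
    by (auto simp: Good_def)
  moreover have "openin (top_of_set U) Good"
    using open_Good by (auto simp: openin_open Good_def)
  ultimately have "Good = {} \<or> Good = U"
    using assms(1) connected_clopen by metis
  then show ?thesis using assms(3,4) by (auto simp: Good_def)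
qed

end

section \<open>Maps preserving rank one\<close>

text \<open>Vanishing of all two by two minors. The zero vector is parallel to everything, so
  transitivity fails and nonzero middle vectors must be ensured.\<close>

definition parallel :: "complex^'n \<Rightarrow> complex^'n \<Rightarrow> bool" where
  "parallel x y \<longleftrightarrow> (\<forall>i j. x $ i * y $ j = x $ j * y $ i)"

lemma parallel_sym: "parallel x y \<Longrightarrow> parallel y x"
  by (simp add: parallel_def mult.commute)

lemma parallel_zero [simp]: "parallel 0 y" "parallel x 0"
  by (simp_all add: parallel_def)

lemma parallel_scale: "parallel x (c *s x)" "parallel (c *s x) x"
  by (simp_all add: parallel_def)

lemma parallel_scaleD: "parallel x (c *s y) \<Longrightarrow> c \<noteq> 0 \<Longrightarrow> parallel x y"
  by (simp add: parallel_def mult.left_commute)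

lemma parallel_imp_scale:
  assumes "parallel x y" "x \<noteq> 0"
  obtains c where "y = c *s x"
proof -
  obtain p where p: "x $ p \<noteq> 0" using assms(2) by (auto simp: vec_eq_iff)
  have "y = (y $ p / x $ p) *s x"
    using assms(1) p by (simp add: vec_eq_iff parallel_def field_simps)
  then show thesis by (rule that)
qed

lemma parallel_diff: "parallel x y \<Longrightarrow> parallel x z \<Longrightarrow> parallel x (y - z)"
  by (simp add: parallel_def right_diff_distrib)

lemma not_parallel_exists:
  fixes x :: "complex^'n"
  assumes "x \<noteq> 0" "CARD('n) \<ge> 2"
  obtains y where "\<not> parallel x y"
proof -
  obtain p where p: "x $ p \<noteq> 0" using assms(1) by (auto simp: vec_eq_iff)
  have "\<exists>q. q \<noteq> p"
  proof (rule ccontr)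
    assume "\<not> ?thesis"
    then have "(UNIV :: 'n set) = {p}" by auto
    then show False using assms(2) by (metis card.empty card.insert empty_iff finite.emptyI not_less_eq_eq numeral_2_eq_2 One_nat_def order_refl)
  qed
  then obtain q where "q \<noteq> p" by blast
  have "\<not> parallel x (axis q 1)"
  proof
    assume "parallel x (axis q 1)"
    then have "x $ p * (axis q 1 :: complex^'n) $ q = x $ q * (axis q 1 :: complex^'n) $ p"
      unfolding parallel_def by blast
    then show False using p \<open>q \<noteq> p\<close> by (simp add: axis_def)
  qed
  then show thesis by (rule that)
qed

lemma bdot_add_left: "bdot (x + y) z = bdot x z + bdot y z"
  by (simp add: bdot_def distrib_right sum.distrib)

lemma bdot_diff_left: "bdot (x - y) z = bdot x z - bdot y z"
  by (simp add: bdot_def left_diff_distrib sum_subtractf)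

lemma bdot_add_right: "bdot z (x + y) = bdot z x + bdot z y"
  by (simp add: bdot_def distrib_left sum.distrib)

lemma bdot_commute: "bdot x y = bdot y x"
  by (simp add: bdot_def mult.commute)

lemma bdot_scale_left [simp]: "bdot (c *s x) y = c * bdot x y"
  by (simp add: bdot_def sum_distrib_left mult.assoc)

lemma bdot_scale_right [simp]: "bdot x (c *s y) = c * bdot x y"
  by (simp add: bdot_def sum_distrib_left mult_ac)

text \<open>The functionals \<open>axis j (v $ i) - axis i (v $ j)\<close> kill \<open>v\<close>;
  their values at \<open>r\<close> are the minors of \<open>v\<close> and \<open>r\<close>.\<close>

lemma annihilator_parallel:
  assumes "\<And>g. g \<noteq> 0 \<Longrightarrow> bdot g v = 0 \<Longrightarrow> bdot g r = 0"
  shows "parallel v r"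
proof -
  have *: "bdot g v = 0 \<Longrightarrow> bdot g r = 0" for g
    using assms[of g] by (cases "g = 0") (auto simp: bdot_def)
  have "v $ i * r $ j = v $ j * r $ i" for i j
  proof -
    have "bdot (axis j (v $ i) - axis i (v $ j)) v = 0"
      by (simp add: bdot_diff_left bdot_axis)
    then have "bdot (axis j (v $ i) - axis i (v $ j)) r = 0" by (rule *)
    then show ?thesis by (simp add: bdot_diff_left bdot_axis)
  qed
  then show ?thesis by (simp add: parallel_def)
qed

lemma outer_scale: "outer (c *s x) y = outer x (c *s y)"
  by (simp add: vec_eq_iff)

lemma outer_add_left: "outer (x + y) z = outer x z + outer y z"
  by (simp add: vec_eq_iff distrib_right)

lemma outer_add_right: "outer z (x + y) = outer z x + outer z y"
  by (simp add: vec_eq_iff distrib_left)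

lemma outer_zero [simp]: "outer 0 y = 0" "outer x 0 = 0"
  by (simp_all add: vec_eq_iff)

lemma outer_eq_0_iff [simp]: "outer x y = 0 \<longleftrightarrow> x = 0 \<or> y = 0"
  by (auto simp: vec_eq_iff)

lemma outer_scaleR: "outer (r *\<^sub>R x) y = r *\<^sub>R outer x y" "outer x (r *\<^sub>R y) = r *\<^sub>R outer x y"
  by (simp_all add: vec_eq_iff)

lemma outer_eq_parallel:
  assumes "outer x y = outer x' y'" "outer x y \<noteq> 0"
  shows "parallel x x'" "parallel y y'"
proof -
  have e: "x $ i * y $ j = x' $ i * y' $ j" for i j
    using assms(1) by (metis outer_component)
  obtain p q where pq: "x $ p * y $ q \<noteq> 0"
    using assms(2) by (auto simp: vec_eq_iff)
  have pq': "x' $ p \<noteq> 0" "y' $ q \<noteq> 0" using pq e[of p q] by auto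
  have "x $ i * x' $ j * (y $ q * y' $ q) = x $ j * x' $ i * (y $ q * y' $ q)" for i j
    using e[of i q] e[of j q] by (metis mult.assoc mult.commute mult.left_commute)
  then show "parallel x x'" using pq pq' by (simp add: parallel_def)
  have "y $ i * y' $ j * (x $ p * x' $ p) = y $ j * y' $ i * (x $ p * x' $ p)" for i j
    using e[of p i] e[of p j] by (metis mult.assoc mult.commute mult.left_commute)
  then show "parallel y y'" using pq pq' by (simp add: parallel_def)
qed

lemma outer_cancel_left: "outer x y = outer x y' \<Longrightarrow> x \<noteq> 0 \<Longrightarrow> y = y'"
  by (auto simp: vec_eq_iff)

lemma outer_cancel_right: "outer x y = outer x' y \<Longrightarrow> y \<noteq> 0 \<Longrightarrow> x = x'"
  by (auto simp: vec_eq_iff)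

section \<open>Additive families of matrices of rank at most one\<close>

definition rank_le_one :: "complex^'n^'m \<Rightarrow> bool" where
  "rank_le_one M \<longleftrightarrow> (\<exists>x y. M = outer x y)"

text \<open>In the form of polynomial equations the condition passes to limits. A nonzero entry
  serves as pivot for the factorisation.\<close>

lemma rank_le_one_iff_minors:
  "rank_le_one M \<longleftrightarrow> (\<forall>i j k l. M $ i $ j * M $ k $ l = M $ i $ l * M $ k $ j)"
proof
  assume "rank_le_one M"
  then show "\<forall>i j k l. M $ i $ j * M $ k $ l = M $ i $ l * M $ k $ j"
    by (auto simp: rank_le_one_def)
next
  assume *: "\<forall>i j k l. M $ i $ j * M $ k $ l = M $ i $ l * M $ k $ j"
  show "rank_le_one M"
  proof (cases "M = 0")
    case True
    then show ?thesis unfolding rank_le_one_def by (metis outer_zero(1))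
  next
    case False
    then obtain p q where pq: "M $ p $ q \<noteq> 0" by (auto simp: vec_eq_iff)
    have "outer (\<chi> i. M $ i $ q) (\<chi> j. M $ p $ j / M $ p $ q) $ i $ j = M $ i $ j" for i j
      using *[rule_format, of i j p q] pq by (simp add: field_simps)
    then have "M = outer (\<chi> i. M $ i $ q) (\<chi> j. M $ p $ j / M $ p $ q)" by (simp add: vec_eq_iff)
    then show ?thesis unfolding rank_le_one_def by blast
  qed
qed

text \<open>A two by two minor of the sum is the product of a minor of \<open>x\<close>,
  \<open>x'\<close> and a minor of \<open>y\<close>, \<open>y'\<close>.\<close>

lemma rank_le_one_add_outer:
  assumes "rank_le_one (outer x y + outer x' y')"
  shows "parallel x x' \<or> parallel y y'"
proof -
  have "(x $ i * x' $ k - x' $ i * x $ k) * (y $ j * y' $ l - y' $ j * y $ l) = 0" for i j k l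
    using assms[unfolded rank_le_one_iff_minors, rule_format, of i j k l] by (simp add: algebra_simps)
  then have "(x $ i * x' $ k = x $ k * x' $ i) \<or> (y $ j * y' $ l = y $ l * y' $ j)" for i j k l
    by (metis eq_iff_diff_eq_0 mult.commute mult_eq_0_iff)
  then show ?thesis unfolding parallel_def by blast
qed

text \<open>Together with \<open>rowmap\<close> this describes the two kinds of additive families of
  rank at most one: a common left factor or a common right factor.\<close>

definition colmap :: "('a \<Rightarrow> complex^'n^'m) \<Rightarrow> bool" where
  "colmap L \<longleftrightarrow> (\<exists>x. \<forall>b. \<exists>y. L b = outer x y)"

definition rowmap :: "('a \<Rightarrow> complex^'n^'m) \<Rightarrow> bool" where
  "rowmap L \<longleftrightarrow> (\<exists>y. \<forall>b. \<exists>x. L b = outer x y)"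

text \<open>Without a common right factor there are two nonzero values with non-parallel right
  factors, which must share the left factor \<open>x0\<close>. A value with another left factor
  would need a right factor parallel to both of theirs, hence is zero.\<close>

lemma colmap_or_rowmap:
  assumes add: "\<And>b c. L (b + c) = L b + L c" and rk: "\<And>b. rank_le_one (L b)"
  shows "colmap L \<or> rowmap L"
proof (rule disjCI)
  assume nr: "\<not> rowmap L"
  have "\<exists>b. L b \<noteq> 0" using nr unfolding rowmap_def by (metis outer_zero(1))
  then obtain b0 x0 y0 where 0: "L b0 = outer x0 y0" "x0 \<noteq> 0" "y0 \<noteq> 0"
    using rk unfolding rank_le_one_def by (metis outer_zero)
  obtain b1 where b1: "\<And>x. L b1 \<noteq> outer x y0" using nr unfolding rowmap_def by metis
  obtain x1 y1 where 1: "L b1 = outer x1 y1" using rk unfolding rank_le_one_def by metis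
  have np: "\<not> parallel y0 y" if "L b1 = outer x y" for x y
  proof
    assume "parallel y0 y"
    then obtain c where "y = c *s y0" using 0(3) by (rule parallel_imp_scale)
    then show False using b1 that by (metis outer_scale)
  qed
  have "parallel x0 x1"
    using rank_le_one_add_outer[of x0 y0 x1 y1] rk[of "b0 + b1"] np[OF 1] by (simp add: add 0(1) 1)
  then obtain c where "x1 = c *s x0" using 0(2) by (rule parallel_imp_scale)
  then have eq1: "L b1 = outer x0 (c *s y1)" using 1 by (simp add: outer_scale)
  have "\<exists>y. L b = outer x0 y" for b
  proof -
    obtain x y where xy: "L b = outer x y" using rk unfolding rank_le_one_def by metis
    show ?thesis
    proof (cases "parallel x0 x")
      case True
      then obtain d where "x = d *s x0" using 0(2) by (rule parallel_imp_scale)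
      then show ?thesis using xy by (metis outer_scale)
    next
      case False
      then have "parallel y0 y"
        using rank_le_one_add_outer[of x0 y0 x y] rk[of "b0 + b"] by (simp add: add 0(1) xy)
      then obtain d where d: "y = d *s y0" using 0(3) by (rule parallel_imp_scale)
      have "parallel y (c *s y1)"
        using rank_le_one_add_outer[of x y x0 "c *s y1"] rk[of "b + b1"] False parallel_sym
        by (auto simp: add eq1 xy)
      then have "d = 0"
        unfolding d using np[OF eq1] parallel_scaleD parallel_sym by metis
      then show ?thesis using xy d by (metis outer_zero(2) vector_smult_lzero)
    qed
  qed
  then show "colmap L" unfolding colmap_def by blast
qed

text \<open>For each \<open>b\<close> one of two parallelism conditions holds, and each is stable
  under sums and differences in \<open>b\<close>. The mixed situation makes both conditions fail
  somewhere, but a group is not the union of two proper subgroups.\<close>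

lemma colmap_rowmap_mix:
  assumes L1: "\<And>b c. L1 (b + c) = L1 b + L1 c" and L2: "\<And>b c. L2 (b + c) = L2 b + L2 c"
    and rk: "\<And>b. rank_le_one (L1 b + L2 b)"
    and c1: "colmap L1" "\<not> rowmap L1" and c2: "rowmap L2" "\<not> colmap L2"
  shows False
proof -
  obtain x A where A: "\<And>b. L1 b = outer x (A b)" using c1(1) unfolding colmap_def by metis
  obtain y A' where A': "\<And>b. L2 b = outer (A' b) y" using c2(1) unfolding rowmap_def by metis
  have y0: "y \<noteq> 0" using c2(2) A' unfolding colmap_def by (metis outer_zero(2))
  have x0: "x \<noteq> 0" using c1(2) A unfolding rowmap_def by (metis outer_zero(1))
  have par: "parallel x (A' b) \<or> parallel (A b) y" for b
    using rank_le_one_add_outer rk[of b] unfolding A A' by metis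
  have "\<exists>b. \<not> parallel (A b) y"
  proof (rule ccontr)
    assume "\<not> ?thesis"
    then have "\<exists>c. A b = c *s y" for b using y0 by (metis parallel_imp_scale parallel_sym)
    then have "\<exists>z. L1 b = outer z y" for b unfolding A by (metis outer_scale)
    then show False using c1(2) unfolding rowmap_def by blast
  qed
  then obtain b1 where b1: "\<not> parallel (A b1) y" by blast
  have "\<exists>b. \<not> parallel x (A' b)"
  proof (rule ccontr)
    assume "\<not> ?thesis"
    then have "\<exists>c. A' b = c *s x" for b using x0 by (metis parallel_imp_scale)
    then have "\<exists>z. L2 b = outer x z" for b unfolding A' by (metis outer_scale)
    then show False using c2(2) unfolding colmap_def by blast
  qed
  then obtain b2 where b2: "\<not> parallel x (A' b2)" by blast
  have p1: "parallel x (A' b1)" and p2: "parallel (A b2) y" using par b1 b2 by blast+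
  have A'_add: "A' (b1 + b2) = A' b1 + A' b2"
    using L2[of b1 b2] y0 unfolding A' by (metis outer_add_left outer_cancel_right)
  have A_add: "A (b1 + b2) = A b1 + A b2"
    using L1[of b1 b2] x0 unfolding A by (metis outer_add_right outer_cancel_left)
  from par[of "b1 + b2"] show False
  proof
    assume "parallel x (A' (b1 + b2))"
    from parallel_diff[OF this p1] show False using b2 by (simp add: A'_add)
  next
    assume "parallel (A (b1 + b2)) y"
    from parallel_diff[OF parallel_sym[OF this] parallel_sym[OF p2]] show False
      using b1 parallel_sym by (auto simp: A_add)
  qed
qed

text \<open>The kind cannot change with \<open>a\<close>: additivity in the first argument would put
  two families of different kinds into one sum of rank at most one.\<close>

lemma all_colmap_or_all_rowmap:
  assumes add1: "\<And>a b c. L a (b + c) = L a b + L a c"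
    and add2: "\<And>a a' b. L (a + a') b = L a b + L a' b"
    and rk: "\<And>a b. rank_le_one (L a b)"
  shows "(\<forall>a. colmap (L a)) \<or> (\<forall>a. rowmap (L a))"
proof (rule ccontr)
  assume "\<not> ?thesis"
  then obtain a a' where a: "\<not> colmap (L a)" "\<not> rowmap (L a')" by blast
  then have "rowmap (L a)" "colmap (L a')" using colmap_or_rowmap[of "L _", OF add1 rk] by blast+
  moreover have "rank_le_one (L a' b + L a b)" for b unfolding add2[symmetric] by (rule rk)
  ultimately show False using colmap_rowmap_mix[of "L a'" "L a", OF add1 add1] a by blast
qed

section \<open>Real linear bijections preserving rank one and the modulus of the trace\<close>

definition vcnj :: "complex^'n \<Rightarrow> complex^'n" where
  "vcnj x = (\<chi> i. cnj (x $ i))"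

lemma vcnj_component [simp]: "vcnj x $ i = cnj (x $ i)"
  by (simp add: vcnj_def)

lemma vcnj_vcnj [simp]: "vcnj (vcnj x) = x"
  by (simp add: vec_eq_iff)

lemma complex_linear_matrix:
  fixes B :: "complex^'n \<Rightarrow> complex^'m"
  assumes "linear B" and i: "\<And>x. B (\<i> *s x) = \<i> *s B x"
  shows "\<exists>M. \<forall>x. B x = M *v x"
proof -
  interpret linear B by fact
  have sc: "B (c *s x) = c *s B x" for c x
  proof -
    have split: "c *s y = Re c *\<^sub>R y + Im c *\<^sub>R (\<i> *s y)" for y :: "complex^'k"
      by (simp add: vec_eq_iff complex_eq_iff)
    show ?thesis unfolding split by (simp add: add scaleR i)
  qed
  have "B x = (\<chi> k j. B (axis j 1) $ k) *v x" for x
  proof -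
    have "B x = B (\<Sum>j\<in>UNIV. x $ j *s axis j 1)" by (simp add: basis_expansion)
    also have "\<dots> = (\<Sum>j\<in>UNIV. x $ j *s B (axis j 1))" by (simp add: sum sc)
    finally show ?thesis by (simp add: vec_eq_iff matrix_vector_mult_def mult.commute)
  qed
  then show ?thesis by blast
qed

lemma trace_outer: "trace (outer x y) = bdot x y"
  by (simp add: trace_def bdot_def)

text \<open>The coefficient sits inside the left factor, so the expansion can be used under maps
  that are only real linear.\<close>

lemma outer_sum_matrix:
  fixes M :: "complex^'n^'n"
  shows "M = (\<Sum>i\<in>UNIV. \<Sum>j\<in>UNIV. outer (axis i (M $ i $ j)) (axis j 1))"
proof -
  have "outer (axis i c) (axis j 1) = munit i j c" for i j :: 'n and c
    by (auto simp: vec_eq_iff axis_def)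
  then show ?thesis by (simp add: matrix_munit_sum[symmetric])
qed

lemma linear_eq_on_outer:
  fixes f :: "complex^'n^'n \<Rightarrow> 'b::real_vector"
  assumes "linear f" "linear g" "\<And>a b. f (outer a b) = g (outer a b)"
  shows "f M = g M"
  by (subst (1 2) outer_sum_matrix) (simp add: linear_sum[OF assms(1)] linear_sum[OF assms(2)] assms(3))

text \<open>The assumption \<open>col\<close> selects one of the two kinds; the other is brought to
  it by transposition. From \<open>n2\<close> come the non-parallel vectors on which the scalar
  comparisons rest.\<close>

locale rank_one_preserver =
  fixes S :: "complex^'n^'n \<Rightarrow> complex^'n^'n"
  assumes lin: "linear S" and inj: "\<And>M. S M = 0 \<Longrightarrow> M = 0" and surj: "surj S"
    and rk: "\<And>a b. rank_le_one (S (outer a b))"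
    and tr: "\<And>a b. cmod (trace (S (outer a b))) = cmod (bdot a b)"
    and n2: "CARD('n) \<ge> 2"
    and col: "\<And>a. colmap (\<lambda>b. S (outer a b))"
begin

lemma S_add: "S (M + N) = S M + S N" and S_scaleR: "S (r *\<^sub>R M) = r *\<^sub>R S M"
  using lin by (auto simp: linear_add linear_cmul)

lemma S_nonzero: "a \<noteq> 0 \<Longrightarrow> b \<noteq> 0 \<Longrightarrow> S (outer a b) \<noteq> 0"
  using inj by fastforce

text \<open>If a common left factor also arose for varying \<open>a\<close>, the left factor would
  be the same for all outer products, hence for the whole image, contradicting surjectivity in
  dimension at least two.\<close>

lemma all_rowmap: "rowmap (\<lambda>a. S (outer a b))"
proof (rule ccontr)
  assume "\<not> ?thesis"
  moreover have "(\<forall>b. colmap (\<lambda>a. S (outer a b))) \<or> (\<forall>b. rowmap (\<lambda>a. S (outer a b)))"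
    by (rule all_colmap_or_all_rowmap[of "\<lambda>b a. S (outer a b)"])
       (simp_all add: S_add outer_add_left outer_add_right rk)
  ultimately have c: "colmap (\<lambda>a. S (outer a b))" for b by blast
  define a0 :: "complex^'n" where "a0 = axis undefined 1"
  have a0: "a0 \<noteq> 0" unfolding a0_def by (simp add: axis_eq_0_iff)
  obtain x where x: "\<And>b. \<exists>y. S (outer a0 b) = outer x y" using col unfolding colmap_def by meson
  have x0: "x \<noteq> 0" using x[of a0] S_nonzero[OF a0 a0] by auto
  have "\<exists>y. S (outer a b) = outer x y" for a b
  proof (cases "b = 0")
    case True
    then show ?thesis by (intro exI[of _ 0]) (simp add: linear_0[OF lin])
  next
    case False
    obtain x' where x': "\<And>a. \<exists>y. S (outer a b) = outer x' y" using c unfolding colmap_def by meson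
    obtain y y' where "S (outer a0 b) = outer x y" "S (outer a0 b) = outer x' y'" using x x' by meson
    then have "parallel x x'" using outer_eq_parallel(1)[of x y x' y'] S_nonzero[OF a0 False] by simp
    then obtain k where "x' = k *s x" using x0 by (rule parallel_imp_scale)
    then show ?thesis using x'[of a] by (auto simp: outer_scale)
  qed
  then obtain Y where Y: "\<And>a b. S (outer a b) = outer x (Y a b)" by metis
  have all: "\<exists>y. S M = outer x y" for M
  proof -
    have "S M = (\<Sum>i\<in>UNIV. \<Sum>j\<in>UNIV. outer x (Y (axis i (M $ i $ j)) (axis j 1)))"
      by (subst outer_sum_matrix) (simp add: linear_sum[OF lin] Y)
    also have "\<dots> = outer x (\<Sum>i\<in>UNIV. \<Sum>j\<in>UNIV. Y (axis i (M $ i $ j)) (axis j 1))"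
      by (simp add: vec_eq_iff sum_distrib_left)
    finally show ?thesis by blast
  qed
  obtain u where u: "\<not> parallel x u" using not_parallel_exists[OF x0 n2] .
  then have u0: "u \<noteq> 0" by auto
  obtain M where M: "S M = outer u u" using surj by (metis surjD)
  obtain y where "outer u u = outer x y" using all[of M] M by auto
  then have "parallel u x" using outer_eq_parallel(1) u0 by (metis outer_eq_0_iff)
  then show False using u parallel_sym by blast
qed

text \<open>\<open>B\<close> and \<open>C\<close> are read off on the two slices through
  \<open>a0\<close>. Elsewhere the factors agree up to a scalar, and comparing \<open>a\<close>,
  \<open>a0\<close> and \<open>a + a0\<close> shows that the scalar is 1, provided that
  \<open>B a\<close> and \<open>B a0\<close> are not parallel.\<close>

lemma tensor_form:
  obtains B C where "linear B" "linear C" "\<And>a b. S (outer a b) = outer (B a) (C b)"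
    "\<And>a. B a = 0 \<Longrightarrow> a = 0" "\<And>b. C b = 0 \<Longrightarrow> b = 0"
proof -
  define a0 :: "complex^'n" where "a0 = axis undefined 1"
  have a0: "a0 \<noteq> 0" unfolding a0_def by (simp add: axis_eq_0_iff)
  obtain z X where X: "\<And>a. S (outer a a0) = outer (X a) z" using all_rowmap[of a0] unfolding rowmap_def by metis
  have z0: "z \<noteq> 0" using X[of a0] S_nonzero[OF a0 a0] by auto
  then obtain q where q: "z $ q \<noteq> 0" by (auto simp: vec_eq_iff)
  \<comment> \<open>Normalised to have entry 1 at \<open>q\<close>, so that column \<open>q\<close>
    of \<open>S (outer a a0)\<close> is \<open>B a\<close>.\<close>
  define y0 where "y0 = (1 / z $ q) *s z"
  define B where "B a = (\<chi> i. S (outer a a0) $ i $ q)" for a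
  have BX: "B a = z $ q *s X a" for a by (simp add: B_def X vec_eq_iff mult.commute)
  have SB: "S (outer a a0) = outer (B a) y0" for a
    unfolding BX X y0_def using q by (simp add: vec_eq_iff)
  have linB: "linear B"
    unfolding B_def by (rule linearI) (simp_all add: vec_eq_iff outer_add_left outer_scaleR S_add S_scaleR)
  have B0: "a = 0" if "B a = 0" for a
    using S_nonzero[of a a0] a0 SB[of a] that by auto
  have Ba0: "B a0 \<noteq> 0" using B0 a0 by blast
  then obtain p where p: "B a0 $ p \<noteq> 0" by (auto simp: vec_eq_iff)
  have y0: "y0 \<noteq> 0" using SB[of a0] S_nonzero[OF a0 a0] by auto
  have left: "\<exists>y. S (outer a b) = outer (B a) y" if "a \<noteq> 0" for a b
  proof -
    obtain x where x: "\<And>b. \<exists>y. S (outer a b) = outer x y" using col[of a] unfolding colmap_def by meson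
    have "B a \<noteq> 0" using B0 that by blast
    obtain y where "S (outer a a0) = outer x y" using x by meson
    then have "parallel (B a) x" using SB[of a] S_nonzero[OF that a0] outer_eq_parallel(1) by metis
    then obtain k where "x = k *s B a" using \<open>B a \<noteq> 0\<close> by (rule parallel_imp_scale)
    then show ?thesis using x[of b] by (auto simp: outer_scale)
  qed
  define C where "C b = (\<chi> j. S (outer a0 b) $ p $ j / B a0 $ p)" for b
  have SC: "S (outer a0 b) = outer (B a0) (C b)" for b
  proof -
    obtain y where y: "S (outer a0 b) = outer (B a0) y" using left[OF a0] by meson
    then have "C b = y" using p by (simp add: C_def vec_eq_iff)
    then show ?thesis using y by simp
  qed
  have linC: "linear C"
    unfolding C_def by (rule linearI) (simp_all add: vec_eq_iff outer_add_right outer_scaleR S_add S_scaleR divide_inverse distrib_right)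
  have C0: "b = 0" if "C b = 0" for b
    using S_nonzero[of a0 b] a0 SC[of b] that by auto
  have right: "\<exists>x. S (outer a b) = outer x (C b)" if "b \<noteq> 0" for a b
  proof -
    obtain y where y: "\<And>a. \<exists>x. S (outer a b) = outer x y" using all_rowmap[of b] unfolding rowmap_def by meson
    have "C b \<noteq> 0" using C0 that by blast
    obtain x where "S (outer a0 b) = outer x y" using y by meson
    then have "parallel (C b) y" using SC[of b] S_nonzero[OF a0 that] outer_eq_parallel(2) by metis
    then obtain k where "y = k *s C b" using \<open>C b \<noteq> 0\<close> by (rule parallel_imp_scale)
    then show ?thesis using y[of a] by (auto simp: outer_scale[symmetric])
  qed
  have \<kappa>: "\<exists>k. S (outer a b) = outer (k *s B a) (C b)" if nz: "a \<noteq> 0" "b \<noteq> 0" for a b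
  proof -
    obtain x y where xy: "S (outer a b) = outer (B a) y" "S (outer a b) = outer x (C b)"
      using left[OF nz(1)] right[OF nz(2)] by meson
    then have "parallel (B a) x" using S_nonzero[OF nz] outer_eq_parallel(1) by metis
    then obtain k where "x = k *s B a" using B0 nz(1) by (metis parallel_imp_scale)
    then show ?thesis using xy by blast
  qed
  \<comment> \<open>An injective real linear map may still send non-parallel vectors to parallel
    ones; the trace condition prevents it. If \<open>b\<close> annihilates \<open>a\<close>, then
    \<open>C b\<close> annihilates \<open>B a\<close>, hence \<open>B a'\<close>, and so
    \<open>b\<close> annihilates \<open>a'\<close>.\<close>
  have par: "parallel a a'" if nz: "parallel (B a) (B a')" "a \<noteq> 0" "a' \<noteq> 0" for a a'
  proof (rule annihilator_parallel)
    fix b :: "complex^'n" assume b: "b \<noteq> 0" "bdot b a = 0"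
    have B: "B a \<noteq> 0" "B a' \<noteq> 0" using B0 nz by blast+
    obtain k where k: "S (outer a b) = outer (k *s B a) (C b)" using \<kappa> nz b by blast
    have "k \<noteq> 0" using S_nonzero[OF nz(2) b(1)] k by auto
    moreover have "cmod (k * bdot (B a) (C b)) = cmod (bdot a b)"
      using tr[of a b] unfolding k trace_outer by simp
    ultimately have 0: "bdot (B a) (C b) = 0" using b(2) by (simp add: bdot_commute)
    obtain k' where k': "S (outer a' b) = outer (k' *s B a') (C b)" using \<kappa> nz b by blast
    obtain c where c: "B a' = c *s B a" using parallel_imp_scale[OF nz(1) B(1)] .
    have "cmod (bdot a' b) = cmod (k' * (c * bdot (B a) (C b)))"
      using tr[of a' b] unfolding k' trace_outer c by (simp add: mult.assoc)
    then show "bdot b a' = 0" using 0 by (simp add: bdot_commute)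
  qed
  have B_add: "B (a + a') = B a + B a'" for a a' by (rule linear_add[OF linB])
  have generic: "S (outer a b) = outer (B a) (C b)" if np: "\<not> parallel a a0" for a b
  proof (cases "b = 0")
    case True
    then show ?thesis using linear_0[OF lin] linear_0[OF linC] by simp
  next
    case False
    have a: "a \<noteq> 0" using np by auto
    have aa: "a + a0 \<noteq> 0"
    proof
      assume "a + a0 = 0"
      then have "a = (-1) *s a0" by (simp add: eq_neg_iff_add_eq_0)
      then show False using np parallel_scale(2) by metis
    qed
    obtain k where k: "S (outer a b) = outer (k *s B a) (C b)" using \<kappa> a False by blast
    obtain k' where k': "S (outer (a + a0) b) = outer (k' *s B (a + a0)) (C b)" using \<kappa> aa False by blast
    have "outer (k' *s B (a + a0)) (C b) = outer (k *s B a + B a0) (C b)"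
      unfolding k'[symmetric] by (simp add: outer_add_left S_add k SC)
    moreover have "C b \<noteq> 0" using C0 False by blast
    ultimately have "k' *s (B a + B a0) = k *s B a + B a0"
      unfolding B_add by (rule outer_cancel_right)
    then have e: "(k' - k) *s B a = (1 - k') *s B a0"
      by (simp add: vec_eq_iff algebra_simps)
    have npB: "\<not> parallel (B a) (B a0)" using par a a0 np by blast
    have "k' = 1"
    proof (rule ccontr)
      assume "k' \<noteq> 1"
      have "parallel (B a) ((1 - k') *s B a0)" unfolding e[symmetric] by (rule parallel_scale)
      from parallel_scaleD[OF this] show False using npB \<open>k' \<noteq> 1\<close> by simp
    qed
    then have "(1 - k) *s B a = 0" using e by simp
    then have "1 - k = 0 \<or> B a = 0" by (simp only: vector_mul_eq_0)
    then have "k = 1" using B0[of a] a by auto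
    then show ?thesis using k by simp
  qed
  have form: "S (outer a b) = outer (B a) (C b)" for a b
  proof (cases "parallel a a0")
    case False
    then show ?thesis by (rule generic)
  next
    case True
    \<comment> \<open>For \<open>a\<close> on the line of \<open>a0\<close>, both \<open>a1\<close>
      and \<open>a + a1\<close> lie off it, and additivity recovers the value at
      \<open>a\<close>.\<close>
    obtain a1 where a1: "\<not> parallel a0 a1" using not_parallel_exists[OF a0 n2] .
    have 1: "\<not> parallel a1 a0" using a1 parallel_sym by blast
    have 2: "\<not> parallel (a + a1) a0"
    proof
      assume "parallel (a + a1) a0"
      from parallel_diff[OF parallel_sym[OF this] parallel_sym[OF True]] show False using a1 by simp
    qed
    have "S (outer a b) + S (outer a1 b) = S (outer (a + a1) b)" by (simp add: outer_add_left S_add)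
    then show ?thesis unfolding generic[OF 1] generic[OF 2] by (simp add: B_add outer_add_left)
  qed
  show thesis using that[OF linB linC form B0 C0] .
qed

text \<open>In \<open>outer a b\<close> the factor \<open>\<i>\<close> can be moved from
  \<open>a\<close> to \<open>b\<close>. Hence \<open>B\<close> and \<open>C\<close> turn
  multiplication by \<open>\<i>\<close> into multiplication by one common scalar \<open>c\<close>,
  and applying this twice gives \<open>c * c = -1\<close>: both maps are complex linear or both
  conjugate linear.\<close>

lemma matrix_form:
  "\<exists>M N. (\<forall>a b. S (outer a b) = outer (M *v a) (N *v b)) \<or>
         (\<forall>a b. S (outer a b) = outer (M *v vcnj a) (N *v vcnj b))"
proof -
  obtain B C where B: "linear B" and C: "linear C" and form: "\<And>a b. S (outer a b) = outer (B a) (C b)"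
    and B0: "\<And>a. B a = 0 \<Longrightarrow> a = 0" and C0: "\<And>b. C b = 0 \<Longrightarrow> b = 0" using tensor_form by blast
  have ii: "\<i> *s (\<i> *s x) = - x" for x :: "complex^'n"
    by (simp add: vector_smult_assoc vec_eq_iff)
  have i0: "\<i> *s x \<noteq> 0" if "x \<noteq> 0" for x :: "complex^'n"
    using that by simp
  have pair: "\<exists>c. B (\<i> *s a) = c *s B a \<and> C (\<i> *s b) = c *s C b" if "a \<noteq> 0" "b \<noteq> 0" for a b
  proof -
    have e: "outer (B (\<i> *s a)) (C b) = outer (B a) (C (\<i> *s b))"
      unfolding form[symmetric] by (simp add: outer_scale)
    have nz: "B a \<noteq> 0" "C b \<noteq> 0" "B (\<i> *s a) \<noteq> 0" "C (\<i> *s b) \<noteq> 0"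
      using B0 C0 that i0 by blast+
    then have "parallel (B a) (B (\<i> *s a))" using outer_eq_parallel(1)[OF e] parallel_sym by simp
    then obtain c where c: "B (\<i> *s a) = c *s B a" using nz(1) by (rule parallel_imp_scale)
    have "outer (B a) (c *s C b) = outer (B a) (C (\<i> *s b))" using e unfolding c by (simp add: outer_scale)
    then show ?thesis using c nz(1) by (metis outer_cancel_left)
  qed
  define a0 :: "complex^'n" where "a0 = axis undefined 1"
  have a0: "a0 \<noteq> 0" unfolding a0_def by (simp add: axis_eq_0_iff)
  obtain c where c: "B (\<i> *s a0) = c *s B a0" "C (\<i> *s a0) = c *s C a0" using pair[OF a0 a0] by blast
  have cancel: "k = k'" if "k *s x = k' *s x" "x \<noteq> 0" for k k' and x :: "complex^'n"
    using that by simp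
  have Bi: "B (\<i> *s a) = c *s B a" for a
  proof (cases "a = 0")
    case False
    obtain k where k: "B (\<i> *s a) = k *s B a" "C (\<i> *s a0) = k *s C a0" using pair[OF False a0] by blast
    then have "k = c" using c(2) C0 a0 cancel by metis
    then show ?thesis using k by simp
  qed (simp add: linear_0[OF B])
  have Ci: "C (\<i> *s b) = c *s C b" for b
  proof (cases "b = 0")
    case False
    obtain k where k: "B (\<i> *s a0) = k *s B a0" "C (\<i> *s b) = k *s C b" using pair[OF a0 False] by blast
    then have "k = c" using c(1) B0 a0 cancel by metis
    then show ?thesis using k by simp
  qed (simp add: linear_0[OF C])
  have "- B a0 = (c * c) *s B a0"
    using Bi[of "\<i> *s a0"] unfolding ii Bi by (simp add: linear_neg[OF B] vector_smult_assoc)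
  then have "(-1) *s B a0 = (c * c) *s B a0" by (simp add: vec_eq_iff)
  then have "c * c = -1" using cancel B0 a0 by metis
  then have "(c - \<i>) * (c + \<i>) = 0" by (simp add: algebra_simps)
  then consider "c = \<i>" | "c = - \<i>" by (auto simp: eq_neg_iff_add_eq_0)
  then show ?thesis
  proof cases
    case 1
    obtain M where "\<And>x. B x = M *v x" using complex_linear_matrix[OF B] Bi unfolding 1 by blast
    moreover obtain N where "\<And>x. C x = N *v x" using complex_linear_matrix[OF C] Ci unfolding 1 by blast
    ultimately show ?thesis using form by metis
  next
    case 2
    have lv: "linear (\<lambda>x. L (vcnj x))" if "linear L" for L :: "complex^'n \<Rightarrow> complex^'n"
    proof (rule linearI)
      show "L (vcnj (x + y)) = L (vcnj x) + L (vcnj y)" for x y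
        unfolding linear_add[OF that, symmetric] by (rule arg_cong[of _ _ L]) (simp add: vec_eq_iff)
      show "L (vcnj (r *\<^sub>R x)) = r *\<^sub>R L (vcnj x)" for r x
        unfolding linear_cmul[OF that, symmetric] by (rule arg_cong[of _ _ L]) (simp add: vec_eq_iff)
    qed
    have iv: "L (vcnj (\<i> *s x)) = \<i> *s L (vcnj x)"
      if "linear L" "\<And>x. L (\<i> *s x) = - \<i> *s L x" for L :: "complex^'n \<Rightarrow> complex^'n" and x
    proof -
      have "vcnj (\<i> *s x) = - (\<i> *s vcnj x)" by (simp add: vec_eq_iff)
      then have "L (vcnj (\<i> *s x)) = - L (\<i> *s vcnj x)" by (simp only: linear_neg[OF that(1)])
      then show ?thesis by (simp add: that(2) vec_eq_iff)
    qed
    obtain M where M: "\<And>x. B (vcnj x) = M *v x"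
      using complex_linear_matrix[OF lv[OF B] iv[OF B Bi[unfolded 2]]] by blast
    obtain N where N: "\<And>x. C (vcnj x) = N *v x"
      using complex_linear_matrix[OF lv[OF C] iv[OF C Ci[unfolded 2]]] by blast
    have "S (outer a b) = outer (M *v vcnj a) (N *v vcnj b)" for a b
      unfolding form M[symmetric] N[symmetric] by simp
    then show ?thesis by blast
  qed
qed

end

lemma outer_conj:
  fixes M N :: "complex^'n^'n"
  shows "outer (M *v a) (N *v b) = M ** outer a b ** transpose N"
proof -
  have "M ** outer a b = outer (M *v a) b"
    by (simp add: vec_eq_iff matrix_matrix_mult_def matrix_vector_mult_def sum_distrib_right mult.assoc)
  moreover have "outer x b ** transpose N = outer x (N *v b)" for x :: "complex^'n"
    by (simp add: vec_eq_iff matrix_matrix_mult_def matrix_vector_mult_def transpose_def sum_distrib_left mult_ac)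
  ultimately show ?thesis by simp
qed

lemma bdot_mult_vec: "bdot (A *v x) y = bdot x (transpose A *v y)"
  unfolding bdot_def matrix_vector_mult_def transpose_def
  by (simp add: sum_distrib_left sum_distrib_right mult_ac) (rule sum.swap)

text \<open>Pairs of unit vectors show that \<open>N\<close> is diagonal with unimodular entries;
  the annihilating pair \<open>axis i 1 - axis k 1\<close> and \<open>axis i 1 + axis k 1\<close>
  shows that the entries coincide.\<close>

lemma unimodular_scalar_matrix:
  fixes N :: "complex^'n^'n"
  assumes "\<And>a b. cmod (bdot b (N *v a)) = cmod (bdot b a)"
  obtains \<gamma> where "cmod \<gamma> = 1" "N = mat \<gamma>"
proof -
  have col: "(N *v axis i 1) $ k = N $ k $ i" for i k
    by (simp add: matrix_vector_mult_def axis_def if_distrib cong: if_cong)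
  have entry: "cmod (N $ k $ i) = cmod ((axis i 1 :: complex^'n) $ k)" for i k
    using assms[of "axis k 1" "axis i 1"] by (simp add: bdot_axis col)
  have offd: "N $ k $ i = 0" if "k \<noteq> i" for i k
    using entry[of k i] that by (simp add: axis_def)
  have one: "cmod (N $ i $ i) = 1" for i using entry[of i i] by (simp add: axis_def)
  have eq: "N $ i $ i = N $ k $ k" for i k
  proof (cases "i = k")
    case False
    have "bdot (axis i 1 - axis k 1) (axis i 1 + axis k 1) = 0"
      using False by (simp add: bdot_diff_left bdot_axis) (simp add: axis_def)
    then have "bdot (axis i 1 - axis k 1) (N *v (axis i 1 + axis k 1)) = 0"
      using assms[of "axis i 1 - axis k 1" "axis i 1 + axis k 1"] by simp
    then show ?thesis using False
      by (simp add: bdot_diff_left bdot_axis matrix_vector_right_distrib col offd)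
  qed simp
  define \<gamma> where "\<gamma> = N $ undefined $ undefined"
  have "N = mat \<gamma>" unfolding vec_eq_iff mat_def \<gamma>_def using offd eq by auto
  moreover have "cmod \<gamma> = 1" unfolding \<gamma>_def by (rule one)
  ultimately show thesis using that by blast
qed

lemma linear_mcnj: "linear mcnj"
  by (rule linearI) (simp_all add: mcnj_def vec_eq_iff)

text \<open>The trace condition says that \<open>transpose N ** P\<close> preserves the modulus of
  \<open>bdot\<close>, so it is a unimodular scalar matrix and \<open>transpose N\<close> is that
  multiple of the inverse of \<open>P\<close>. In the conjugate linear case it is applied to
  conjugated vectors.\<close>

lemma (in rank_one_preserver) similarity_form:
  "\<exists>\<gamma> P Q. cmod \<gamma> = 1 \<and> P ** Q = mat 1 \<and> Q ** P = mat 1 \<and>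
     ((\<forall>M. S M = mscale \<gamma> (P ** M ** Q)) \<or> (\<forall>M. S M = mscale \<gamma> (P ** mcnj M ** Q)))"
proof -
  have lin1: "linear (\<lambda>M. P ** M ** Q)" for P Q :: "complex^'n^'n"
    by (rule bounded_linear.linear[OF bounded_linear_matrix_conj])
  have lin2: "linear (\<lambda>M. P ** mcnj M ** Q)" for P Q :: "complex^'n^'n"
    using linear_compose[OF linear_mcnj lin1] by (simp add: o_def)
  have mo: "outer (vcnj a) (vcnj b) = mcnj (outer a b)" for a b :: "complex^'n"
    by (simp add: vec_eq_iff mcnj_def)
  have scalar: "\<exists>\<gamma> Q. cmod \<gamma> = 1 \<and> P ** Q = mat 1 \<and> Q ** P = mat 1 \<and> transpose N = mscale \<gamma> Q"
    if t: "\<And>a b. cmod (bdot (P *v a) (N *v b)) = cmod (bdot a b)" for P N :: "complex^'n^'n"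
  proof -
    have "cmod (bdot b ((transpose N ** P) *v a)) = cmod (bdot b a)" for a b
      using t[of a b] bdot_mult_vec[of N b "P *v a"] by (simp add: bdot_commute matrix_vector_mul_assoc)
    then obtain \<gamma> where \<gamma>: "cmod \<gamma> = 1" "transpose N ** P = mat \<gamma>" using unimodular_scalar_matrix by blast
    then have "\<gamma> \<noteq> 0" by auto
    define Q where "Q = mscale (inverse \<gamma>) (transpose N)"
    have "Q ** P = mat 1" unfolding Q_def mscale_mult_left \<gamma>(2) using \<open>\<gamma> \<noteq> 0\<close>
      by (simp add: vec_eq_iff mat_def)
    moreover then have "P ** Q = mat 1" using matrix_left_right_inverse by blast
    moreover have "transpose N = mscale \<gamma> Q" unfolding Q_def mscale_mscale using \<open>\<gamma> \<noteq> 0\<close> by (simp add: vec_eq_iff)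
    ultimately show ?thesis using \<gamma>(1) by blast
  qed
  obtain P N where "(\<forall>a b. S (outer a b) = outer (P *v a) (N *v b)) \<or>
         (\<forall>a b. S (outer a b) = outer (P *v vcnj a) (N *v vcnj b))" using matrix_form by blast
  then show ?thesis
  proof
    assume f: "\<forall>a b. S (outer a b) = outer (P *v a) (N *v b)"
    have "cmod (bdot (P *v a) (N *v b)) = cmod (bdot a b)" for a b
      using tr[of a b] f by (simp add: trace_outer)
    then obtain \<gamma> Q where Q: "cmod \<gamma> = 1" "P ** Q = mat 1" "Q ** P = mat 1" "transpose N = mscale \<gamma> Q"
      using scalar by blast
    have "S M = P ** M ** transpose N" for M
      by (rule linear_eq_on_outer[OF lin lin1]) (simp add: f outer_conj)
    then have "\<forall>M. S M = mscale \<gamma> (P ** M ** Q)" by (simp add: Q(4) mscale_mult_right)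
    then show ?thesis using Q by blast
  next
    assume f: "\<forall>a b. S (outer a b) = outer (P *v vcnj a) (N *v vcnj b)"
    have "cmod (bdot (P *v a) (N *v b)) = cmod (bdot a b)" for a b
    proof -
      have "bdot (vcnj a) (vcnj b) = cnj (bdot a b)" by (simp add: bdot_def)
      then show ?thesis using tr[of "vcnj a" "vcnj b"] f by (simp add: trace_outer)
    qed
    then obtain \<gamma> Q where Q: "cmod \<gamma> = 1" "P ** Q = mat 1" "Q ** P = mat 1" "transpose N = mscale \<gamma> Q"
      using scalar by blast
    have "S M = P ** mcnj M ** transpose N" for M
      by (rule linear_eq_on_outer[OF lin lin2]) (simp add: f outer_conj mo)
    then have "\<forall>M. S M = mscale \<gamma> (P ** mcnj M ** Q)" by (simp add: Q(4) mscale_mult_right)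
    then show ?thesis using Q by blast
  qed
qed

section \<open>Linear preservers of the spectral radius\<close>

definition madj :: "complex^'n^'n \<Rightarrow> complex^'n^'n" where
  "madj A = transpose (mcnj A)"

lemma mcnj_component [simp]: "mcnj A $ i $ j = cnj (A $ i $ j)"
  by (simp add: mcnj_def)

lemma madj_component [simp]: "madj A $ i $ j = cnj (A $ j $ i)"
  by (simp add: madj_def transpose_def)

lemma mcnj_mcnj [simp]: "mcnj (mcnj A) = A"
  by (simp add: vec_eq_iff)

lemma mcnj_mult: "mcnj (A ** B) = mcnj A ** mcnj B"
  by (simp add: vec_eq_iff matrix_matrix_mult_def)

lemma mcnj_mscale: "mcnj (mscale c A) = mscale (cnj c) (mcnj A)"
  by (simp add: vec_eq_iff)

lemma mcnj_mat: "mcnj (mat c) = mat (cnj c)"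
  by (simp add: vec_eq_iff mat_def)

lemma madj_mult: "madj (A ** B) = madj B ** madj A"
  by (simp add: madj_def mcnj_mult matrix_transpose_mul)

lemma madj_mscale: "madj (mscale c A) = mscale (cnj c) (madj A)"
  by (simp add: vec_eq_iff)

lemma madj_mat: "madj (mat c) = mat (cnj c)"
  by (simp add: vec_eq_iff mat_def)

lemma transpose_mscale: "transpose (mscale c A) = mscale c (transpose A)"
  by (simp add: vec_eq_iff transpose_def)

lemma trace_mscale: "trace (mscale c A) = c * trace A"
  by (simp add: trace_def sum_distrib_left)

lemma trace_mult: "trace (A ** B) = (\<Sum>i\<in>UNIV. \<Sum>j\<in>UNIV. A $ i $ j * B $ j $ i)"
  by (simp add: trace_def matrix_matrix_mult_def)

lemma inner_matrix: "inner A B = Re (trace (madj A ** B))" for A B :: "complex^'n^'n"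
proof -
  have "inner A B = (\<Sum>i\<in>UNIV. \<Sum>j\<in>UNIV. Re (cnj (A $ i $ j) * B $ i $ j))"
    by (simp add: inner_vec_def inner_complex_def)
  also have "\<dots> = (\<Sum>j\<in>UNIV. \<Sum>i\<in>UNIV. Re (cnj (A $ i $ j) * B $ i $ j))" by (rule sum.swap)
  also have "\<dots> = Re (trace (madj A ** B))" by (simp add: trace_mult)
  finally show ?thesis .
qed

lemma inner_transpose: "inner (transpose A) (transpose B) = inner A B" for A B :: "complex^'n^'n"
  unfolding inner_vec_def transpose_def by (simp, rule sum.swap)

lemma inner_mcnj: "inner (mcnj A) (mcnj B) = inner A B" for A B :: "complex^'n^'n"
  by (simp add: inner_vec_def inner_complex_def)

lemma inner_mscale_conj:
  fixes P Q X Y :: "complex^'n^'n"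
  shows "inner (mscale c (P ** X ** Q)) Y = inner X (mscale (cnj c) (madj P ** Y ** madj Q))"
proof -
  have "trace (madj (mscale c (P ** X ** Q)) ** Y) = cnj c * trace (madj Q ** (madj X ** madj P ** Y))"
    by (simp add: madj_mscale madj_mult mscale_mult_left trace_mscale matrix_mul_assoc)
  also have "\<dots> = cnj c * trace ((madj X ** madj P ** Y) ** madj Q)"
    by (subst trace_mul_sym) simp
  also have "\<dots> = trace (madj X ** mscale (cnj c) (madj P ** Y ** madj Q))"
    by (simp add: mscale_mult_right trace_mscale matrix_mul_assoc)
  finally show ?thesis by (simp add: inner_matrix)
qed

lemma inner_outer: "inner (outer x y) M = Re (bdot (vcnj x) (M *v vcnj y))" for M :: "complex^'n^'n"
proof -
  have "inner (outer x y) M = (\<Sum>i\<in>UNIV. \<Sum>j\<in>UNIV. Re (cnj (outer x y $ i $ j) * M $ i $ j))"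
    by (simp add: inner_vec_def inner_complex_def del: outer_component)
  also have "\<dots> = Re (\<Sum>i\<in>UNIV. \<Sum>j\<in>UNIV. cnj (x $ i * y $ j) * M $ i $ j)"
    by (simp only: Re_sum outer_component)
  also have "(\<Sum>i\<in>UNIV. \<Sum>j\<in>UNIV. cnj (x $ i * y $ j) * M $ i $ j) = bdot (vcnj x) (M *v vcnj y)"
    by (simp add: bdot_def matrix_vector_mult_def sum_distrib_left mult_ac)
  finally show ?thesis .
qed

lemma mat_mult_vec: "mat c *v v = c *s v" for v :: "complex^'n"
  by (simp add: vec_eq_iff matrix_vector_mult_def mat_def if_distrib if_distribR cong: if_cong)

text \<open>The basis consists of \<open>e\<close> and vectors in the kernel of \<open>f\<close>;
  row \<open>j\<close> of the inverse is then \<open>f\<close> itself.\<close>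

lemma adapted_basis:
  fixes e f :: "complex^'n"
  assumes ef: "bdot f e = 1"
  obtains P Q :: "complex^'n^'n" and j where "P ** Q = mat 1" "Q ** P = mat 1"
    "\<And>M. (Q ** M ** P) $ j $ j = bdot f (M *v e)"
proof -
  have "e \<noteq> 0" using ef by (auto simp: bdot_def)
  then obtain j where j: "e $ j \<noteq> 0" by (auto simp: vec_eq_iff)
  \<comment> \<open>The unit vectors are projected along \<open>e\<close> into the kernel of
    \<open>f\<close>, and the one at \<open>j\<close> is replaced by \<open>e\<close>; since
    \<open>e $ j \<noteq> 0\<close> the columns remain independent.\<close>
  define P where "P = (\<chi> i k. if k = j then e $ i else (if i = k then 1 else 0) - f $ k * e $ i)"
  have Pcol: "column j P = e" by (simp add: P_def column_def vec_eq_iff)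
  have fP: "bdot f (column k P) = (if k = j then 1 else 0)" for k
  proof (cases "k = j")
    case False
    have "column k P = axis k 1 - f $ k *s e" using False by (simp add: P_def column_def axis_def vec_eq_iff)
    moreover have "bdot f (axis k 1) = f $ k" by (simp add: bdot_commute[of f] bdot_axis)
    ultimately show ?thesis using False ef
      by (simp add: bdot_commute[of f] bdot_diff_left)
  qed (simp add: Pcol ef)
  have fPx: "bdot f (P *v x) = x $ j" for x
  proof -
    have "bdot f (P *v x) = (\<Sum>k\<in>UNIV. bdot f (column k P) * x $ k)"
      unfolding bdot_def matrix_vector_mult_def column_def
      by (simp add: sum_distrib_left sum_distrib_right mult.assoc) (rule sum.swap)
    then show ?thesis by (simp add: fP if_distrib if_distribR cong: if_cong)
  qed
  have "x = 0" if x: "P *v x = 0" for x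
  proof -
    have xj: "x $ j = 0" using fPx[of x] x by (simp add: bdot_def)
    have comp: "(P *v x) $ i = x $ i - bdot f x * e $ i" for i
    proof -
      have "(P *v x) $ i = (\<Sum>k\<in>UNIV. (if i = k then x $ k else 0) - f $ k * x $ k * e $ i)"
        unfolding matrix_vector_mult_def P_def using xj by (auto intro!: sum.cong simp: algebra_simps)
      then show ?thesis by (simp add: sum_subtractf bdot_def sum_distrib_right)
    qed
    have "bdot f x * e $ j = 0" using comp[of j] x xj by simp
    then have "bdot f x = 0" using j by simp
    then show ?thesis using comp x by (simp add: vec_eq_iff)
  qed
  then obtain Q where Q: "Q ** P = mat 1" using matrix_left_invertible_ker by blast
  then have PQ: "P ** Q = mat 1" using matrix_left_right_inverse by blast
  have "(Q ** M ** P) $ j $ j = bdot f (M *v e)" for M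
  proof -
    have "(A ** P) $ j $ j = (A *v column j P) $ j" for A :: "complex^'n^'n"
      by (simp add: matrix_matrix_mult_def matrix_vector_mult_def column_def)
    then have "(Q ** M ** P) $ j $ j = (Q *v (M *v e)) $ j"
      by (simp add: Pcol matrix_vector_mul_assoc)
    also have "\<dots> = bdot f (P *v (Q *v (M *v e)))" by (rule fPx[symmetric])
    finally show ?thesis by (simp add: matrix_vector_mul_assoc matrix_mul_assoc PQ)
  qed
  with PQ Q show thesis by (rule that)
qed

section \<open>The adjoint of the inverse of a spectral radius preserver\<close>

locale spec_rad_preserver =
  fixes T Ti :: "complex^'n^'n \<Rightarrow> complex^'n^'n"
  assumes linT: "linear T" and linTi: "linear Ti"
    and TTi: "\<And>x. T (Ti x) = x" and TiT: "\<And>x. Ti (T x) = x"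
    and rho: "\<And>x. spec_rad (T x) = spec_rad x"
begin

text \<open>The first-order test bounds a functional of \<open>Ti h\<close>; as an inner product
  with \<open>outer a b\<close> it becomes the inner product of \<open>S (outer a b)\<close> with
  \<open>h\<close>.\<close>

definition S :: "complex^'n^'n \<Rightarrow> complex^'n^'n" where "S = adjoint Ti"

lemma inner_S: "inner (S M) h = inner M (Ti h)"
  unfolding S_def using adjoint_works[OF linTi, of h M] by (simp add: inner_commute)

lemma linS: "linear S"
  unfolding S_def by (rule adjoint_linear[OF linTi])

text \<open>A multiple \<open>z\<close> of a rank-one projection is chosen so that the derivative in
  its eigenvalue test is the inner product with \<open>outer a b\<close>. If \<open>v\<close> is an
  extremal eigenvector of \<open>T z\<close>, the test fixes the inner product of
  \<open>S (outer a b)\<close> with every \<open>h\<close> having \<open>v\<close> as eigenvector: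
  those killing \<open>v\<close> give rank one, the scalar ones give the trace.\<close>

lemma S_outer_nonisotropic:
  assumes c: "bdot a b \<noteq> 0"
  shows "\<exists>x y. S (outer a b) = outer x y \<and> cmod (bdot x y) = cmod (bdot a b)"
proof -
  define c where "c = bdot a b"
  define e where "e = vcnj b"
  define f where "f = (1 / cnj c) *s vcnj a"
  have c0: "c \<noteq> 0" using assms unfolding c_def .
  have "bdot (vcnj a) (vcnj b) = cnj c" by (simp add: bdot_def c_def)
  then have "bdot f e = 1" unfolding f_def e_def using c0 by simp
  then obtain P Q :: "complex^'n^'n" and j where PQ: "P ** Q = mat 1" "Q ** P = mat 1"
    and jj: "\<And>M. (Q ** M ** P) $ j $ j = bdot f (M *v e)"
    by (rule adapted_basis) blast
  have inner_ab: "inner (outer a b) M = Re (cnj c * (Q ** M ** P) $ j $ j)" for M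
    unfolding jj inner_outer f_def e_def using c0 by simp
  \<comment> \<open>The single nonzero entry \<open>c\<close> dominates, and \<open>cnj c\<close>
    cancels the factor in \<open>f\<close>, so that \<open>inner_ab\<close> has the shape of the
    first-order term.\<close>
  define d where "d = (axis j c :: complex^'n)"
  have dj: "d $ j = c" by (simp add: d_def axis_def)
  have dom: "cmod (d $ i) < cmod (d $ j)" if "i \<noteq> j" for i using that c0 by (simp add: d_def axis_def)
  define z where "z = P ** cdiag d ** Q"
  have "spec_rad (T z) = cmod (d $ j)" unfolding rho z_def by (rule spec_rad_conj_diag[OF PQ dom])
  then obtain \<mu> v where v: "v \<noteq> 0" "T z *v v = \<mu> *s v" "cmod \<mu> = cmod (d $ j)"
    using spec_rad_eigenvector[of "T z"] by metis
  have le: "Re (cnj \<mu> * s) \<le> inner (S (outer a b)) h" if hv: "h *v v = s *s v" for h s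
  proof -
    have lim: "((\<lambda>t. (1 / t) *\<^sub>R (t *\<^sub>R Ti h)) \<longlongrightarrow> Ti h) (at_right 0)"
    proof (rule Lim_transform_eventually[OF tendsto_const])
      have "\<forall>\<^sub>F t::real in at_right 0. t > 0" by (simp add: eventually_at_right_less)
      then show "\<forall>\<^sub>F t in at_right 0. Ti h = (1 / t) *\<^sub>R (t *\<^sub>R Ti h)" by eventually_elim simp
    qed
    have "T z + t *\<^sub>R h = T (z + t *\<^sub>R Ti h)" for t
      by (simp add: linear_add[OF linT] linear_cmul[OF linT] TTi)
    then have "\<forall>\<^sub>F t in at_right 0. spec_rad (T z + t *\<^sub>R h) \<le> spec_rad (P ** cdiag d ** Q + t *\<^sub>R Ti h)"
      by (simp add: rho z_def)
    from peripheral_eigenvector_ineq[OF PQ dom v hv lim this]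
    show ?thesis by (simp add: inner_S inner_ab dj)
  qed
  \<comment> \<open>Also \<open>- h\<close> has \<open>v\<close> as eigenvector, so the one-sided
    estimate holds in both directions.\<close>
  have eq: "inner (S (outer a b)) h = Re (cnj \<mu> * s)" if hv: "h *v v = s *s v" for h s
  proof -
    have "(- h) *v v = - (h *v v)" by (simp add: vec_eq_iff matrix_vector_mult_def sum_negf)
    then have "(- h) *v v = (- s) *s v" unfolding hv by (simp add: vec_eq_iff)
    from le[OF this] le[OF hv] show ?thesis by simp
  qed
  define R where "R = S (outer a b)"
  define r where "r i = (\<chi> j. cnj (R $ i $ j))" for i
  have "parallel v (r i)" for i
  proof (rule annihilator_parallel)
    fix g assume g: "bdot g v = 0"
    \<comment> \<open>Makes the inner product below the square of the modulus of
      \<open>bdot g (r i)\<close>.\<close>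
    define \<zeta> where "\<zeta> = cnj (bdot g (r i))"
    have "outer (axis i \<zeta>) g *v v = 0 *s v" by (simp add: outer_mult_vec g)
    from eq[OF this] have "inner R (outer (axis i \<zeta>) g) = 0" unfolding R_def by simp
    moreover have "inner R (outer (axis i \<zeta>) g) = Re (cnj (\<zeta> * bdot g (r i)))"
    proof -
      have "R *v vcnj g = (\<chi> k. cnj (bdot g (r k)))"
        by (simp add: vec_eq_iff matrix_vector_mult_def bdot_def r_def mult.commute)
      moreover have "vcnj (axis i \<zeta>) = axis i (cnj \<zeta>)" by (simp add: vec_eq_iff axis_def)
      ultimately show ?thesis unfolding inner_commute[of R] inner_outer by (simp add: bdot_axis)
    qed
    ultimately have "Re (cnj (bdot g (r i)) * bdot g (r i)) = 0" unfolding \<zeta>_def by (simp add: mult.commute)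
    then have "(cmod (bdot g (r i)))\<^sup>2 = 0" unfolding cmod_power2 by (simp add: power2_eq_square)
    then show "bdot g (r i) = 0" by simp
  qed
  then have "\<exists>k. r i = k *s v" for i using v(1) parallel_imp_scale by metis
  then obtain k where k: "\<And>i. r i = k i *s v" by metis
  define \<alpha> where "\<alpha> = (\<chi> i. k i)"
  have "R $ i $ l = cnj (k i * v $ l)" for i l
    using k[of i] by (metis complex_cnj_cnj r_def vec_lambda_beta vector_smult_component)
  then have R: "R = outer (vcnj \<alpha>) (vcnj v)" by (simp add: vec_eq_iff \<alpha>_def)
  \<comment> \<open>Scalar matrices have every vector as eigenvector; \<open>s = 1\<close> and
    \<open>s = \<i>\<close> determine real and imaginary part of the trace.\<close>
  have "Re (s * bdot \<alpha> v) = Re (cnj \<mu> * s)" for s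
    using eq[OF mat_mult_vec[of s v]] unfolding R_def[symmetric] R inner_outer by (simp add: mat_mult_vec)
  from this[of 1] this[of \<i>] have "bdot \<alpha> v = cnj \<mu>" by (simp add: complex_eq_iff)
  moreover have "bdot (vcnj \<alpha>) (vcnj v) = cnj (bdot \<alpha> v)" by (simp add: bdot_def)
  ultimately have "cmod (bdot (vcnj \<alpha>) (vcnj v)) = cmod c" using v(3) dj by simp
  then show ?thesis using R unfolding R_def c_def by blast
qed

lemma tendsto_linear: "linear f \<Longrightarrow> (g \<longlongrightarrow> l) F \<Longrightarrow> ((\<lambda>x. f (g x)) \<longlongrightarrow> f l) F"
  for f :: "'a::euclidean_space \<Rightarrow> 'b::real_normed_vector"
  using bounded_linear.tendsto linear_conv_bounded_linear by blast

text \<open>Pairs with \<open>bdot a b = 0\<close> are limits of pairs with nonzero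
  \<open>bdot\<close>, and both the minors and the trace are continuous.\<close>

lemma S_outer: "rank_le_one (S (outer a b)) \<and> cmod (trace (S (outer a b))) = cmod (bdot a b)"
proof (cases "bdot a b = 0")
  case False
  then obtain x y where "S (outer a b) = outer x y" "cmod (bdot x y) = cmod (bdot a b)"
    using S_outer_nonisotropic by blast
  then show ?thesis unfolding rank_le_one_def by (auto simp: trace_outer)
next
  case True
  show ?thesis
  proof (cases "a = 0")
    case True
    then show ?thesis
      using linear_0[OF linS] unfolding rank_le_one_iff_minors by (simp add: trace_def bdot_def)
  next
    case False
    \<comment> \<open>\<open>bdot a (vcnj a)\<close> is the squared norm of \<open>a\<close>, so
      \<open>bdot a (B t)\<close> is nonzero for \<open>t > 0\<close>.\<close>
    define B where "B t = b + t *\<^sub>R vcnj a" for t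
    have pos: "\<forall>\<^sub>F t::real in at_right 0. t > 0" by (simp add: eventually_at_right_less)
    have nz: "bdot a (B t) \<noteq> 0" if "t > 0" for t
    proof -
      have "bdot a (vcnj a) = of_real (\<Sum>i\<in>UNIV. (cmod (a $ i))\<^sup>2)"
        unfolding bdot_def of_real_sum by (simp only: complex_norm_square vcnj_component)
      moreover have "(\<Sum>i\<in>UNIV. (cmod (a $ i))\<^sup>2) \<noteq> 0"
        using False by (simp add: sum_nonneg_eq_0_iff vec_eq_iff)
      moreover have "bdot a (B t) = of_real t * bdot a (vcnj a)"
      proof -
        have "t *\<^sub>R vcnj a = of_real t *s vcnj a" by (simp add: vec_eq_iff complex_eq_iff)
        then show ?thesis unfolding B_def bdot_add_right True by simp
      qed
      ultimately show ?thesis using that by (simp only: mult_eq_0_iff of_real_eq_0_iff) simp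
    qed
    define X where "X t = S (outer a (B t))" for t
    have good: "rank_le_one (X t) \<and> cmod (trace (X t)) = cmod (bdot a (B t))" if "t > 0" for t
      using S_outer_nonisotropic[OF nz[OF that]] unfolding X_def rank_le_one_def by (auto simp: trace_outer)
    have B0: "(B \<longlongrightarrow> b + 0 *\<^sub>R vcnj a) (at_right 0)" unfolding B_def by (intro tendsto_intros)
    then have "((\<lambda>t. outer a (B t)) \<longlongrightarrow> outer a b) (at_right 0)"
      unfolding outer_def by (intro vec_tendstoI) (auto intro!: tendsto_intros)
    then have X: "(X \<longlongrightarrow> S (outer a b)) (at_right 0)"
      unfolding X_def by (rule tendsto_linear[OF linS])
    then have Xc: "((\<lambda>t. X t $ i $ j) \<longlongrightarrow> S (outer a b) $ i $ j) (at_right 0)" for i j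
      by (intro tendsto_vec_nth)
    have "S (outer a b) $ i $ j * S (outer a b) $ k $ l - S (outer a b) $ i $ l * S (outer a b) $ k $ j = 0" for i j k l
    proof -
      have lim: "((\<lambda>t. X t $ i $ j * X t $ k $ l - X t $ i $ l * X t $ k $ j) \<longlongrightarrow>
        S (outer a b) $ i $ j * S (outer a b) $ k $ l - S (outer a b) $ i $ l * S (outer a b) $ k $ j) (at_right 0)"
        by (intro tendsto_intros Xc)
      have "\<forall>\<^sub>F t in at_right 0. X t $ i $ j * X t $ k $ l - X t $ i $ l * X t $ k $ j = 0"
        using pos
      proof eventually_elim
        case (elim t)
        then have "\<forall>i j k l. X t $ i $ j * X t $ k $ l = X t $ i $ l * X t $ k $ j"
          using good unfolding rank_le_one_iff_minors by blast
        then show ?case by simp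
      qed
      from Lim_transform_eventually[OF lim this] show ?thesis by (simp add: tendsto_const_iff)
    qed
    then have "rank_le_one (S (outer a b))" unfolding rank_le_one_iff_minors by simp
    moreover have "((\<lambda>t. cmod (trace (X t)) - cmod (bdot a (B t))) \<longlongrightarrow>
        cmod (trace (S (outer a b))) - cmod (bdot a b)) (at_right 0)"
      unfolding trace_def bdot_def using B0 by (intro tendsto_intros Xc) auto
    then have "((\<lambda>t. 0) \<longlongrightarrow> cmod (trace (S (outer a b))) - cmod (bdot a b)) (at_right (0::real))"
    proof (rule Lim_transform_eventually)
      show "\<forall>\<^sub>F t in at_right 0. cmod (trace (X t)) - cmod (bdot a (B t)) = 0"
        using pos by eventually_elim (use good in auto)
    qed
    then have "cmod (trace (S (outer a b))) = cmod (bdot a b)" by (simp add: tendsto_const_iff)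
    ultimately show ?thesis ..
  qed
qed

lemma S_inj: "S M = 0 \<Longrightarrow> M = 0"
  using inner_S[of M "T M"] TiT[of M] by simp

lemma S_surj: "surj S"
proof -
  have "inj S" by (simp add: linear_injective_0[OF linS] S_inj)
  then show ?thesis using linear_injective_isomorphism[OF linS] by (metis surjI)
qed

text \<open>\<open>T\<close> is the inverse of the adjoint of \<open>S\<close>, and for a similarity
  with unimodular factor this inverse adjoint has the same shape with \<open>madj Q\<close> and
  \<open>madj P\<close>. The isometries \<tau> and \<sigma> stand for identity, transposition or
  conjugation, so one computation serves all four forms.\<close>

lemma recover:
  assumes PQ: "P ** Q = mat 1" "Q ** P = mat 1" and \<gamma>: "cmod \<gamma> = 1"
    and \<tau>: "\<And>X Y. inner (\<tau> X) (\<tau> Y) = inner X Y"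
    and \<sigma>: "\<And>X Y. inner (\<sigma> X) (\<sigma> Y) = inner X Y" "\<And>X. \<sigma> (\<sigma> X) = X"
    and form: "\<And>M. \<tau> (S M) = mscale \<gamma> (P ** \<sigma> M ** Q)"
  shows "\<tau> (T Y) = mscale \<gamma> (madj Q ** \<sigma> Y ** madj P)"
proof -
  define Z where "Z = mscale (cnj \<gamma>) (madj P ** \<tau> (T Y) ** madj Q)"
  have g: "\<gamma> * cnj \<gamma> = 1" using \<gamma> by (simp add: complex_norm_square[symmetric])
  have "inner (\<sigma> M) Z = inner (\<sigma> M) (\<sigma> Y)" for M
  proof -
    have "inner (\<sigma> M) Z = inner (\<tau> (S M)) (\<tau> (T Y))"
      unfolding Z_def form by (rule inner_mscale_conj[symmetric])
    then show ?thesis by (simp add: \<tau> \<sigma> inner_S TiT)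
  qed
  \<comment> \<open>With this argument the first factor becomes \<open>Z - \<sigma> Y\<close>
    itself, because \<sigma> is an involution.\<close>
  from this[of "\<sigma> (Z - \<sigma> Y)"] have "inner (Z - \<sigma> Y) (Z - \<sigma> Y) = 0"
    by (simp add: \<sigma>(2) inner_diff_right)
  then have Z: "Z = \<sigma> Y" by simp
  have m: "madj Q ** madj P = mat 1" "madj P ** madj Q = mat 1"
    using PQ by (simp_all add: madj_mult[symmetric] madj_mat)
  have "mscale \<gamma> (madj Q ** Z ** madj P) = mscale (\<gamma> * cnj \<gamma>) (madj Q ** (madj P ** \<tau> (T Y) ** madj Q) ** madj P)"
    unfolding Z_def by (simp add: mscale_mult_left mscale_mult_right mscale_mscale)
  also have "\<dots> = \<tau> (T Y)"
    unfolding conj_conj[OF m(1)] g by (simp add: vec_eq_iff)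
  finally show ?thesis unfolding Z by simp
qed

lemma linear_form_ge_2:
  assumes n2: "CARD('n) \<ge> 2"
  shows "\<exists>\<gamma> u u'. cmod \<gamma> = 1 \<and> u ** u' = mat 1 \<and> u' ** u = mat 1 \<and>
    ((\<forall>x. T x = mscale \<gamma> (u ** x ** u')) \<or> (\<forall>x. T x = mscale \<gamma> (u ** transpose x ** u')) \<or>
     (\<forall>x. T x = mscale \<gamma> (u ** mcnj x ** u')) \<or> (\<forall>x. T x = mscale \<gamma> (u ** transpose (mcnj x) ** u')))"
proof -
  have tt: "transpose (transpose A) = A" for A :: "complex^'n^'n" by simp
  have "(\<forall>a. colmap (\<lambda>b. S (outer a b))) \<or> (\<forall>a. rowmap (\<lambda>b. S (outer a b)))"
    by (rule all_colmap_or_all_rowmap)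
       (simp_all add: outer_add_left outer_add_right linear_add[OF linS] S_outer)
  then show ?thesis
  proof
    assume "\<forall>a. colmap (\<lambda>b. S (outer a b))"
    then interpret rank_one_preserver S
      by (intro rank_one_preserver.intro) (simp_all add: linS S_inj S_surj S_outer n2)
    obtain \<gamma> P Q where PQ: "cmod \<gamma> = 1" "P ** Q = mat 1" "Q ** P = mat 1"
      and f: "(\<forall>M. S M = mscale \<gamma> (P ** M ** Q)) \<or> (\<forall>M. S M = mscale \<gamma> (P ** mcnj M ** Q))"
      using similarity_form by blast
    have m: "madj Q ** madj P = mat 1" "madj P ** madj Q = mat 1"
      using PQ by (simp_all add: madj_mult[symmetric] madj_mat)
    from f show ?thesis
    proof
      assume "\<forall>M. S M = mscale \<gamma> (P ** M ** Q)"
      then have "T Y = mscale \<gamma> (madj Q ** Y ** madj P)" for Y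
        using recover[OF PQ(2,3,1), of "\<lambda>x. x" "\<lambda>x. x"] by simp
      then show ?thesis using PQ(1) m by blast
    next
      assume "\<forall>M. S M = mscale \<gamma> (P ** mcnj M ** Q)"
      then have "T Y = mscale \<gamma> (madj Q ** mcnj Y ** madj P)" for Y
        using recover[OF PQ(2,3,1), of "\<lambda>x. x" mcnj] by (simp add: inner_mcnj)
      then show ?thesis using PQ(1) m by blast
    qed
  next
    assume row: "\<forall>a. rowmap (\<lambda>b. S (outer a b))"
    have to: "transpose (outer x y) = outer y x" for x y :: "complex^'n"
      by (simp add: vec_eq_iff transpose_def mult.commute)
    have lt: "linear (\<lambda>M. transpose (S M))"
      by (rule linearI) (simp_all add: linear_add[OF linS] linear_cmul[OF linS] vec_eq_iff transpose_def)
    \<comment> \<open>Transposing the values exchanges left and right factors and keeps the trace;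
      the transposition reappears in the form of \<open>T\<close>.\<close>
    interpret rank_one_preserver "\<lambda>M. transpose (S M)"
    proof (rule rank_one_preserver.intro)
      show "linear (\<lambda>M. transpose (S M))" by (rule lt)
      show "M = 0" if "transpose (S M) = 0" for M
      proof -
        have "transpose (0 :: complex^'n^'n) = 0" by (simp add: vec_eq_iff transpose_def)
        then show ?thesis using that S_inj tt[of "S M"] by simp
      qed
      show "surj (\<lambda>M. transpose (S M))"
        unfolding surj_def
      proof
        fix N
        obtain M where "transpose N = S M" using surjD[OF S_surj] by blast
        then have "N = transpose (S M)" using tt[of N] by simp
        then show "\<exists>M. N = transpose (S M)" ..
      qed
      show "rank_le_one (transpose (S (outer a b)))" for a b
        using S_outer[of a b] unfolding rank_le_one_def by (metis to)
      show "cmod (trace (transpose (S (outer a b)))) = cmod (bdot a b)" for a b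
        using S_outer[of a b] by (simp add: trace_def transpose_def)
      show "colmap (\<lambda>b. transpose (S (outer a b)))" for a
        using row unfolding rowmap_def colmap_def by (metis to)
    qed (rule n2)
    obtain \<gamma> P Q where PQ: "cmod \<gamma> = 1" "P ** Q = mat 1" "Q ** P = mat 1"
      and f: "(\<forall>M. transpose (S M) = mscale \<gamma> (P ** M ** Q)) \<or> (\<forall>M. transpose (S M) = mscale \<gamma> (P ** mcnj M ** Q))"
      using similarity_form by blast
    have "transpose (madj P) ** transpose (madj Q) = mat 1" "transpose (madj Q) ** transpose (madj P) = mat 1"
      using PQ by (simp_all add: matrix_transpose_mul[symmetric] madj_mult[symmetric] madj_mat)
    moreover have "(\<forall>x. T x = mscale \<gamma> (transpose (madj P) ** transpose x ** transpose (madj Q))) \<or>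
        (\<forall>x. T x = mscale \<gamma> (transpose (madj P) ** transpose (mcnj x) ** transpose (madj Q)))"
      using f
    proof
      assume "\<forall>M. transpose (S M) = mscale \<gamma> (P ** M ** Q)"
      then have "transpose (T Y) = mscale \<gamma> (madj Q ** Y ** madj P)" for Y
        using recover[OF PQ(2,3,1), of transpose "\<lambda>x. x"] by (simp add: inner_transpose)
      then have "T Y = transpose (mscale \<gamma> (madj Q ** Y ** madj P))" for Y by (metis tt)
      then show ?thesis by (simp add: transpose_mscale matrix_transpose_mul matrix_mul_assoc)
    next
      assume "\<forall>M. transpose (S M) = mscale \<gamma> (P ** mcnj M ** Q)"
      then have "transpose (T Y) = mscale \<gamma> (madj Q ** mcnj Y ** madj P)" for Y
        using recover[OF PQ(2,3,1), of transpose mcnj] by (simp add: inner_transpose inner_mcnj)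
      then have "T Y = transpose (mscale \<gamma> (madj Q ** mcnj Y ** madj P))" for Y by (metis tt)
      then show ?thesis by (simp add: transpose_mscale matrix_transpose_mul matrix_mul_assoc)
    qed
    ultimately show ?thesis using PQ(1) by blast
  qed
qed

text \<open>In dimension one there are no non-parallel vectors, but \<open>T\<close> is then a real
  linear isometry of the complex plane, determined by the images of 1 and
  \<open>\<i>\<close>.\<close>

lemma linear_form_1:
  assumes n1: "CARD('n) = 1"
  shows "\<exists>\<gamma>. cmod \<gamma> = 1 \<and> ((\<forall>x. T x = mscale \<gamma> x) \<or> (\<forall>x. T x = mscale \<gamma> (mcnj x)))"
proof -
  define o' :: 'n where "o' = undefined"
  have all: "i = o'" for i :: 'n using n1 by (metis (full_types) UNIV_I card_1_singletonE singletonD)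
  have U: "(UNIV :: 'n set) = {o'}" using all by auto
  have mat: "M = mat (M $ o' $ o')" for M :: "complex^'n^'n"
  proof -
    have "M $ i $ j = mat (M $ o' $ o') $ i $ j" for i j
      using all[of i] all[of j] by (simp add: mat_def)
    then show ?thesis unfolding vec_eq_iff by blast
  qed
  have sr: "spec_rad (mat c :: complex^'n^'n) = cmod c" for c
  proof (rule antisym)
    show "spec_rad (mat c :: complex^'n^'n) \<le> cmod c"
      by (rule spec_rad_leI) (simp add: mat_mult_vec)
    show "cmod c \<le> spec_rad (mat c :: complex^'n^'n)"
      by (rule spec_rad_ge_eigenvector[of "axis o' 1"]) (simp_all add: mat_mult_vec axis_eq_0_iff)
  qed
  define t where "t c = T (mat c) $ o' $ o'" for c
  have tm: "T (mat c) = mat (t c)" for c unfolding t_def by (rule mat)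
  have norm_t: "cmod (t c) = cmod c" for c using rho[of "mat c"] by (simp add: tm sr)
  have mat_add: "(mat (x + y) :: complex^'n^'n) = mat x + mat y" for x y by (simp add: vec_eq_iff mat_def)
  have mat_sc: "(mat (r *\<^sub>R x) :: complex^'n^'n) = r *\<^sub>R mat x" for r x by (simp add: vec_eq_iff mat_def)
  have t_lin: "t (Re c *\<^sub>R 1 + Im c *\<^sub>R \<i>) = Re c *\<^sub>R t 1 + Im c *\<^sub>R t \<i>" for c
    unfolding t_def mat_add mat_sc by (simp add: linear_add[OF linT] linear_cmul[OF linT])
  have split: "Re c *\<^sub>R 1 + Im c *\<^sub>R \<i> = c" for c by (simp add: complex_eq_iff)
  have t_eq: "t c = Re c *\<^sub>R t 1 + Im c *\<^sub>R t \<i>" for c using t_lin[of c] unfolding split .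
  define \<gamma> where "\<gamma> = t 1"
  define w where "w = cnj \<gamma> * t \<i>"
  have \<gamma>: "cmod \<gamma> = 1" unfolding \<gamma>_def norm_t by simp
  have w1: "cmod w = 1" unfolding w_def by (simp add: norm_mult norm_t \<gamma>)
  \<comment> \<open>Here \<open>w\<close> is the quotient of \<open>t \<i>\<close> by
    \<open>t 1\<close>; the squared modulus 2 at \<open>1 + \<i>\<close> leaves no room for a real
    part of \<open>w\<close>.\<close>
  have "(cmod (t (1 + \<i>)))\<^sup>2 = (cmod \<gamma>)\<^sup>2 + 2 * Re w + (cmod (t \<i>))\<^sup>2"
    using t_eq[of "1 + \<i>"] cmod_add_squared[of \<gamma> "t \<i>"] by (simp add: \<gamma>_def w_def)
  then have "Re w = 0" unfolding norm_t \<gamma> by (simp add: cmod_power2)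
  moreover have "(Re w)\<^sup>2 + (Im w)\<^sup>2 = 1" using w1 by (metis cmod_power2 one_power2)
  ultimately have "Im w = 1 \<or> Im w = -1" by (simp add: power2_eq_1_iff)
  moreover have "\<gamma> * w = t \<i>"
    unfolding w_def mult.assoc[symmetric] using \<gamma> by (simp add: complex_norm_square[symmetric])
  ultimately have "t \<i> = \<gamma> * \<i> \<or> t \<i> = \<gamma> * (- \<i>)"
    using \<open>Re w = 0\<close> by (metis complex_eq_iff imaginary_unit.simps uminus_complex.simps add.inverse_neutral)
  then show ?thesis
  proof
    assume i: "t \<i> = \<gamma> * \<i>"
    have "t c = \<gamma> * c" for c
      unfolding t_eq[of c] i \<gamma>_def[symmetric] by (simp add: complex_eq_iff algebra_simps)
    then have "T (mat (x $ o' $ o')) = mscale \<gamma> x" for x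
      using mat[of "mscale \<gamma> x"] by (simp add: tm)
    then have "T x = mscale \<gamma> x" for x using mat[of x] by metis
    then show ?thesis using \<gamma> by blast
  next
    assume i: "t \<i> = \<gamma> * (- \<i>)"
    have "t c = \<gamma> * cnj c" for c
      unfolding t_eq[of c] i \<gamma>_def[symmetric] by (simp add: complex_eq_iff algebra_simps)
    then have "T (mat (x $ o' $ o')) = mscale \<gamma> (mcnj x)" for x
      using mat[of "mscale \<gamma> (mcnj x)"] by (simp add: tm)
    then have "T x = mscale \<gamma> (mcnj x)" for x using mat[of x] by metis
    then show ?thesis using \<gamma> by blast
  qed
qed

lemma linear_form:
  "\<exists>\<gamma> u u'. cmod \<gamma> = 1 \<and> u ** u' = mat 1 \<and> u' ** u = mat 1 \<and>
    ((\<forall>x. T x = mscale \<gamma> (u ** x ** u')) \<or> (\<forall>x. T x = mscale \<gamma> (u ** transpose x ** u')) \<or>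
     (\<forall>x. T x = mscale \<gamma> (u ** mcnj x ** u')) \<or> (\<forall>x. T x = mscale \<gamma> (u ** transpose (mcnj x) ** u')))"
proof (cases "CARD('n) \<ge> 2")
  case True
  then show ?thesis by (rule linear_form_ge_2)
next
  case False
  moreover have "CARD('n) > 0" by simp
  ultimately have "CARD('n) = 1" by linarith
  from linear_form_1[OF this] show ?thesis
    by (metis matrix_mul_lid matrix_mul_rid)
qed

end

section \<open>The derivative at the origin and the proof of the theorem\<close>

lemma derivative_preserves_spec_rad:
  fixes F :: "complex^'n^'n \<Rightarrow> complex^'n^'n"
  assumes U: "open U" "a \<in> U" and der: "(F has_derivative T) (at a)"
    and iso: "\<And>x y. x \<in> U \<Longrightarrow> y \<in> U \<Longrightarrow> spec_rad (F x - F y) = spec_rad (x - y)"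
  shows "spec_rad (T h) = spec_rad h"
proof -
  obtain r where r: "r > 0" "ball a r \<subseteq> U" using U by (meson openE)
  \<comment> \<open>Small enough that every point \<open>a + t k *\<^sub>R h\<close> lies in
    \<open>U\<close>; each difference quotient then has exactly the spectral radius of
    \<open>h\<close>.\<close>
  define t where "t k = r / (norm h + 1) / real (Suc k)" for k
  have p: "norm h + 1 > 0" by (simp add: add_nonneg_pos)
  have t0: "t k > 0" for k unfolding t_def using r p by simp
  have "t \<longlonglongrightarrow> 0"
    using tendsto_mult[OF tendsto_const[of "r / (norm h + 1)"] LIMSEQ_inverse_real_of_nat]
    unfolding t_def by (simp add: divide_inverse)
  then have "filterlim t (at_right 0) sequentially"
    unfolding filterlim_at using t0 by (auto intro!: always_eventually simp: less_imp_neq[OF t0, symmetric])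
  from filterlim_compose[OF has_derivative_directional[OF der] this]
  have "(\<lambda>k. (1 / t k) *\<^sub>R (F (a + t k *\<^sub>R h) - F a)) \<longlonglongrightarrow> T h" .
  moreover have "spec_rad ((1 / t k) *\<^sub>R (F (a + t k *\<^sub>R h) - F a)) = spec_rad h" for k
  proof -
    have "t k \<le> r / (norm h + 1)" unfolding t_def using r p by (simp add: divide_le_eq mult_le_cancel_left1)
    then have "t k * (norm h + 1) \<le> r" using p by (simp add: le_divide_eq)
    then have "t k * norm h < r" using t0[of k] by (simp add: distrib_left)
    then have "a + t k *\<^sub>R h \<in> U" using r(2) t0[of k] by (auto simp: dist_norm)
    then show ?thesis using iso[of "a + t k *\<^sub>R h" a] U(2) t0[of k] by (simp add: spec_rad_scaleR)
  qed
  ultimately show ?thesis by (rule spec_rad_limit)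
qed

text \<open>Cramer's rule for two coordinates in which the minor \<open>D\<close> is
  nonzero.\<close>

lemma functional_two_values:
  assumes "\<not> parallel x y"
  obtains g where "bdot g x = 1" "bdot g y = 1"
proof -
  obtain i j where ij: "x $ i * y $ j - x $ j * y $ i \<noteq> 0"
    using assms unfolding parallel_def by auto
  define D where "D = x $ i * y $ j - x $ j * y $ i"
  define g where "g = axis i ((y $ j - x $ j) / D) + axis j ((x $ i - y $ i) / D)"
  have "bdot g x = ((y $ j - x $ j) * x $ i + (x $ i - y $ i) * x $ j) / D"
    by (simp add: g_def bdot_add_left bdot_axis add_divide_distrib)
  also have "\<dots> = 1" using ij unfolding D_def by (simp add: algebra_simps)
  finally have 1: "bdot g x = 1" .
  have "bdot g y = ((y $ j - x $ j) * y $ i + (x $ i - y $ i) * y $ j) / D"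
    by (simp add: g_def bdot_add_left bdot_axis add_divide_distrib)
  also have "\<dots> = 1" using ij unfolding D_def by (simp add: algebra_simps)
  finally show thesis using 1 that by blast
qed

text \<open>A nonzero \<open>h\<close> in the kernel has spectral radius 0, so some
  \<open>h *v e\<close> is not parallel to \<open>e\<close>. The matrix \<open>y\<close> sends
  \<open>e\<close> to \<open>e - h *v e\<close> and has square zero, so \<open>h + y\<close> fixes
  \<open>e\<close> while its spectral radius would equal that of \<open>y\<close>, which is
  0.\<close>

lemma spec_rad_preserver_kernel:
  fixes T :: "complex^'n^'n \<Rightarrow> complex^'n^'n"
  assumes lin: "linear T" and rho: "\<And>x. spec_rad (T x) = spec_rad x" and h: "T h = 0"
  shows "h = 0"
proof (rule ccontr)
  assume "h \<noteq> 0"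
  then obtain e where e: "h *v e \<noteq> 0" by (metis matrix_eq matrix_vector_mult_0)
  have "spec_rad (0 :: complex^'n^'n) = 0" using spec_rad_mscale[of 0 0] by (simp add: vec_eq_iff mscale_def flip: zero_vec_def)
  then have rh: "spec_rad h = 0" using rho[of h] h by simp
  have "\<not> parallel e (h *v e)"
  proof
    assume "parallel e (h *v e)"
    moreover have "e \<noteq> 0" using e by auto
    ultimately obtain c where c: "h *v e = c *s e" by (rule parallel_imp_scale)
    then have "cmod c \<le> 0" using spec_rad_ge_eigenvector[OF \<open>e \<noteq> 0\<close> c] rh by simp
    then show False using c e by simp
  qed
  then obtain g where g: "bdot g e = 1" "bdot g (h *v e) = 1" by (rule functional_two_values)
  define y where "y = outer (e - h *v e) g"
  have "(h + y) *v e = 1 *s e"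
    by (simp add: y_def matrix_vector_mult_add_rdistrib outer_mult_vec g)
  moreover have "e \<noteq> 0" using e by auto
  ultimately have "1 \<le> spec_rad (h + y)" using spec_rad_ge_eigenvector by fastforce
  also have "\<dots> = spec_rad (T (h + y))" by (rule rho[symmetric])
  also have "T (h + y) = T y" by (simp add: linear_add[OF lin] h)
  also have "spec_rad (T y) = spec_rad y" by (rule rho)
  also have "spec_rad y \<le> 0"
  proof (rule spec_rad_leI)
    fix c v assume v: "v \<noteq> 0" "y *v v = c *s v"
    have "bdot g (e - h *v e) = 0" using g by (simp add: bdot_commute[of g] bdot_diff_left)
    then have "y *v (y *v v) = 0"
      unfolding y_def outer_mult_vec bdot_scale_right by (simp only: mult_zero_right vector_smult_lzero)
    then have "(c * c) *s v = 0" unfolding v(2) by (simp add: vector_scalar_commute v(2) vector_smult_assoc)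
    then show "cmod c \<le> 0" using v(1) by simp
  qed
  finally show False by simp
qed

theorem theorem6:
  fixes U :: "(complex^'n^'n) set"
    and F :: "complex^'n^'n \<Rightarrow> complex^'n^'n"
    and F' :: "complex^'n^'n \<Rightarrow> ((complex^'n^'n) \<Rightarrow>\<^sub>L (complex^'n^'n))"
  assumes "open U" and "connected U" and "0 \<in> U"
    and "\<And>x. x \<in> U \<Longrightarrow> (F has_derivative blinfun_apply (F' x)) (at x)"
    and "continuous_on U F'"
    and "F 0 = 0"
    and "\<And>x y. x \<in> U \<Longrightarrow> y \<in> U \<Longrightarrow> spec_rad (F x - F y) = spec_rad (x - y)"
  shows "\<exists>\<gamma> u. cmod \<gamma> = 1 \<and> invertible u \<and>
           (\<exists>H. (H = (\<lambda>x. mscale (inverse \<gamma>) (F x)) \<or> H = (\<lambda>x. mscale (inverse \<gamma>) (mcnj (F x)))) \<and>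
              ((\<forall>x\<in>U. H x = u ** x ** matrix_inv u) \<or>
               (\<forall>x\<in>U. H x = u ** transpose x ** matrix_inv u)))"
proof -
  define T where "T = blinfun_apply (F' 0)"
  have linT: "linear T" unfolding T_def by (rule bounded_linear.linear[OF blinfun.bounded_linear_right])
  have rho: "spec_rad (T x) = spec_rad x" for x
    unfolding T_def by (rule derivative_preserves_spec_rad[OF assms(1,3) assms(4)[OF assms(3)] assms(7)])
  have "inj T"
    using spec_rad_preserver_kernel[OF linT rho] by (simp add: linear_injective_0[OF linT])
  then obtain Ti where Ti: "linear Ti" "\<And>x. Ti (T x) = x" "\<And>x. T (Ti x) = x"
    using linear_injective_isomorphism[OF linT] by blast
  interpret T: spec_rad_preserver T Ti
    by (rule spec_rad_preserver.intro) (simp_all add: linT Ti rho)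
  have bTi: "bounded_linear Ti" using Ti(1) linear_conv_bounded_linear by blast
  \<comment> \<open>As a bounded operator, so that the derivative of \<open>Ti \<circ> F\<close> is
    again a continuous operator-valued map.\<close>
  define J where "J = Blinfun Ti"
  have J: "blinfun_apply J = Ti" unfolding J_def by (rule bounded_linear_Blinfun_apply[OF bTi])
  interpret G: spec_rad_isometry U "\<lambda>x. Ti (F x)" "\<lambda>x. J o\<^sub>L F' x"
  proof
    show "((\<lambda>x. Ti (F x)) has_derivative blinfun_apply (J o\<^sub>L F' x)) (at x)" if "x \<in> U" for x
    proof -
      have "((\<lambda>x. Ti (F x)) has_derivative (\<lambda>h. Ti (blinfun_apply (F' x) h))) (at x)"
        by (rule bounded_linear.has_derivative[OF bTi assms(4)[OF that]])
      then show ?thesis by (simp add: blinfun_compose.rep_eq J o_def)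
    qed
    show "spec_rad (Ti (F x) - Ti (F y)) = spec_rad (x - y)" if "x \<in> U" "y \<in> U" for x y
    proof -
      have "spec_rad (Ti (F x) - Ti (F y)) = spec_rad (T (Ti (F x - F y)))"
        unfolding rho linear_diff[OF Ti(1)] ..
      then show ?thesis using assms(7)[OF that] by (simp add: Ti(3))
    qed
  qed (rule assms(1))
  have "J o\<^sub>L F' 0 = id_blinfun"
    by (intro blinfun_eqI) (simp add: J Ti(2) T_def[symmetric])
  then have "0 \<in> G.Good" using assms(3,6) linear_0[OF Ti(1)] by (simp add: G.Good_def)
  moreover have "continuous_on U (\<lambda>x. J o\<^sub>L F' x)"
    by (intro continuous_intros assms(5))
  ultimately have "Ti (F x) = x" if "x \<in> U" for x
    using G.identity_on_domain[OF assms(2)] that by blast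
  then have FT: "F x = T x" if "x \<in> U" for x using that Ti(3) by metis
  obtain \<gamma> u u' where u: "cmod \<gamma> = 1" "u ** u' = mat 1" "u' ** u = mat 1"
    and form: "(\<forall>x. T x = mscale \<gamma> (u ** x ** u')) \<or> (\<forall>x. T x = mscale \<gamma> (u ** transpose x ** u')) \<or>
     (\<forall>x. T x = mscale \<gamma> (u ** mcnj x ** u')) \<or> (\<forall>x. T x = mscale \<gamma> (u ** transpose (mcnj x) ** u'))"
    using T.linear_form by blast
  have \<gamma>0: "\<gamma> \<noteq> 0" using u(1) by auto
  have inv: "invertible A \<and> matrix_inv A = B" if "A ** B = mat 1" "B ** A = mat 1" for A B :: "complex^'n^'n"
  proof -
    have i: "invertible A" using that unfolding invertible_def by blast
    have "A ** matrix_inv A = mat 1 \<and> matrix_inv A ** A = mat 1"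
      unfolding matrix_inv_def by (rule someI_ex) (use that in blast)
    then have "A ** matrix_inv A = mat 1" ..
    then have "matrix_inv A = B" by (metis that(2) matrix_mul_assoc matrix_mul_lid matrix_mul_rid)
    then show ?thesis using i by blast
  qed
  have cancel: "mscale (inverse \<gamma>) (mscale \<gamma> A) = A" "mscale (inverse (cnj \<gamma>)) (mscale (cnj \<gamma>) A) = A"
    for A :: "complex^'n^'n"
    using \<gamma>0 by (simp_all add: mscale_mscale vec_eq_iff)
  have cu: "mcnj u ** mcnj u' = mat 1" "mcnj u' ** mcnj u = mat 1"
    using u by (simp_all add: mcnj_mult[symmetric] mcnj_mat)
  have tc: "mcnj (transpose (mcnj x)) = transpose x" for x :: "complex^'n^'n"
    by (simp add: vec_eq_iff transpose_def)
  from form show ?thesis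
  proof (elim disjE)
    assume "\<forall>x. T x = mscale \<gamma> (u ** x ** u')"
    then have "\<forall>x\<in>U. mscale (inverse \<gamma>) (F x) = u ** x ** matrix_inv u"
      using inv[OF u(2,3)] by (simp add: FT cancel)
    then show ?thesis using u(1) inv[OF u(2,3)] by blast
  next
    assume "\<forall>x. T x = mscale \<gamma> (u ** transpose x ** u')"
    then have "\<forall>x\<in>U. mscale (inverse \<gamma>) (F x) = u ** transpose x ** matrix_inv u"
      using inv[OF u(2,3)] by (simp add: FT cancel)
    then show ?thesis using u(1) inv[OF u(2,3)] by blast
  next
    assume "\<forall>x. T x = mscale \<gamma> (u ** mcnj x ** u')"
    \<comment> \<open>Conjugating the formula for \<open>F\<close> conjugates scalar and similarity
      as well, so \<open>cnj \<gamma>\<close> and \<open>mcnj u\<close> are the witnesses.\<close>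
    then have "\<forall>x\<in>U. mscale (inverse (cnj \<gamma>)) (mcnj (F x)) = mcnj u ** x ** matrix_inv (mcnj u)"
      using inv[OF cu] by (simp add: FT mcnj_mscale mcnj_mult cancel)
    moreover have "cmod (cnj \<gamma>) = 1" using u(1) by simp
    ultimately show ?thesis using inv[OF cu] by blast
  next
    assume "\<forall>x. T x = mscale \<gamma> (u ** transpose (mcnj x) ** u')"
    then have "\<forall>x\<in>U. mscale (inverse (cnj \<gamma>)) (mcnj (F x)) = mcnj u ** transpose x ** matrix_inv (mcnj u)"
      using inv[OF cu] by (simp add: FT mcnj_mscale mcnj_mult cancel tc)
    moreover have "cmod (cnj \<gamma>) = 1" using u(1) by simp
    ultimately show ?thesis using inv[OF cu] by blast
  qed
qed

end
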